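(* Let $B=H^\bullet(S^2;\mathbb Z_2)=\mathbb Z_2 e\oplus\mathbb Z_2 s$ (unit $e$ in degree $0$, $|s|=-2$, $s\cdot s=0$, zero differential), and let $\widetilde F$ be the homotopy inner product for $B$ whose only non-zero values on basis elements are $$\widetilde F_{0,0}(s)(e)=1,\qquad \widetilde F_{0,0}(e)(s)=1,\qquad \widetilde F_{2,0}(\underline s,\underline s;e)(e)=1 ;$$ it arises as the transfer $f(F)$ to cohomology of the local homotopy inner product $F$ on the simplicial cochain algebra $A$ of the tetrahedral triangulation of $S^2$, along the dg-algebra map $f:B\to A$ (with $A$, $F$, $f$ as in the context). Let $\widetilde{\mathcal F}:HH^\bullet(B,B)\to HH^\bullet(B,B^* )$ be the isomorphism induced by $\widetilde F$, and let $\widetilde\Delta:=\widetilde{\mathcal F}^{-1}\circ\mathcal B\circ\widetilde{\mathcal F}$, where $\mathcal B$ is Connes' operator. Then the BV algebra $(HH^\bullet(B,B),\smile,\widetilde\Delta)$ induced by $\widetilde F$ is isomorphic, as a BV algebra, to the string topology BV algebra $(\mathbb H_\bullet(LS^2;\mathbb Z_2),\cdot,\Delta_{\mathrm{ST}})$, i.e. to the BV algebra with $\mathbb Z_2$-basis $\{\alpha_k\}_{k\ge0}\cup\{\beta_k\}_{k\ge 0}$, $|\alpha_k|=k$, $|\beta_k|=k-2$, product $$\alpha_k\cdot\alpha_\ell=\alpha_{k+\ell},\quad \beta_k\cdot\beta_\ell=0,\quad \alpha_k\cdot\beta_\ell=\beta_\ell\cdot\alpha_k=\beta_{k+\ell},$$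 and operator $$\Delta_{\mathrm{ST}}(\alpha_k)=0,\qquad \Delta_{\mathrm{ST}}(\beta_k)=k\,\alpha_{k-1}+k\,\beta_{k+1}.$$
   Context: The ground ring is $\mathbb Z_2=\mathbb Z/2\mathbb Z$, so signs are omitted. Differentials lower degree by one. For a graded module $A$, $\underline A$ is $A$ shifted up by one: $\underline A_j=A_{j-1}$. **Modules.** A unital dg-algebra $A$ is a dg-bimodule over itself; its dual $A^*$, with $A^*_j=\mathrm{Hom}(A_{-j},\mathbb Z_2)$, is a dg-bimodule via $(n.a)(m)=n(a m)$, $(a.n)(m)=n(m a)$ and $d(n)(m)=n(dm)$. **Hochschild cochains.** For a dg-bimodule $M$ over $A$, let $CH^\bullet(A,M)=\prod_{r\ge0}\mathrm{Hom}(\underline A^{\otimes r},M)$ (graded Hom), with differential $\mathcal D=\mathcal D_0+\mathcal D_1$, where for $\varphi\in \mathrm{Hom}(\underline A^{\otimes r},M)$: $\mathcal D_0(\varphi)(\underline{a_1},\dots,\underline{a_r})=d(\varphi(\underline{a_1},\dots,\underline{a_r}))+\sum_j\varphi(\underline{a_1},\dots,\underline{da_j},\dots,\underline{a_r})$ and $\mathcal D_1(\varphi)(\underline{a_1},\dots,\underline{a_{r+1}})=a_1.\varphi(\underline{a_2},\dots,\underline{a_{r+1}})+\sum_{j=1}^r\varphi(\underline{a_1},\dots,\underline{a_ja_{j+1}},\dots,\underline{a_{r+1}})+\varphi(\underline{a_1},\dots,\underline{a_r}).a_{r+1}$. The normalized subcomplex $\overline{CH}^\bullet(A,M)$ consists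 of those cochains vanishing when any input is $\underline 1$; its cohomology is $HH^\bullet(A,M)$. The cup product on $HH^\bullet(A,A)$ is induced by $(\varphi\smile\rho)(\underline{a_1},\dots,\underline{a_{r+s}})=\varphi(\underline{a_1},\dots,\underline{a_r})\cdot\rho(\underline{a_{r+1}},\dots,\underline{a_{r+s}})$. Connes' operator $\mathcal B$ on $HH^\bullet(A,A^* )$ is induced by, for $\varphi\in\mathrm{Hom}(\underline A^{\otimes r},A^* )$, $\mathcal B(\varphi)\in \mathrm{Hom}(\underline A^{\otimes r-1},A^* )$, $\mathcal B(\varphi)(\underline{a_1},\dots,\underline{a_{r-1}})(a_r)=\sum_{j=1}^r\varphi(\underline{a_j},\dots,\underline{a_r},\underline{a_1},\dots,\underline{a_{j-1}})(1)$ (and $\mathcal B(\varphi)=0$ if $r=0$). **Homotopy inner products.** For a family $F=\{F_{p,q}:\underline A^{\otimes p}\otimes A\otimes\underline A^{\otimes q}\to A^*\}_{p,q\ge0}$ define $\mathcal D F$ as follows: $(\mathcal DF)_{p,q}(\underline{a_1},\dots,\underline{a_p};m;\underline{b_1},\dots,\underline{b_q})(n)$ is the sum of all terms obtained from $F_{p,q}(\underline{a_1},\dots,\underline{a_p};m;\underline{b_1},\dots,\underline{b_q})(n)$ by applying $d$ to exactly one of the inputs $a_1,\dots,a_p,m,b_1,\dots,b_q,n$, plus the following terms: if $p\ge1$, $F_{p-1,q}(\underline{a_2},\dots,\underline{a_p};m;\underline{b_1},\dots,\underline{b_q})(n a_1)$, $\sum_{j=1}^{p-1}F_{p-1,q}(\underline{a_1},\dots,\underline{a_ja_{j+1}},\dots,\underline{a_p};m;\underline{b_1},\dots,\underline{b_q})(n)$,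 $F_{p-1,q}(\underline{a_1},\dots,\underline{a_{p-1}};a_pm;\underline{b_1},\dots,\underline{b_q})(n)$; if $q\ge1$, $F_{p,q-1}(\underline{a_1},\dots,\underline{a_p};mb_1;\underline{b_2},\dots,\underline{b_q})(n)$, $\sum_{j=1}^{q-1}F_{p,q-1}(\underline{a_1},\dots,\underline{a_p};m;\underline{b_1},\dots,\underline{b_jb_{j+1}},\dots,\underline{b_q})(n)$, $F_{p,q-1}(\underline{a_1},\dots,\underline{a_p};m;\underline{b_1},\dots,\underline{b_{q-1}})(b_qn)$. $F$ is a homotopy inner product for $A$ if $\mathcal DF=0$; it is always assumed to vanish when one of the underlined inputs is $\underline 1$. It induces a cochain map $\mathcal F=\sum_{p,q}\mathcal F_{p,q}:\overline{CH}^\bullet(A,A)\to\overline{CH}^\bullet(A,A^* )$, where for $\varphi\in \mathrm{Hom}(\underline A^{\otimes r},A)$, $\mathcal F_{p,q}(\varphi)(\underline{a_1},\dots,\underline{a_{p+r+q}})=F_{p,q}(\underline{a_1},\dots,\underline{a_p};\varphi(\underline{a_{p+1}},\dots,\underline{a_{p+r}});\underline{a_{p+r+1}},\dots,\underline{a_{p+r+q}})$; the induced map on Hochschild cohomology is also denoted $\mathcal F$. For a dg-algebra map $f:B\to A$, the transferred homotopy inner product $f(F)$ for $B$ is obtained by applying $f$ to all inputs (including the module input and the argument $n$) and then $F$. **Local model.** $A$ is the simplicial cochain algebra of the boundary of the $3$-simplex with ordered vertices $0,1,2,3$: basis $e_j$ (degree $0$), $b_{ij}$, $i<j$ (degree $-1$),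 $c_{ijl}$, $i<j<l$ (degree $-2$); the differential sends a basis element indexed by a simplex to the sum of the basis elements indexed by simplices of one dimension higher containing it (and $d c_{ijl}=0$); non-zero products are $e_je_j=e_j$, $e_ib_{ij}=b_{ij}=b_{ij}e_j$, $e_ic_{ijl}=c_{ijl}=c_{ijl}e_l$, $b_{ij}b_{jl}=c_{ijl}$. For $i<j<l$, $F^{[ijl]}$ has only components with $q=0$, with only the following non-zero values on basis elements. For all $k\ge0$: $F_{k,0}(\underline{b_{il}},\dots,\underline{b_{il}};m)(n)=1$ for $(m,n)\in\{(c_{ijl},e_l),(e_i,c_{ijl}),(b_{ij},b_{jl})\}$. For all $k\ge0$, $1\le t\le k+1$, with $\underline{c_{ijl}}$ in the $t$-th of $k+1$ positions: $F_{k+1,0}(\underline{b_{ij}},\dots,\underline{b_{ij}},\underline{c_{ijl}},\underline{b_{il}},\dots,\underline{b_{il}};m)(n)=1$ for $(m,n)\in\{(e_i,b_{ij}),(b_{ij},e_j)\}$ and $F_{k+1,0}(\underline{b_{il}},\dots,\underline{b_{il}},\underline{c_{ijl}},\underline{b_{jl}},\dots,\underline{b_{jl}};m)(n)=1$ for $(m,n)\in\{(e_j,b_{jl}),(b_{jl},e_l)\}$. For all $k\ge0$, $1\le t_1<t_2\le k+2$, with $\underline{c_{ijl}}$ in positions $t_1$ and $t_2$ of $k+2$ positions: $F_{k+2,0}(\underline{b_{ij}},\dots,\underline{b_{ij}},\underline{c_{ijl}},\underline{b_{il}},\dots,\underline{b_{il}},\underline{c_{ijl}},\underline{b_{jl}},\dots,\underline{b_{jl}};e_j)(e_j)=1$.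 Then $F:=F^{[012]}+F^{[013]}+F^{[023]}+F^{[123]}$. The map $f:B\to A$ is $f(e)=e_0+e_1+e_2+e_3$, $f(s)=c_{012}$. **String topology.** $LS^2$ is the free loop space and $\mathbb H_\bullet(LS^2;\mathbb Z_2)=H_{\bullet+2}(LS^2;\mathbb Z_2)$, with the Chas–Sullivan loop product and BV operator; by a known computation of Menichi this BV algebra is the explicit one displayed in the claim. An isomorphism of BV algebras is an isomorphism of graded algebras commuting with the $\Delta$ operators. *)

theory Defs
  imports
    Complex_Main
    "HOL-Library.Z2"
    "HOL-Library.Poly_Mapping"
    "HOL-Library.Function_Algebras"
    "HOL-Algebra.QuotRing"
begin

text \<open>
  The ground ring is the field \<^typ>\<open>bit\<close> with two elements.  A vector space over it is an
  abelian group in which \<open>x + x = 0\<close>, and a linear map is an additive map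
  (\<^const>\<open>additive\<close>), so no scalar multiplication is mentioned below.  All signs are omitted.
\<close>

section \<open>Graded complexes and their cohomology\<close>

record 'v gr_complex =
  part :: "int \<Rightarrow> 'v set"
  diff :: "'v \<Rightarrow> 'v"

text \<open>The direct sum of the homogeneous parts: finite sums of homogeneous elements.\<close>

definition total_space :: "('v::ab_group_add, 'x) gr_complex_scheme \<Rightarrow> 'v set" where
  "total_space X = {x. \<exists>c. (\<forall>k. c k \<in> part X k) \<and> finite {k. c k \<noteq> 0} \<and> x = (\<Sum>k | c k \<noteq> 0. c k)}"

definition graded_space :: "('v::ab_group_add, 'x) gr_complex_scheme \<Rightarrow> bool" where
  "graded_space X \<longleftrightarrow>
     (\<forall>k. 0 \<in> part X k \<and> (\<forall>x\<in>part X k. x + x = 0 \<and> (\<forall>y\<in>part X k. x + y \<in> part X k))) \<and>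
     (\<forall>c. (\<forall>k. c k \<in> part X k) \<and> finite {k. c k \<noteq> 0} \<and> (\<Sum>k | c k \<noteq> 0. c k) = 0
          \<longrightarrow> (\<forall>k. c k = 0))"

definition cochain_map ::
  "('v::ab_group_add, 'x) gr_complex_scheme \<Rightarrow> ('w::ab_group_add, 'y) gr_complex_scheme
     \<Rightarrow> ('v \<Rightarrow> 'w) \<Rightarrow> bool" where
  "cochain_map X Y f \<longleftrightarrow>
     (\<forall>x\<in>total_space X. f x \<in> total_space Y \<and> f (diff X x) = diff Y (f x) \<and>
        (\<forall>y\<in>total_space X. f (x + y) = f x + f y))"

text \<open>A cohomology class is the coset of a cocycle modulo the coboundaries.\<close>

definition coh_class :: "('v::ab_group_add, 'x) gr_complex_scheme \<Rightarrow> 'v \<Rightarrow> 'v set" where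
  "coh_class X x = {x + diff X y | y. y \<in> total_space X}"

definition class_add :: "'v::ab_group_add set \<Rightarrow> 'v set \<Rightarrow> 'v set" where
  "class_add a b = {x + y | x y. x \<in> a \<and> y \<in> b}"

text \<open>The additive group of all classes, in the multiplicative notation of \<^typ>\<open>'a monoid\<close>.\<close>

definition cohomology :: "('v::ab_group_add, 'x) gr_complex_scheme \<Rightarrow> 'v set monoid" where
  "cohomology X =
     \<lparr>carrier = coh_class X ` {x \<in> total_space X. diff X x = 0},
      monoid.mult = class_add,
      one = coh_class X 0\<rparr>"

definition coh_part :: "('v::ab_group_add, 'x) gr_complex_scheme \<Rightarrow> int \<Rightarrow> 'v set set" where
  "coh_part X k = coh_class X ` {x \<in> part X k. diff X x = 0}"

text \<open>
  Maps induced on classes.  The union runs over all representatives, so the result is a class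
  only if it does not depend on the representative.
\<close>

definition induced ::
  "('w::ab_group_add, 'y) gr_complex_scheme \<Rightarrow> ('v \<Rightarrow> 'w) \<Rightarrow> 'v set \<Rightarrow> 'w set" where
  "induced Y f a = (\<Union>x\<in>a. coh_class Y (f x))"

definition induced2 ::
  "('w::ab_group_add, 'y) gr_complex_scheme \<Rightarrow> ('u \<Rightarrow> 'v \<Rightarrow> 'w) \<Rightarrow> 'u set \<Rightarrow> 'v set \<Rightarrow> 'w set" where
  "induced2 Y f a b = (\<Union>x\<in>a. \<Union>y\<in>b. coh_class Y (f x y))"

section \<open>Dg-algebras and dg-bimodules\<close>

text \<open>The underlying vector space of a dg-algebra is the whole type \<^typ>\<open>'a\<close>.\<close>

record 'a dg_alg = "'a gr_complex" +
  mul :: "'a \<Rightarrow> 'a \<Rightarrow> 'a"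
  unit :: 'a

definition dg_algebra :: "('a::ab_group_add) dg_alg \<Rightarrow> bool" where
  "dg_algebra A \<longleftrightarrow>
     graded_space A \<and> total_space A = UNIV \<and>
     additive (diff A) \<and>
     (\<forall>k. diff A ` part A k \<subseteq> part A (k - 1)) \<and>
     (\<forall>x. diff A (diff A x) = 0) \<and>
     (\<forall>x. additive (mul A x) \<and> additive (\<lambda>y. mul A y x)) \<and>
     (\<forall>i j. \<forall>x\<in>part A i. \<forall>y\<in>part A j. mul A x y \<in> part A (i + j)) \<and>
     (\<forall>x y z. mul A (mul A x y) z = mul A x (mul A y z)) \<and>
     unit A \<in> part A 0 \<and>
     (\<forall>x. mul A (unit A) x = x \<and> mul A x (unit A) = x) \<and>
     (\<forall>x y. diff A (mul A x y) = mul A (diff A x) y + mul A x (diff A y))"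

definition dg_algebra_map ::
  "('b::ab_group_add) dg_alg \<Rightarrow> ('a::ab_group_add) dg_alg \<Rightarrow> ('b \<Rightarrow> 'a) \<Rightarrow> bool" where
  "dg_algebra_map B A f \<longleftrightarrow>
     additive f \<and> (\<forall>k. f ` part B k \<subseteq> part A k) \<and> (\<forall>x. f (diff B x) = diff A (f x)) \<and>
     (\<forall>x y. f (mul B x y) = mul A (f x) (f y)) \<and> f (unit B) = unit A"

record ('a, 'm) dg_bimod = "'m gr_complex" +
  lact :: "'a \<Rightarrow> 'm \<Rightarrow> 'm"
  ract :: "'m \<Rightarrow> 'a \<Rightarrow> 'm"

definition self_bimod :: "('a::ab_group_add) dg_alg \<Rightarrow> ('a, 'a) dg_bimod" where
  "self_bimod A = \<lparr>part = part A, diff = diff A, lact = mul A, ract = mul A\<rparr>"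

text \<open>
  \<open>Hom(A\<^sub>-\<^sub>j, \<int>/2)\<close> is encoded as the set of linear functionals on the whole algebra
  that vanish on all parts other than the one of degree \<open>-j\<close>.
\<close>

definition dual_bimod :: "('a::ab_group_add) dg_alg \<Rightarrow> ('a, 'a \<Rightarrow> bit) dg_bimod" where
  "dual_bimod A =
     \<lparr>part = (\<lambda>j. {n. additive n \<and> (\<forall>i. i \<noteq> - j \<longrightarrow> (\<forall>m\<in>part A i. n m = 0))}),
      diff = (\<lambda>n m. n (diff A m)),
      lact = (\<lambda>a n m. n (mul A m a)),
      ract = (\<lambda>n a m. n (mul A a m))\<rparr>"

section \<open>Normalized Hochschild cochains\<close>

text \<open>
  A family \<open>(\<phi>\<^sub>r)\<^sub>r\<close> of maps in \<open>r\<close> variables is encoded as a single function on lists, whose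
  restriction to the lists of length \<open>r\<close> is \<open>\<phi>\<^sub>r\<close>.
\<close>

definition multilinear :: "('a::ab_group_add list \<Rightarrow> 'm::ab_group_add) \<Rightarrow> bool" where
  "multilinear \<phi> \<longleftrightarrow>
     (\<forall>xs y z ys. \<phi> (xs @ (y + z) # ys) = \<phi> (xs @ y # ys) + \<phi> (xs @ z # ys))"

definition normalized :: "('a::ab_group_add) dg_alg \<Rightarrow> ('a list \<Rightarrow> 'm::ab_group_add) \<Rightarrow> bool" where
  "normalized A \<phi> \<longleftrightarrow> (\<forall>as. unit A \<in> set as \<longrightarrow> \<phi> as = 0)"

text \<open>Replace the neighbours in positions \<open>j\<close> and \<open>j + 1\<close> (counted from 0) by their product.\<close>

definition merge :: "('a::ab_group_add) dg_alg \<Rightarrow> nat \<Rightarrow> 'a list \<Rightarrow> 'a list" where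
  "merge A j as = take j as @ mul A (as ! j) (as ! Suc j) # drop (Suc (Suc j)) as"

definition apply_diff :: "('a::ab_group_add) dg_alg \<Rightarrow> nat \<Rightarrow> 'a list \<Rightarrow> 'a list" where
  "apply_diff A j as = as[j := diff A (as ! j)]"

text \<open>
  In degree \<open>k\<close>, inputs of degrees \<open>i\<^sub>1, \<dots>, i\<^sub>r\<close> are sent to degree
  \<open>k + (i\<^sub>1 + 1) + \<dots> + (i\<^sub>r + 1)\<close>, because of the shift of the inputs.  The product over \<open>r\<close> is
  taken degree by degree: a homogeneous cochain may have infinitely many non-zero components,
  while an element of the total space is a finite sum of homogeneous ones.
\<close>

definition CH_part ::
  "('a::ab_group_add) dg_alg \<Rightarrow> ('a, 'm::ab_group_add) dg_bimod \<Rightarrow> int \<Rightarrow> ('a list \<Rightarrow> 'm) set" where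
  "CH_part A M k = {\<phi>. multilinear \<phi> \<and> normalized A \<phi> \<and>
     (\<forall>as ds. list_all2 (\<lambda>a i. a \<in> part A i) as ds
        \<longrightarrow> \<phi> as \<in> part M (k + (\<Sum>i\<leftarrow>ds. i + 1)))}"

definition CH_diff ::
  "('a::ab_group_add) dg_alg \<Rightarrow> ('a, 'm::ab_group_add) dg_bimod \<Rightarrow> ('a list \<Rightarrow> 'm) \<Rightarrow> 'a list \<Rightarrow> 'm" where
  "CH_diff A M \<phi> as =
     diff M (\<phi> as) + (\<Sum>j<length as. \<phi> (apply_diff A j as)) +
     (if as = [] then 0
      else lact M (hd as) (\<phi> (tl as)) + (\<Sum>j<length as - 1. \<phi> (merge A j as))
           + ract M (\<phi> (butlast as)) (last as))"

definition CH ::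
  "('a::ab_group_add) dg_alg \<Rightarrow> ('a, 'm::ab_group_add) dg_bimod \<Rightarrow> ('a list \<Rightarrow> 'm) gr_complex" where
  "CH A M = \<lparr>part = CH_part A M, diff = CH_diff A M\<rparr>"

definition cup ::
  "('a::ab_group_add) dg_alg \<Rightarrow> ('a list \<Rightarrow> 'a) \<Rightarrow> ('a list \<Rightarrow> 'a) \<Rightarrow> 'a list \<Rightarrow> 'a" where
  "cup A \<phi> \<rho> as = (\<Sum>r\<le>length as. mul A (\<phi> (take r as)) (\<rho> (drop r as)))"

definition cup_unit :: "('a::ab_group_add) dg_alg \<Rightarrow> 'a list \<Rightarrow> 'a" where
  "cup_unit A as = (if as = [] then unit A else 0)"

text \<open>
  The cyclic permutations of \<open>(a\<^sub>1, \<dots>, a\<^sub>r)\<close> are its rotations by \<open>j = 0, \<dots>, r - 1\<close>, where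
  \<open>r \<ge> 1\<close> is one more than the number of inputs of the result; the component \<open>r = 0\<close> of \<open>\<phi>\<close>
  is never used.
\<close>

definition Connes ::
  "('a::ab_group_add) dg_alg \<Rightarrow> ('a list \<Rightarrow> 'a \<Rightarrow> bit) \<Rightarrow> 'a list \<Rightarrow> 'a \<Rightarrow> bit" where
  "Connes A \<phi> as a = (\<Sum>j<Suc (length as). \<phi> (rotate j (as @ [a])) (unit A))"

section \<open>Homotopy inner products\<close>

text \<open>
  \<open>F [a\<^sub>1, \<dots>, a\<^sub>p] m [b\<^sub>1, \<dots>, b\<^sub>q] n\<close> stands for
  \<open>F\<^sub>p\<^sub>,\<^sub>q(a\<^sub>1, \<dots>, a\<^sub>p; m; b\<^sub>1, \<dots>, b\<^sub>q)(n)\<close>.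
\<close>

type_synonym 'a hip = "'a list \<Rightarrow> 'a \<Rightarrow> 'a list \<Rightarrow> 'a \<Rightarrow> bit"

definition hip_diff :: "('a::ab_group_add) dg_alg \<Rightarrow> 'a hip \<Rightarrow> 'a hip" where
  "hip_diff A F as m bs n =
     (\<Sum>j<length as. F (apply_diff A j as) m bs n) + F as (diff A m) bs n
     + (\<Sum>j<length bs. F as m (apply_diff A j bs) n) + F as m bs (diff A n)
     + (if as = [] then 0
        else F (tl as) m bs (mul A n (hd as))
             + (\<Sum>j<length as - 1. F (merge A j as) m bs n)
             + F (butlast as) (mul A (last as) m) bs n)
     + (if bs = [] then 0
        else F as (mul A m (hd bs)) (tl bs) n
             + (\<Sum>j<length bs - 1. F as m (merge A j bs) n)
             + F as m (butlast bs) (mul A (last bs) n))"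

definition homotopy_inner_product :: "('a::ab_group_add) dg_alg \<Rightarrow> 'a hip \<Rightarrow> bool" where
  "homotopy_inner_product A F \<longleftrightarrow>
     (\<forall>as m bs. F as m bs \<in> total_space (dual_bimod A)) \<and>
     (\<forall>m bs. multilinear (\<lambda>as. F as m bs)) \<and>
     (\<forall>as bs. additive (\<lambda>m. F as m bs)) \<and>
     (\<forall>as m. multilinear (F as m)) \<and>
     (\<forall>as m bs. unit A \<in> set as \<union> set bs \<longrightarrow> F as m bs = 0) \<and>
     (\<forall>as m bs n. hip_diff A F as m bs n = 0)"

definition hip_map :: "('a::ab_group_add) hip \<Rightarrow> ('a list \<Rightarrow> 'a) \<Rightarrow> 'a list \<Rightarrow> 'a \<Rightarrow> bit" where
  "hip_map F \<phi> as =
     (\<Sum>p\<le>length as. \<Sum>q\<le>length as - p.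
        F (take p as) (\<phi> (take (length as - p - q) (drop p as))) (drop (length as - q) as))"

definition transfer_hip :: "('b \<Rightarrow> 'a) \<Rightarrow> 'a hip \<Rightarrow> 'b hip" where
  "transfer_hip f F as m bs n = F (map f as) (f m) (map f bs) (f n)"

section \<open>BV algebras\<close>

record 'a bv_alg = "'a ring" +
  bv_part :: "int \<Rightarrow> 'a set"
  bv_op :: "'a \<Rightarrow> 'a"

text \<open>
  Graded commutativity is commutativity over \<open>\<int>/2\<close>, and the last condition is the
  seven-term relation, which says that the operator has order at most two.
\<close>

definition bv_algebra :: "'a bv_alg \<Rightarrow> bool" where
  "bv_algebra R \<longleftrightarrow>
     cring R \<and>
     (\<forall>x\<in>carrier R. x \<oplus>\<^bsub>R\<^esub> x = \<zero>\<^bsub>R\<^esub>) \<and>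
     (\<forall>k. subgroup (bv_part R k) (add_monoid R)) \<and>
     (\<forall>x\<in>carrier R. \<exists>!c. (\<forall>k. c k \<in> bv_part R k) \<and> finite {k. c k \<noteq> \<zero>\<^bsub>R\<^esub>} \<and>
        x = (\<Oplus>\<^bsub>R\<^esub>k\<in>{k. c k \<noteq> \<zero>\<^bsub>R\<^esub>}. c k)) \<and>
     \<one>\<^bsub>R\<^esub> \<in> bv_part R 0 \<and>
     (\<forall>i j. \<forall>x\<in>bv_part R i. \<forall>y\<in>bv_part R j. x \<otimes>\<^bsub>R\<^esub> y \<in> bv_part R (i + j)) \<and>
     bv_op R \<in> hom (add_monoid R) (add_monoid R) \<and>
     (\<forall>k. bv_op R ` bv_part R k \<subseteq> bv_part R (k + 1)) \<and>
     (\<forall>x\<in>carrier R. bv_op R (bv_op R x) = \<zero>\<^bsub>R\<^esub>) \<and>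
     (\<forall>x\<in>carrier R. \<forall>y\<in>carrier R. \<forall>z\<in>carrier R.
        bv_op R (x \<otimes>\<^bsub>R\<^esub> y \<otimes>\<^bsub>R\<^esub> z) =
          bv_op R (x \<otimes>\<^bsub>R\<^esub> y) \<otimes>\<^bsub>R\<^esub> z \<oplus>\<^bsub>R\<^esub> x \<otimes>\<^bsub>R\<^esub> bv_op R (y \<otimes>\<^bsub>R\<^esub> z)
          \<oplus>\<^bsub>R\<^esub> y \<otimes>\<^bsub>R\<^esub> bv_op R (x \<otimes>\<^bsub>R\<^esub> z)
          \<oplus>\<^bsub>R\<^esub> bv_op R x \<otimes>\<^bsub>R\<^esub> y \<otimes>\<^bsub>R\<^esub> z \<oplus>\<^bsub>R\<^esub> x \<otimes>\<^bsub>R\<^esub> bv_op R y \<otimes>\<^bsub>R\<^esub> z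
          \<oplus>\<^bsub>R\<^esub> x \<otimes>\<^bsub>R\<^esub> y \<otimes>\<^bsub>R\<^esub> bv_op R z)"

definition bv_isomorphic :: "'a bv_alg \<Rightarrow> 'b bv_alg \<Rightarrow> bool" where
  "bv_isomorphic R S \<longleftrightarrow>
     (\<exists>h\<in>ring_iso R S. (\<forall>k. h ` bv_part R k = bv_part S k) \<and>
        (\<forall>x\<in>carrier R. h (bv_op R x) = bv_op S (h x)))"

abbreviation HH_self :: "('a::ab_group_add) dg_alg \<Rightarrow> ('a list \<Rightarrow> 'a) set monoid" where
  "HH_self A \<equiv> cohomology (CH A (self_bimod A))"

abbreviation HH_dual :: "('a::ab_group_add) dg_alg \<Rightarrow> ('a list \<Rightarrow> 'a \<Rightarrow> bit) set monoid" where
  "HH_dual A \<equiv> cohomology (CH A (dual_bimod A))"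

definition HH_hip_map ::
  "('a::ab_group_add) dg_alg \<Rightarrow> 'a hip \<Rightarrow> ('a list \<Rightarrow> 'a) set \<Rightarrow> ('a list \<Rightarrow> 'a \<Rightarrow> bit) set" where
  "HH_hip_map A F = induced (CH A (dual_bimod A)) (hip_map F)"

definition HH_Connes ::
  "('a::ab_group_add) dg_alg \<Rightarrow> ('a list \<Rightarrow> 'a \<Rightarrow> bit) set \<Rightarrow> ('a list \<Rightarrow> 'a \<Rightarrow> bit) set" where
  "HH_Connes A = induced (CH A (dual_bimod A)) (Connes A)"

definition HH_bv :: "('a::ab_group_add) dg_alg \<Rightarrow> 'a hip \<Rightarrow> ('a list \<Rightarrow> 'a) set bv_alg" where
  "HH_bv A F =
     \<lparr>carrier = carrier (HH_self A),
      monoid.mult = induced2 (CH A (self_bimod A)) (cup A),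
      one = coh_class (CH A (self_bimod A)) (cup_unit A),
      zero = coh_class (CH A (self_bimod A)) 0,
      add = class_add,
      bv_part = coh_part (CH A (self_bimod A)),
      bv_op = (\<lambda>x. inv_into (carrier (HH_self A)) (HH_hip_map A F)
                     (HH_Connes A (HH_hip_map A F x)))\<rparr>"

section \<open>Vector spaces with a basis\<close>

text \<open>
  The space with basis \<^typ>\<open>'b\<close> is \<^typ>\<open>'b \<Rightarrow>\<^sub>0 bit\<close>.  A vector is the sum of the basis vectors in
  its support (\<^const>\<open>Poly_Mapping.keys\<close>), so a (multi)linear extension is a sum over supports.
\<close>

abbreviation bas :: "'b \<Rightarrow> 'b \<Rightarrow>\<^sub>0 bit" where
  "bas b \<equiv> Poly_Mapping.single b 1"

definition lin :: "('b \<Rightarrow> 'v::comm_monoid_add) \<Rightarrow> ('b \<Rightarrow>\<^sub>0 bit) \<Rightarrow> 'v" where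
  "lin g x = (\<Sum>b\<in>Poly_Mapping.keys x. g b)"

definition bilin ::
  "('b \<Rightarrow> 'c \<Rightarrow> 'v::comm_monoid_add) \<Rightarrow> ('b \<Rightarrow>\<^sub>0 bit) \<Rightarrow> ('c \<Rightarrow>\<^sub>0 bit) \<Rightarrow> 'v" where
  "bilin g x y = (\<Sum>b\<in>Poly_Mapping.keys x. \<Sum>c\<in>Poly_Mapping.keys y. g b c)"

definition hip_lin :: "'b hip \<Rightarrow> ('b \<Rightarrow>\<^sub>0 bit) hip" where
  "hip_lin G as m bs n =
     (\<Sum>as'\<in>listset (map Poly_Mapping.keys as). \<Sum>m'\<in>Poly_Mapping.keys m.
      \<Sum>bs'\<in>listset (map Poly_Mapping.keys bs). \<Sum>n'\<in>Poly_Mapping.keys n.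
        G as' m' bs' n')"

definition basis_part :: "('b \<Rightarrow> int) \<Rightarrow> int \<Rightarrow> ('b \<Rightarrow>\<^sub>0 bit) set" where
  "basis_part dg k = {x. \<forall>b\<in>Poly_Mapping.keys x. dg b = k}"

section \<open>The cohomology algebra of the 2-sphere\<close>

datatype sph = Cls_e | Cls_s

fun sph_deg :: "sph \<Rightarrow> int" where
  "sph_deg Cls_e = 0"
| "sph_deg Cls_s = - 2"

fun sph_mul :: "sph \<Rightarrow> sph \<Rightarrow> (sph \<Rightarrow>\<^sub>0 bit)" where
  "sph_mul Cls_e x = bas x"
| "sph_mul Cls_s Cls_e = bas Cls_s"
| "sph_mul Cls_s Cls_s = 0"

definition sphB :: "(sph \<Rightarrow>\<^sub>0 bit) dg_alg" where
  "sphB = \<lparr>part = basis_part sph_deg, diff = (\<lambda>x. 0), mul = bilin sph_mul, unit = bas Cls_e\<rparr>"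

definition sphF :: "(sph \<Rightarrow>\<^sub>0 bit) hip" where
  "sphF = hip_lin (\<lambda>as m bs n. of_bool ((as, m, bs, n) \<in>
     {([], Cls_s, [], Cls_e), ([], Cls_e, [], Cls_s), ([Cls_s, Cls_s], Cls_e, [], Cls_e)}))"

section \<open>Simplicial cochains of the boundary of the tetrahedron\<close>

datatype smplx =
    E0 | E1 | E2 | E3
  | B01 | B02 | B03 | B12 | B13 | B23
  | C012 | C013 | C023 | C123

fun verts :: "smplx \<Rightarrow> nat list" where
  "verts E0 = [0]" | "verts E1 = [1]" | "verts E2 = [2]" | "verts E3 = [3]"
| "verts B01 = [0,1]" | "verts B02 = [0,2]" | "verts B03 = [0,3]"
| "verts B12 = [1,2]" | "verts B13 = [1,3]" | "verts B23 = [2,3]"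
| "verts C012 = [0,1,2]" | "verts C013 = [0,1,3]" | "verts C023 = [0,2,3]" | "verts C123 = [1,2,3]"

definition tet_deg :: "smplx \<Rightarrow> int" where
  "tet_deg \<sigma> = 1 - int (length (verts \<sigma>))"

definition tet_diff :: "smplx \<Rightarrow> (smplx \<Rightarrow>\<^sub>0 bit)" where
  "tet_diff \<sigma> =
     (\<Sum>\<tau> | set (verts \<sigma>) \<subseteq> set (verts \<tau>) \<and> length (verts \<tau>) = Suc (length (verts \<sigma>)). bas \<tau>)"

text \<open>
  The product of \<open>[i\<^sub>0, \<dots>, i\<^sub>p]\<close> and \<open>[i\<^sub>p, \<dots>, i\<^sub>p\<^sub>+\<^sub>q]\<close> is \<open>[i\<^sub>0, \<dots>, i\<^sub>p\<^sub>+\<^sub>q]\<close> if this is a simplex,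
  and all other products of basis elements are 0; so the following sum has at most one term.
\<close>

definition tet_mul :: "smplx \<Rightarrow> smplx \<Rightarrow> (smplx \<Rightarrow>\<^sub>0 bit)" where
  "tet_mul \<sigma> \<tau> =
     (\<Sum>\<rho> | last (verts \<sigma>) = hd (verts \<tau>) \<and> verts \<rho> = verts \<sigma> @ tl (verts \<tau>). bas \<rho>)"

definition tetA :: "(smplx \<Rightarrow>\<^sub>0 bit) dg_alg" where
  "tetA = \<lparr>part = basis_part tet_deg, diff = lin tet_diff, mul = bilin tet_mul,
           unit = bas E0 + bas E1 + bas E2 + bas E3\<rparr>"

text \<open>
  The non-zero values of the local homotopy inner product of the triangle \<open>i < j < l\<close>, with
  every simplex given by its list of vertices (so \<open>[i]\<close>, \<open>[i, j]\<close>, \<open>[i, j, l]\<close> are the basis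
  elements \<open>e\<close>, \<open>b\<close>, \<open>c\<close> with these indices).  In the last three cases the position of the
  2-simplex among the inputs is encoded by the lengths \<open>u\<close>, \<open>v\<close>, \<open>w\<close> of the runs around it.
\<close>

definition local_support ::
  "nat \<Rightarrow> nat \<Rightarrow> nat \<Rightarrow> nat list list \<Rightarrow> nat list \<Rightarrow> nat list \<Rightarrow> bool" where
  "local_support i j l as m n \<longleftrightarrow>
     (\<exists>k. as = replicate k [i,l] \<and>
        (m, n) \<in> {([i,j,l], [l]), ([i], [i,j,l]), ([i,j], [j,l])}) \<or>
     (\<exists>u v. as = replicate u [i,j] @ [i,j,l] # replicate v [i,l] \<and>
        (m, n) \<in> {([i], [i,j]), ([i,j], [j])}) \<or>
     (\<exists>u v. as = replicate u [i,l] @ [i,j,l] # replicate v [j,l] \<and>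
        (m, n) \<in> {([j], [j,l]), ([j,l], [l])}) \<or>
     (\<exists>u v w. as = replicate u [i,j] @ [i,j,l] # replicate v [i,l] @ [i,j,l] # replicate w [j,l] \<and>
        (m, n) = ([j], [j]))"

definition localF :: "nat \<Rightarrow> nat \<Rightarrow> nat \<Rightarrow> (smplx \<Rightarrow>\<^sub>0 bit) hip" where
  "localF i j l = hip_lin (\<lambda>as m bs n.
     of_bool (bs = [] \<and> local_support i j l (map verts as) (verts m) (verts n)))"

definition tetF :: "(smplx \<Rightarrow>\<^sub>0 bit) hip" where
  "tetF = localF 0 1 2 + localF 0 1 3 + localF 0 2 3 + localF 1 2 3"

fun sph_to_tet :: "sph \<Rightarrow> (smplx \<Rightarrow>\<^sub>0 bit)" where
  "sph_to_tet Cls_e = bas E0 + bas E1 + bas E2 + bas E3"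
| "sph_to_tet Cls_s = bas C012"

section \<open>The string topology BV algebra of the 2-sphere\<close>

text \<open>
  \<open>\<H>\<^sub>\<bullet>(LS\<^sup>2; \<int>/2)\<close> with the loop product and the BV operator, in the explicit form computed
  by Menichi.
\<close>

datatype st_gen = Alpha nat | Beta nat

fun st_deg :: "st_gen \<Rightarrow> int" where
  "st_deg (Alpha k) = int k"
| "st_deg (Beta k) = int k - 2"

fun st_mul :: "st_gen \<Rightarrow> st_gen \<Rightarrow> (st_gen \<Rightarrow>\<^sub>0 bit)" where
  "st_mul (Alpha k) (Alpha l) = bas (Alpha (k + l))"
| "st_mul (Alpha k) (Beta l) = bas (Beta (k + l))"
| "st_mul (Beta k) (Alpha l) = bas (Beta (k + l))"
| "st_mul (Beta k) (Beta l) = 0"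

text \<open>For \<open>k = 0\<close> the truncated index \<open>k - 1\<close> is harmless, since its coefficient is \<open>k = 0\<close>.\<close>

fun st_delta :: "st_gen \<Rightarrow> (st_gen \<Rightarrow>\<^sub>0 bit)" where
  "st_delta (Alpha k) = 0"
| "st_delta (Beta k) =
     Poly_Mapping.single (Alpha (k - 1)) (of_nat k) + Poly_Mapping.single (Beta (k + 1)) (of_nat k)"

definition string_bv :: "(st_gen \<Rightarrow>\<^sub>0 bit) bv_alg" where
  "string_bv =
     \<lparr>carrier = UNIV, monoid.mult = bilin st_mul, one = bas (Alpha 0), zero = 0, add = (+),
      bv_part = basis_part st_deg, bv_op = lin st_delta\<rparr>"

end

(*
  The values of the local family F at (m; n) depend only on the product m n, so F amounts to a
  Hochschild cochain of A with values in the dual, that is to a noncommutative power series G x in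
  the basis elements for every basis element x.  Every G x is a sum of products of 2-simplices c
  and geometric series 1/(1 + b) of edges b.  The closedness equation becomes an identity in the
  ring of power series with the derivation T dual to the differential and the product; it follows
  from T c = b_ij + b_il + b_jl + e_i c + c e_l + b_ij b_jl for c = c_ijl, together with the
  analogous formula for 1/(1 + b), and from the fact that every edge lies in exactly two triangles.

  Over B all normalized Hochschild cochains are cocycles: a cochain is determined by its values on
  (s, ..., s), and the product of two entries s vanishes.  So both cohomologies have a basis
  indexed by two copies of the natural numbers, on which the inner product, Connes' operator
  and the cup product are explicit.
*)
theory Submission
  imports Defs
begin

section \<open>Linear extension over the field with two elements\<close>

text \<open>The power series work because the formulas factor. For an edge,
  \<open>T b = e_i (1 + b) + (1 + b) e_j\<close>; with \<open>S = 1/(1 + b)\<close> this gives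
  \<open>T S = S e_i + e_j S\<close>. For a triangle,
  \<open>T c = (1 + b_ij) (1 + b_jl) + (1 + b_il) + e_i c + c e_l\<close>, and the factors facing
  the series next to \<open>c\<close> in \<open>G x\<close> cancel against them. A single triangle
  is not closed: in the equation of each of its three edges it leaves exactly the series
  \<open>S\<close> of that edge. On a closed surface these remainders cancel in pairs modulo 2.

  On the sphere, in suitable coordinates, \<open>F_{0,0}\<close> is the identity, while
  \<open>F_{2,0}\<close> adds \<open>Beta (k + 2)\<close> to \<open>Alpha k\<close>. Conjugation
  with this map turns Connes' operator, which sends \<open>Beta k\<close> to \<open>k\<close> times
  \<open>Alpha (k - 1)\<close>, into one with the additional summand \<open>k\<close> times
  \<open>Beta (k + 1)\<close>. This is the second summand of the string topology operator.\<close>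

class char_two = ab_group_add +
  assumes add_self [simp]: "x + x = 0"
begin

text \<open>After \<open>add_ac\<close> has sorted a right-nested sum, equal summands are neighbours
  and this rule removes them; the long identities below are closed in this way.\<close>

lemma add_self_left [simp]: "x + (x + y) = y"
  by (simp flip: add.assoc)

lemma add_eq_0_iff_eq: "x + y = 0 \<longleftrightarrow> x = y"
  using add_left_imp_eq[of x y x] by auto

end

instance bit :: char_two
  by standard (simp add: Z2.bit_eq_iff)

text \<open>Sums and products of bits stay in ring form, so that general ring and sum lemmas apply
  to coefficients.\<close>

declare add_bit_eq_xor [simp del] mult_bit_eq_and [simp del]

instance "fun" :: (type, char_two) char_two
  by standard (simp add: fun_eq_iff)

instance poly_mapping :: (type, char_two) char_two
  by standard (simp add: poly_mapping_eq_iff fun_eq_iff lookup_add)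

lemma lin_superset:
  assumes "finite K" "Poly_Mapping.keys x \<subseteq> K"
  shows "lin g x = (\<Sum>b\<in>K. if Poly_Mapping.lookup x b = 1 then g b else 0)"
  unfolding lin_def using assms
  by (intro sum.mono_neutral_cong_left) (auto simp: in_keys_iff)

lemma lin_UNIV:
  fixes x :: "'b::finite \<Rightarrow>\<^sub>0 bit"
  shows "lin g x = (\<Sum>b\<in>UNIV. if Poly_Mapping.lookup x b = 1 then g b else 0)"
  by (intro lin_superset) auto

lemma lin_0 [simp]: "lin g 0 = 0"
  by (simp add: lin_def)

lemma lin_bas [simp]: "lin g (bas b) = g b"
  by (simp add: lin_def)

lemma lin_add [simp]:
  fixes g :: "'b \<Rightarrow> 'v::char_two"
  shows "lin g (x + y) = lin g x + lin g y"
proof -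
  \<comment> \<open>\<open>keys\<close> is not additive: a basis vector common to \<open>x\<close>
    and \<open>y\<close> disappears from \<open>x + y\<close>. Over a common superset it contributes
    \<open>g b + g b = 0\<close>.\<close>
  let ?K = "Poly_Mapping.keys x \<union> Poly_Mapping.keys y"
  have "Poly_Mapping.keys (x + y) \<subseteq> ?K"
    by (rule Poly_Mapping.keys_add)
  then show ?thesis
    by (auto simp: lin_superset[of ?K] lookup_add simp flip: sum.distrib intro!: sum.cong)
qed

lemma additive_lin: "additive (lin (g :: 'b \<Rightarrow> 'v::char_two))"
  by (simp add: additive_def)

lemma lin_cong: "(\<And>b. b \<in> Poly_Mapping.keys x \<Longrightarrow> g b = h b) \<Longrightarrow> lin g x = lin h x"
  by (simp add: lin_def)

lemma lin_zero_fun [simp]: "lin (\<lambda>b. 0) x = 0"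
  by (simp add: lin_def)

lemma lin_add_fun: "lin (\<lambda>b. g b + h b) x = lin g x + lin h x"
  by (simp add: lin_def sum.distrib)

lemma lin_mult_left: "lin (\<lambda>b. c * g b) x = (c::'v::semiring_0) * lin g x"
  by (simp add: lin_def sum_distrib_left)

lemma sum_fun_apply: "sum f I x = (\<Sum>i\<in>I. f i x)"
  by (induction I rule: infinite_finite_induct) simp_all

lemma lookup_lin: "Poly_Mapping.lookup (lin g x) c = lin (\<lambda>b. Poly_Mapping.lookup (g b) c) x"
  by (simp add: lin_def lookup_sum)

lemma lin_bas_id [simp]: "lin bas x = x"
proof (rule poly_mapping_eqI)
  fix c
  have "Poly_Mapping.lookup (lin bas x) c = (\<Sum>b\<in>Poly_Mapping.keys x. if b = c then 1 else 0)"
    by (simp add: lin_def lookup_sum lookup_single when_def)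
  then show "Poly_Mapping.lookup (lin bas x) c = Poly_Mapping.lookup x c"
    by (cases "Poly_Mapping.lookup x c") (simp_all add: in_keys_iff)
qed

lemma additive_comp_lin: "additive f \<Longrightarrow> f (lin g x) = lin (\<lambda>b. f (g b)) x"
  unfolding lin_def by (rule additive.sum)

lemma lin_lin: "lin (g :: 'b \<Rightarrow> 'v::char_two) (lin h x) = lin (\<lambda>b. lin g (h b)) x"
  by (rule additive_comp_lin[OF additive_lin])

lemma lin_swap: "lin (\<lambda>b. lin (\<lambda>c. g b c) y) x = lin (\<lambda>c. lin (\<lambda>b. g b c) x) y"
  unfolding lin_def by (rule sum.swap)

lemma additive_eq_lin: "additive f \<Longrightarrow> f x = lin (\<lambda>b. f (bas b)) x"
  using additive_comp_lin[of f bas x] by simp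

lemma additive_eqI:
  assumes "additive f" "additive g" "\<And>b. f (bas b) = g (bas b)"
  shows "f x = g (x :: 'b \<Rightarrow>\<^sub>0 bit)"
  using additive_eq_lin[OF assms(1), of x] additive_eq_lin[OF assms(2), of x] assms(3) by simp

lemma additive_add: "additive f \<Longrightarrow> f (x + y) = f x + f y"
  by (simp add: additive_def)

lemma bilin_lin: "bilin g x y = lin (\<lambda>b. lin (g b) y) x"
  by (simp add: bilin_def lin_def)

lemma bilin_bas [simp]: "bilin g (bas b) (bas c) = g b c"
  by (simp add: bilin_lin)

lemma bilin_add [simp]:
  fixes g :: "'b \<Rightarrow> 'c \<Rightarrow> 'v::char_two"
  shows "bilin g (x + x') y = bilin g x y + bilin g x' y"
    "bilin g x (y + y') = bilin g x y + bilin g x y'"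
  by (simp_all add: bilin_lin lin_add_fun)

lemma bilin_0 [simp]: "bilin g 0 y = 0" "bilin g x 0 = 0"
  by (simp_all add: bilin_lin)

lemma additive_bilin:
  fixes g :: "'b \<Rightarrow> 'c \<Rightarrow> 'v::char_two"
  shows "additive (bilin g x)" "additive (\<lambda>x. bilin g x y)"
  by (simp_all add: additive_def)

lemma biadditive_eqI:
  assumes "\<And>x. additive (f x)" "\<And>y. additive (\<lambda>x. f x y)"
    and "\<And>x. additive (g x)" "\<And>y. additive (\<lambda>x. g x y)"
    and "\<And>b c. f (bas b) (bas c) = g (bas b) (bas c)"
  shows "f x y = g (x :: 'b \<Rightarrow>\<^sub>0 bit) (y :: 'c \<Rightarrow>\<^sub>0 bit)"
proof -
  have "f (bas b) y = g (bas b) y" for b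
    by (rule additive_eqI[OF assms(1,3,5)])
  then show ?thesis
    by (rule additive_eqI[OF assms(2,4)])
qed

lemma triadditive_eqI:
  assumes "\<And>x y. additive (f x y)" "\<And>x z. additive (\<lambda>y. f x y z)" "\<And>y z. additive (\<lambda>x. f x y z)"
    and "\<And>x y. additive (g x y)" "\<And>x z. additive (\<lambda>y. g x y z)" "\<And>y z. additive (\<lambda>x. g x y z)"
    and "\<And>b c d. f (bas b) (bas c) (bas d) = g (bas b) (bas c) (bas d)"
  shows "f x y z = g (x :: 'b \<Rightarrow>\<^sub>0 bit) (y :: 'c \<Rightarrow>\<^sub>0 bit) (z :: 'd \<Rightarrow>\<^sub>0 bit)"
proof -
  have "f (bas b) y z = g (bas b) y z" for b
    by (rule biadditive_eqI[of "f (bas b)" "g (bas b)", OF assms(1,2,4,5,7)])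
  then show ?thesis
    by (rule additive_eqI[OF assms(3,6)])
qed

section \<open>Graded spaces and algebras with a homogeneous basis\<close>

lemma basis_part_iff: "x \<in> basis_part dg k \<longleftrightarrow> (\<forall>b. Poly_Mapping.lookup x b = 1 \<longrightarrow> dg b = k)"
  by (auto simp: basis_part_def in_keys_iff)

lemma basis_part_0 [simp]: "0 \<in> basis_part dg k"
  by (simp add: basis_part_iff)

lemma basis_part_add: "x \<in> basis_part dg k \<Longrightarrow> y \<in> basis_part dg k \<Longrightarrow> x + y \<in> basis_part dg k"
  using Poly_Mapping.keys_add[of x y] unfolding basis_part_def by blast

lemma basis_part_sum: "(\<And>i. i \<in> I \<Longrightarrow> f i \<in> basis_part dg k) \<Longrightarrow> sum f I \<in> basis_part dg k"
  by (induction I rule: infinite_finite_induct) (auto intro: basis_part_add)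

lemma bas_in_basis_part [simp]: "bas b \<in> basis_part dg k \<longleftrightarrow> dg b = k"
  by (auto simp: basis_part_iff lookup_single when_def)

lemma lin_in_basis_part:
  assumes "x \<in> basis_part dg k" "\<And>b. dg b = k \<Longrightarrow> g b \<in> basis_part dg' k'"
  shows "lin g x \<in> basis_part dg' k'"
  using assms unfolding lin_def by (intro basis_part_sum) (auto simp: basis_part_def)

lemma bilin_in_basis_part:
  assumes "x \<in> basis_part dg i" "y \<in> basis_part dg' j"
    and "\<And>b c. dg b = i \<Longrightarrow> dg' c = j \<Longrightarrow> g b c \<in> basis_part dg'' k"
  shows "bilin g x y \<in> basis_part dg'' k"
  unfolding bilin_lin by (intro lin_in_basis_part[OF assms(1)] lin_in_basis_part[OF assms(2)] assms(3))

section \<open>Decomposition of a vector into homogeneous components\<close>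

definition homog_comp :: "('b \<Rightarrow> int) \<Rightarrow> int \<Rightarrow> ('b \<Rightarrow>\<^sub>0 bit) \<Rightarrow> ('b \<Rightarrow>\<^sub>0 bit)" where
  "homog_comp dg k x = lin (\<lambda>b. if dg b = k then bas b else 0) x"

lemma lookup_homog_comp:
  "Poly_Mapping.lookup (homog_comp dg k x) b = (if dg b = k then Poly_Mapping.lookup x b else 0)"
proof -
  have "Poly_Mapping.lookup (homog_comp dg k x) b =
      (\<Sum>c\<in>Poly_Mapping.keys x. if c = b then of_bool (dg c = k) else 0)"
    unfolding homog_comp_def lin_def lookup_sum
    by (intro sum.cong) (auto simp: lookup_single)
  then show ?thesis
    by (cases "Poly_Mapping.lookup x b") (simp_all add: in_keys_iff)
qed

lemma homog_comp_in [simp]: "homog_comp dg k x \<in> basis_part dg k"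
  by (simp add: basis_part_iff lookup_homog_comp)

lemma homog_comp_support: "{k. homog_comp dg k x \<noteq> 0} \<subseteq> dg ` Poly_Mapping.keys x"
proof
  fix k assume "k \<in> {k. homog_comp dg k x \<noteq> 0}"
  then obtain b where "Poly_Mapping.lookup (homog_comp dg k x) b \<noteq> 0"
    by (auto simp: poly_mapping_eq_iff fun_eq_iff)
  then show "k \<in> dg ` Poly_Mapping.keys x"
    by (auto simp: lookup_homog_comp in_keys_iff split: if_splits)
qed

lemma homog_comp_finite: "finite {k. homog_comp dg k x \<noteq> 0}"
  by (rule finite_subset[OF homog_comp_support]) simp

text \<open>At \<open>b\<close> only the summand of degree \<open>dg b\<close> can be non-zero.
  Existence and uniqueness of the decomposition are both read off from this.\<close>

lemma lookup_sum_homog: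
  assumes "\<And>k. c k \<in> basis_part dg k" "finite {k. c k \<noteq> 0}"
  shows "Poly_Mapping.lookup (\<Sum>k | c k \<noteq> 0. c k) b = Poly_Mapping.lookup (c (dg b)) b"
proof -
  have "Poly_Mapping.lookup (\<Sum>k | c k \<noteq> 0. c k) b =
      (\<Sum>k | c k \<noteq> 0. if k = dg b then Poly_Mapping.lookup (c k) b else 0)"
    unfolding lookup_sum using assms(1)
    by (intro sum.cong refl) (auto simp: basis_part_iff, metis bit_not_one_iff)
  then show ?thesis
    using assms(2) by (simp split: if_splits)
qed

lemma sum_homog_comp: "(\<Sum>k | homog_comp dg k x \<noteq> 0. homog_comp dg k x) = x"
  by (rule poly_mapping_eqI)
    (simp add: lookup_sum_homog[of "\<lambda>k. homog_comp dg k x" dg] homog_comp_finite lookup_homog_comp)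

lemma homog_comp_unique:
  assumes "\<And>k. c k \<in> basis_part dg k" "finite {k. c k \<noteq> 0}" "x = (\<Sum>k | c k \<noteq> 0. c k)"
  shows "c = (\<lambda>k. homog_comp dg k x)"
proof (intro ext poly_mapping_eqI)
  fix k b
  show "Poly_Mapping.lookup (c k) b = Poly_Mapping.lookup (homog_comp dg k x) b"
  proof (cases "dg b = k")
    case True
    then show ?thesis
      by (simp add: lookup_homog_comp assms(3) lookup_sum_homog[of c dg, OF assms(1,2)])
  next
    case False
    then have "Poly_Mapping.lookup (c k) b \<noteq> 1"
      using assms(1)[of k] by (auto simp: basis_part_iff)
    then show ?thesis
      using False by (simp add: lookup_homog_comp)
  qed
qed

lemma graded_space_basis_part:
  assumes "part X = basis_part dg"
  shows "graded_space X"
proof -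
  have indep: "c k = 0" if "\<forall>k. c k \<in> basis_part dg k" "finite {k. c k \<noteq> 0}" "(\<Sum>k | c k \<noteq> 0. c k) = 0" for c k
    using homog_comp_unique[of c dg 0] that by (simp add: homog_comp_def)
  show ?thesis
    unfolding graded_space_def assms
    by (intro conjI allI ballI impI) (blast intro: indep | simp add: basis_part_add)+
qed

lemma total_space_basis_part:
  assumes "part X = basis_part dg"
  shows "total_space X = UNIV"
proof -
  have "\<exists>c. (\<forall>k. c k \<in> part X k) \<and> finite {k. c k \<noteq> 0} \<and> x = (\<Sum>k | c k \<noteq> 0. c k)" for x
    by (rule exI[of _ "\<lambda>k. homog_comp dg k x"])
      (simp add: assms homog_comp_finite sum_homog_comp)
  then show ?thesis
    unfolding total_space_def by auto
qed

text \<open>Both sides of each equational axiom are additive in every variable, so basis elements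
  suffice. The unit is left as a vector because in the simplicial algebra it is a sum of four basis
  elements.\<close>

lemma dg_algebra_basisI:
  fixes dl :: "'b \<Rightarrow> ('b \<Rightarrow>\<^sub>0 bit)"
  assumes A: "part A = basis_part dg" "diff A = lin dl" "mul A = bilin ml"
    and dl_deg: "\<And>b. dl b \<in> basis_part dg (dg b - 1)"
    and dl_dl: "\<And>b. lin dl (dl b) = 0"
    and ml_deg: "\<And>b c. ml b c \<in> basis_part dg (dg b + dg c)"
    and assoc: "\<And>a b c. lin (\<lambda>x. ml x c) (ml a b) = lin (ml a) (ml b c)"
    and unit: "unit A \<in> basis_part dg 0"
      "\<And>b. lin (\<lambda>x. ml x b) (unit A) = bas b" "\<And>b. lin (ml b) (unit A) = bas b"
    and leibniz: "\<And>b c. lin dl (ml b c) = lin (\<lambda>x. ml x c) (dl b) + lin (ml b) (dl c)"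
  shows "dg_algebra A"
  unfolding dg_algebra_def
proof (intro conjI allI ballI)
  show "graded_space A" "total_space A = UNIV"
    using graded_space_basis_part total_space_basis_part A(1) by blast+
  show "additive (diff A)" "additive (mul A x)" "additive (\<lambda>y. mul A y x)" for x
    by (simp_all add: A additive_lin additive_bilin)
  show "diff A ` part A k \<subseteq> part A (k - 1)" for k
    unfolding A by (auto intro!: lin_in_basis_part dl_deg)
  show "diff A (diff A x) = 0" for x
    by (simp add: A lin_lin dl_dl)
  show "mul A x y \<in> part A (i + j)" if "x \<in> part A i" "y \<in> part A j" for i j x y
    using that unfolding A by (auto intro!: bilin_in_basis_part ml_deg)
  show "mul A (mul A x y) z = mul A x (mul A y z)" for x y z
    unfolding A
    by (rule triadditive_eqI[of "\<lambda>x y z. bilin ml (bilin ml x y) z" "\<lambda>x y z. bilin ml x (bilin ml y z)"])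
      (simp_all add: additive_def, simp add: bilin_lin assoc)
  show "unit A \<in> part A 0"
    by (simp add: A unit)
  show "mul A (unit A) x = x" for x
    unfolding A by (rule additive_eqI[of "\<lambda>x. bilin ml (unit A) x" "\<lambda>x. x"])
      (simp_all add: additive_def, simp add: bilin_lin unit)
  show "mul A x (unit A) = x" for x
    unfolding A by (rule additive_eqI[of "\<lambda>x. bilin ml x (unit A)" "\<lambda>x. x"])
      (simp_all add: additive_def, simp add: bilin_lin unit)
  show "diff A (mul A x y) = mul A (diff A x) y + mul A x (diff A y)" for x y
    unfolding A
    by (rule biadditive_eqI[of "\<lambda>x y. lin dl (bilin ml x y)"
          "\<lambda>x y. bilin ml (lin dl x) y + bilin ml x (lin dl y)"])
      (simp_all add: additive_def add_ac, simp add: bilin_lin leibniz)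
qed

section \<open>Noncommutative power series over the field with two elements\<close>

text \<open>The Cauchy product over all splittings of a word. Recursion on the word replaces the
  left factor by its derivative \<open>\<lambda>v. f (a # v)\<close>, so inductions generalize over
  \<open>f\<close>.\<close>

fun conv :: "('b list \<Rightarrow> 'v::comm_semiring_1) \<Rightarrow> ('b list \<Rightarrow> 'v) \<Rightarrow> 'b list \<Rightarrow> 'v" where
  "conv f g [] = f [] * g []"
| "conv f g (a # w) = f [] * g (a # w) + conv (\<lambda>v. f (a # v)) g w"

lemma conv_add_left: "conv (\<lambda>v. f v + f' v) g w = conv f g w + conv f' g w"
  by (induction w arbitrary: f f') (simp_all add: algebra_simps)

lemma conv_add_right: "conv f (\<lambda>v. g v + g' v) w = conv f g w + conv f g' w"
  by (induction w arbitrary: f) (simp_all add: algebra_simps)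

lemma conv_mult_left: "conv (\<lambda>v. x * f v) g w = x * conv f g w"
  by (induction w arbitrary: f) (simp_all add: algebra_simps)

lemma conv_zero_left [simp]: "conv (\<lambda>v. 0) g w = 0"
  by (induction w) simp_all

lemma conv_lin_left: "conv (\<lambda>v. lin (\<lambda>b. f b v) x) g w = lin (\<lambda>b. conv (f b) g w) x"
proof -
  have "conv (\<lambda>v. \<Sum>b\<in>K. f b v) g w = (\<Sum>b\<in>K. conv (f b) g w)" for K
    by (induction K rule: infinite_finite_induct) (simp_all add: conv_add_left)
  then show ?thesis
    by (simp add: lin_def)
qed

lemma conv_assoc: "conv (conv f g) h w = conv f (conv g h) w"
  by (induction w arbitrary: f) (simp_all add: conv_add_left conv_mult_left algebra_simps)

lemma conv_one_left: "conv (\<lambda>w. of_bool (w = [])) f w = f w"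
  by (induction w) simp_all

lemma conv_one_right: "conv f (\<lambda>w. of_bool (w = [])) w = f w"
  by (induction w arbitrary: f) simp_all

text \<open>A separate type, because multiplication of functions already denotes the pointwise
  product. The ring instance lets the closedness equation be handled by ring rewriting.\<close>

typedef 'b ncseries = "UNIV :: ('b list \<Rightarrow> bit) set"
  morphisms coeff Series ..

setup_lifting type_definition_ncseries

instantiation ncseries :: (type) "{ring_1, char_two}"
begin

lift_definition zero_ncseries :: "'a ncseries" is "\<lambda>w. 0" .
lift_definition one_ncseries :: "'a ncseries" is "\<lambda>w. of_bool (w = [])" .
lift_definition plus_ncseries :: "'a ncseries \<Rightarrow> 'a ncseries \<Rightarrow> 'a ncseries" is "\<lambda>f g w. f w + g w" .
lift_definition minus_ncseries :: "'a ncseries \<Rightarrow> 'a ncseries \<Rightarrow> 'a ncseries" is "\<lambda>f g w. f w + g w" .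
lift_definition uminus_ncseries :: "'a ncseries \<Rightarrow> 'a ncseries" is "\<lambda>f. f" .
lift_definition times_ncseries :: "'a ncseries \<Rightarrow> 'a ncseries \<Rightarrow> 'a ncseries" is conv .

instance
proof
  show "0 \<noteq> (1 :: 'a ncseries)"
    using fun_cong[OF zero_ncseries.rep_eq, of "[]"] fun_cong[OF one_ncseries.rep_eq, of "[]"] by auto
  fix f g h :: "'a ncseries"
  show "f + g + h = f + (g + h)" "f + g = g + f" "0 + f = f" "- f + f = 0" "f - g = f + - g" "f + f = 0"
    by (transfer; simp add: add_ac)+
  show "f * g * h = f * (g * h)"
    by transfer (simp add: fun_eq_iff conv_assoc)
  show "(f + g) * h = f * h + g * h" "f * (g + h) = f * g + f * h"
    by (transfer; simp add: fun_eq_iff conv_add_left conv_add_right)+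
  show "1 * f = f" "f * 1 = f"
    by (transfer; simp add: fun_eq_iff conv_one_left conv_one_right)+
qed

end

lemma coeff_eqI: "(\<And>w. coeff f w = coeff g w) \<Longrightarrow> f = g"
  by (simp add: fun_eq_iff flip: coeff_inject)

lemma coeff_simps [simp]:
  "coeff 0 w = 0" "coeff 1 w = of_bool (w = [])" "coeff (f + g) w = coeff f w + coeff g w"
  by (transfer; simp; fail)+

lemma coeff_mult: "coeff (f * g) w = conv (coeff f) (coeff g) w"
  by transfer simp

lemma coeff_sum [simp]: "coeff (sum f I) w = (\<Sum>i\<in>I. coeff (f i) w)"
  by (induction I rule: infinite_finite_induct) simp_all

lemma coeff_lin: "coeff (lin f x) w = lin (\<lambda>b. coeff (f b) w) x"
  by (simp add: lin_def)

section \<open>Letters, geometric series and the words of the local model\<close>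

lift_definition letter :: "'b \<Rightarrow> 'b ncseries" is "\<lambda>b w. of_bool (w = [b])" .

lift_definition lang :: "('b list \<Rightarrow> bool) \<Rightarrow> 'b ncseries" is "\<lambda>P w. of_bool (P w)" .

lemma coeff_letter [simp]: "coeff (letter b) w = of_bool (w = [b])"
  by transfer simp

lemma coeff_lang [simp]: "coeff (lang P) w = of_bool (P w)"
  by transfer simp

text \<open>The geometric series \<open>1 / (1 + letter b)\<close>, given by its support so that it
  can be compared with the runs of equal inputs in the local model.\<close>

abbreviation star :: "'b \<Rightarrow> 'b ncseries" where
  "star b \<equiv> lang (\<lambda>w. \<exists>k. w = replicate k b)"

lemma replicate_eq_Cons_ex: "(\<exists>k. a # w = replicate k b) \<longleftrightarrow> a = b \<and> (\<exists>k. w = replicate k b)"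
  by (auto simp: Cons_replicate_eq)

lemma coeff_letter_mult_Nil [simp]: "coeff (letter b * f) [] = 0"
  by (simp add: coeff_mult)

lemma coeff_letter_mult_Cons [simp]: "coeff (letter b * f) (a # w) = (if a = b then coeff f w else 0)"
proof -
  have "(\<lambda>v. of_bool (a = b \<and> v = [])) = (\<lambda>v. of_bool (a = b) * of_bool (v = []) :: bit)"
    by (simp add: fun_eq_iff)
  then show ?thesis
    by (simp add: coeff_mult letter.rep_eq conv_mult_left conv_one_left
        del: of_bool_conj)
qed

lemma coeff_mult_letter_Nil [simp]: "coeff (f * letter b) [] = 0"
  by (simp add: coeff_mult)

lemma coeff_mult_letter_snoc [simp]:
  "coeff (f * letter b) (w @ [a]) = (if a = b then coeff f w else 0)"
proof -
  have "conv g (coeff (letter b)) (w @ [a]) = (if a = b then g w else 0)" for g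
    by (induction w arbitrary: g) simp_all
  then show ?thesis
    by (simp add: coeff_mult)
qed

lemma coeff_star_mult_Nil: "coeff (star b * f) [] = coeff f []"
  by (simp add: coeff_mult)

lemma coeff_star_mult_Cons:
  "coeff (star b * f) (a # w) = coeff f (a # w) + (if a = b then coeff (star b * f) w else 0)"
proof -
  have "(\<lambda>v. of_bool (\<exists>k. a # v = replicate k b) :: bit) =
      (\<lambda>v. of_bool (a = b) * of_bool (\<exists>k. v = replicate k b))"
    by (simp add: fun_eq_iff replicate_eq_Cons_ex)
  then show ?thesis
    by (simp add: coeff_mult lang.rep_eq conv_mult_left del: of_bool_conj)
qed

lemma letter_mult_star: "letter b * star b = 1 + star b"
proof (rule coeff_eqI)
  fix w show "coeff (letter b * star b) w = coeff (1 + star b) w"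
    by (cases w) (simp_all add: replicate_eq_Cons_ex)
qed

text \<open>Coefficients of a product are read from the left, so only
  \<open>letter_mult_star\<close> is immediate. It makes \<open>star b\<close> a right inverse of
  \<open>1 + letter b\<close>; left cancellation of that factor makes it a left inverse too.\<close>

lemma star_mult_letter: "star b * letter b = 1 + star b"
proof -
  have "(1 + letter b) * star b = 1"
    by (simp add: distrib_right letter_mult_star add_ac)
  then have *: "(1 + letter b) * (star b * (1 + letter b) + 1) = 0"
    by (simp add: distrib_left flip: mult.assoc)
  \<comment> \<open>The coefficient of the product at \<open>a # w\<close> is that of
    \<open>f\<close> at \<open>a # w\<close>, plus that at \<open>w\<close> if \<open>a = b\<close>;
    so \<open>f\<close> vanishes by induction on the word.\<close>
  have "f = 0" if "(1 + letter b) * f = 0" for f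
  proof (rule coeff_eqI)
    fix w show "coeff f w = coeff 0 w"
    proof (induction w)
      case Nil
      with that have "coeff ((1 + letter b) * f) [] = 0" by simp
      then show ?case by (simp add: distrib_right)
    next
      case (Cons a w)
      with that have "coeff ((1 + letter b) * f) (a # w) = 0" by simp
      with Cons show ?case by (simp add: distrib_right split: if_splits)
    qed
  qed
  from this[OF *] show ?thesis
    by (simp add: distrib_left add_eq_0_iff_eq) (metis add.commute add_self_left)
qed

text \<open>For \<open>b \<noteq> c\<close> the first \<open>c\<close> ends the run of
  \<open>b\<close>, so a word factors in at most one way and nothing cancels modulo 2.\<close>

lemma star_letter_lang:
  assumes "b \<noteq> c"
  shows "star b * (letter c * lang P) = lang (\<lambda>w. \<exists>u v. w = replicate u b @ c # v \<and> P v)"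
proof (rule coeff_eqI)
  fix w
  show "coeff (star b * (letter c * lang P)) w = coeff (lang (\<lambda>w. \<exists>u v. w = replicate u b @ c # v \<and> P v)) w"
  proof (induction w)
    case Nil
    then show ?case by (simp add: coeff_star_mult_Nil)
  next
    case (Cons a w)
    have *: "(\<exists>u v. a # w = replicate u b @ c # v \<and> P v) \<longleftrightarrow>
        a = c \<and> P w \<or> a = b \<and> (\<exists>u v. w = replicate u b @ c # v \<and> P v)" (is "?l \<longleftrightarrow> ?r")
    proof
      assume ?l
      then obtain u v where "a # w = replicate u b @ c # v" "P v" by blast
      then show ?r by (cases u) auto
    next
      assume ?r
      then show ?l
      proof
        assume "a = c \<and> P w"
        then show ?l by (intro exI[of _ 0] exI[of _ w]) simp
      next
        assume "a = b \<and> (\<exists>u v. w = replicate u b @ c # v \<and> P v)"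
        then obtain u v where "a = b" "w = replicate u b @ c # v" "P v" by blast
        then show ?l by (intro exI[of _ "Suc u"] exI[of _ v]) simp
      qed
    qed
    show ?case
      using Cons assms by (auto simp: coeff_star_mult_Cons *)
  qed
qed

section \<open>The derivation dual to a differential and a product\<close>

text \<open>The transpose of the differential \<open>D\<^sub>0 + D\<^sub>1\<close> of the bar construction without its outer
  terms.  It is a derivation because each of its terms changes a single factor of a concatenation.\<close>

fun head_merge ::
  "('b \<Rightarrow> 'b \<Rightarrow> 'b \<Rightarrow>\<^sub>0 bit) \<Rightarrow> ('b list \<Rightarrow> 'v::comm_semiring_1) \<Rightarrow> 'b \<Rightarrow> 'b list \<Rightarrow> 'v" where
  "head_merge ml f a [] = 0"
| "head_merge ml f a (a' # w) = lin (\<lambda>b. f (b # w)) (ml a a')"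

fun bar_coeff ::
  "('b \<Rightarrow> 'b \<Rightarrow>\<^sub>0 bit) \<Rightarrow> ('b \<Rightarrow> 'b \<Rightarrow> 'b \<Rightarrow>\<^sub>0 bit) \<Rightarrow>
     ('b list \<Rightarrow> 'v::comm_semiring_1) \<Rightarrow> 'b list \<Rightarrow> 'v" where
  "bar_coeff dl ml f [] = 0"
| "bar_coeff dl ml f (a # w) = lin (\<lambda>b. f (b # w)) (dl a) + head_merge ml f a w +
     bar_coeff dl ml (\<lambda>v. f (a # v)) w"

lemma head_merge_add: "head_merge ml (\<lambda>v. f v + g v) a w = head_merge ml f a w + head_merge ml g a w"
  by (cases w) (simp_all add: lin_add_fun)

lemma head_merge_mult: "head_merge ml (\<lambda>v. x * f v) a w = x * head_merge ml f a w"
  by (cases w) (simp_all add: lin_mult_left)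

text \<open>A cut of the word lies before or after the merged letter, never inside it: the value 0
  of \<open>head_merge\<close> on the empty word excludes the cut between the two letters.\<close>

lemma head_merge_conv:
  "head_merge ml (conv f g) a w = f [] * head_merge ml g a w + conv (head_merge ml f a) g w"
  by (cases w) (simp_all add: conv_lin_left lin_add_fun lin_mult_left)

lemma bar_coeff_add:
  "bar_coeff dl ml (\<lambda>v. f v + g v) w = bar_coeff dl ml f w + bar_coeff dl ml g w"
  by (induction w arbitrary: f g) (simp_all add: lin_add_fun head_merge_add add_ac)

lemma bar_coeff_mult: "bar_coeff dl ml (\<lambda>v. x * f v) w = x * bar_coeff dl ml f w"
  by (induction w arbitrary: f) (simp_all add: lin_mult_left head_merge_mult algebra_simps)

lemma bar_coeff_conv:
  "bar_coeff dl ml (conv f g) w = conv (bar_coeff dl ml f) g w + conv f (bar_coeff dl ml g) w"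
  by (induction w arbitrary: f)
    (simp_all add: head_merge_conv bar_coeff_add bar_coeff_mult lin_add_fun lin_mult_left
        conv_add_left conv_lin_left algebra_simps)

context
  fixes dl :: "'b \<Rightarrow> 'b \<Rightarrow>\<^sub>0 bit" and ml :: "'b \<Rightarrow> 'b \<Rightarrow> 'b \<Rightarrow>\<^sub>0 bit"
begin

lift_definition bar_der :: "'b ncseries \<Rightarrow> 'b ncseries" is "bar_coeff dl ml" .

lemma bar_der_add [simp]: "bar_der (f + g) = bar_der f + bar_der g"
  by transfer (simp add: fun_eq_iff bar_coeff_add)

lemma bar_der_mult: "bar_der (f * g) = bar_der f * g + f * bar_der g"
  by transfer (simp add: fun_eq_iff bar_coeff_conv[abs_def])

lemma bar_der_0 [simp]: "bar_der 0 = 0"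
  using bar_der_add[of 0 0] by simp

lemma bar_der_1 [simp]: "bar_der 1 = 0"
  using bar_der_mult[of 1 1] by simp

text \<open>The derivative of an inverse, \<open>T (1/u) = (1/u) (T u) (1/u)\<close> without sign,
  for \<open>u = 1 + letter b\<close>.\<close>

lemma bar_der_star: "bar_der (star b) = star b * bar_der (letter b) * star b"
proof -
  have inv: "(1 + letter b) * star b = 1" "star b * (1 + letter b) = 1"
    by (simp_all add: distrib_left distrib_right letter_mult_star star_mult_letter add_ac)
  have "bar_der (letter b) * star b + (1 + letter b) * bar_der (star b) = 0"
    using arg_cong[OF inv(1), of bar_der] by (simp add: bar_der_mult)
  then have "star b * (bar_der (letter b) * star b + (1 + letter b) * bar_der (star b)) = 0"
    by simp
  then have "star b * bar_der (letter b) * star b + (star b * (1 + letter b)) * bar_der (star b) = 0"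
    by (simp only: mult.assoc distrib_left[of _ "bar_der (letter b) * star b"])
  then show ?thesis
    by (simp add: inv add_eq_0_iff_eq)
qed

end

section \<open>Multilinear extension of functions on words\<close>

text \<open>Written as one sum over \<open>listset\<close>, as in \<open>hip_lin\<close>; the
  inductions use the recursion \<open>mext_Cons\<close>.\<close>

definition mext :: "('b list \<Rightarrow> 'v::char_two) \<Rightarrow> ('b \<Rightarrow>\<^sub>0 bit) list \<Rightarrow> 'v" where
  "mext f as = (\<Sum>w\<in>listset (map Poly_Mapping.keys as). f w)"

lemma mext_Nil [simp]: "mext f [] = f []"
  by (simp add: mext_def)

lemma mext_Cons [simp]: "mext f (a # as) = lin (\<lambda>b. mext (\<lambda>w. f (b # w)) as) a"
proof -
  let ?L = "listset (map Poly_Mapping.keys as)"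
  have "set_Cons (Poly_Mapping.keys a) ?L = (\<lambda>(b, w). b # w) ` (Poly_Mapping.keys a \<times> ?L)"
    by (auto simp: set_Cons_def)
  moreover have "inj_on (\<lambda>(b, w). b # w) (Poly_Mapping.keys a \<times> ?L)"
    by (auto simp: inj_on_def)
  ultimately show ?thesis
    by (simp add: mext_def lin_def sum.reindex sum.cartesian_product split_def)
qed

lemma mext_add_fun: "mext (\<lambda>w. f w + g w) as = mext f as + mext g as"
  by (simp add: mext_def sum.distrib)

lemma mext_mult_left: "mext (\<lambda>w. x * f w) as = x * mext f as" for x :: bit
  by (simp add: mext_def sum_distrib_left)

lemma mext_zero_fun [simp]: "mext (\<lambda>w. 0) as = 0"
  by (simp add: mext_def)

lemma mext_lin_fun: "mext (\<lambda>w. lin (\<lambda>x. f x w) y) as = lin (\<lambda>x. mext (f x) as) y"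
  unfolding mext_def lin_def by (rule sum.swap)

lemma mext_snoc: "mext f (as @ [a]) = lin (\<lambda>b. mext (\<lambda>w. f (w @ [b])) as) a"
proof (induction as arbitrary: f)
  case (Cons a' as)
  then show ?case
    using lin_swap[of "\<lambda>b c. mext (\<lambda>w. f (b # w @ [c])) as" a a'] by simp
qed simp

lemma mext_append_add: "mext f (xs @ (y + z) # ys) = mext f (xs @ y # ys) + mext f (xs @ z # ys)"
  by (induction xs arbitrary: f) (simp_all add: lin_add_fun)

lemma mext_append_bas:
  assumes "\<And>w. b \<in> set w \<Longrightarrow> f w = 0"
  shows "mext f (xs @ bas b # ys) = 0"
  using assms by (induction xs arbitrary: f) simp_all

lemma mext_map_lin: "mext f (map (lin h) as) = mext (\<lambda>w. mext f (map h w)) as"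
  by (induction as arbitrary: f) (simp_all add: lin_lin mext_lin_fun)

lemma mext_coeff_add [simp]: "mext (coeff (f + g)) as = mext (coeff f) as + mext (coeff g) as"
  by (simp add: mext_def sum.distrib)

lemma mext_coeff_0 [simp]: "mext (coeff 0) as = 0"
  by (simp add: mext_def)

lemma mext_coeff_lin: "mext (coeff (lin \<Gamma> x)) as = lin (\<lambda>b. mext (coeff (\<Gamma> b)) as) x"
  by (simp add: coeff_lin[abs_def] mext_lin_fun)

section \<open>The inner terms of the Hochschild differential as a derivation\<close>

lemma apply_diff_Cons [simp]:
  "apply_diff A 0 (a # as) = diff A a # as"
  "apply_diff A (Suc j) (a # as) = a # apply_diff A j as"
  by (simp_all add: apply_diff_def)

lemma merge_Cons [simp]:
  "merge A 0 (a # b # as) = mul A a b # as"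
  "merge A (Suc j) (a # as) = a # merge A j as"
  by (simp_all add: merge_def)

lemma apply_diff_eq_Nil [simp]: "apply_diff A j as = [] \<longleftrightarrow> as = []"
  by (simp add: apply_diff_def)

lemma merge_neq_Nil [simp]: "merge A j as \<noteq> []"
  by (simp add: merge_def)

lemma sum_mext_Cons:
  "(\<Sum>j<n. mext f (a # h j)) = lin (\<lambda>b. \<Sum>j<n. mext (\<lambda>w. f (b # w)) (h j)) a"
  by (simp add: lin_def) (rule sum.swap)

text \<open>Links the sums over positions in \<open>hip_diff\<close> with the recursive transpose
  \<open>bar_coeff\<close>: position 0 gives the terms at the first letter, later positions are
  those of the tail.\<close>

lemma mext_bar_coeff:
  assumes "diff A = lin dl" "mul A = bilin ml"
  shows "(\<Sum>j<length as. mext f (apply_diff A j as)) + (\<Sum>j<length as - 1. mext f (merge A j as)) =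
    mext (bar_coeff dl ml f) as"
proof (induction as arbitrary: f)
  case (Cons a as)
  have diff: "(\<Sum>j<Suc n. mext f (apply_diff A j (a # as))) =
      mext f (lin dl a # as) + (\<Sum>j<n. mext f (a # apply_diff A j as))" for n
    by (simp add: assms sum.lessThan_Suc_shift del: sum.lessThan_Suc mext_Cons)
  have merge: "(\<Sum>j<length as. mext f (merge A j (a # as))) =
      mext (\<lambda>w. lin (\<lambda>b. head_merge ml f b w) a) as + (\<Sum>j<length as - 1. mext f (a # merge A j as))"
  proof (cases as)
    case (Cons a' as')
    have "(\<Sum>j<length as. mext f (merge A j (a # as))) =
        mext f (bilin ml a a' # as') + (\<Sum>j<length as - 1. mext f (a # merge A j as))"
      by (simp add: assms Cons sum.lessThan_Suc_shift del: sum.lessThan_Suc mext_Cons)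
    moreover have "mext f (bilin ml a a' # as') = mext (\<lambda>w. lin (\<lambda>b. head_merge ml f b w) a) as"
      by (simp add: Cons bilin_lin lin_lin mext_lin_fun)
    ultimately show ?thesis by simp
  qed simp
  have "(\<Sum>j<length (a # as). mext f (apply_diff A j (a # as))) +
      (\<Sum>j<length (a # as) - 1. mext f (merge A j (a # as))) =
      mext f (lin dl a # as) + mext (\<lambda>w. lin (\<lambda>b. head_merge ml f b w) a) as +
      lin (\<lambda>b. mext (bar_coeff dl ml (\<lambda>w. f (b # w))) as) a"
    using diff[of "length as"] merge
    by (simp add: sum_mext_Cons Cons.IH[symmetric] lin_add_fun add_ac
        del: sum.lessThan_Suc mext_Cons)
  also have "\<dots> = mext (bar_coeff dl ml f) (a # as)"
    by (simp add: mext_add_fun mext_lin_fun lin_lin lin_add_fun)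
  finally show ?case .
qed simp

section \<open>Homotopy inner products from Hochschild cocycles\<close>

text \<open>A family \<open>F\<close> that is concentrated in \<open>q = 0\<close> and depends on \<open>m\<close> and \<open>n\<close> only through the
  product \<open>m \<cdot> n\<close> amounts to a Hochschild cochain with values in the dual, that is to one power
  series \<open>\<Gamma> x\<close> in the basis elements for every basis element \<open>x\<close>.\<close>

definition cochain_hip ::
  "('b \<Rightarrow> 'b \<Rightarrow> 'b \<Rightarrow>\<^sub>0 bit) \<Rightarrow> ('b \<Rightarrow> 'b ncseries) \<Rightarrow> ('b \<Rightarrow>\<^sub>0 bit) hip" where
  "cochain_hip ml \<Gamma> as m bs n =
     (if bs = [] then lin (\<lambda>x. mext (coeff (\<Gamma> x)) as) (bilin ml m n) else 0)"

lemma hip_lin_eq_cochain_hip: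
  assumes "\<And>as m n. G as m [] n = lin (\<lambda>x. coeff (\<Gamma> x) as) (ml m n)"
    and "\<And>as m bs n. bs \<noteq> [] \<Longrightarrow> G as m bs n = 0"
  shows "hip_lin G = cochain_hip ml \<Gamma>"
proof (intro ext)
  fix as m bs n
  show "hip_lin G as m bs n = cochain_hip ml \<Gamma> as m bs n"
  proof (cases bs)
    case Nil
    have "hip_lin G as m bs n = mext (\<lambda>w. lin (\<lambda>b. lin (\<lambda>c. G w b [] c) n) m) as"
      by (simp add: Nil hip_lin_def mext_def lin_def)
    then show ?thesis
      by (simp add: cochain_hip_def Nil assms(1) mext_lin_fun bilin_lin lin_lin)
  next
    case (Cons b bs')
    have "bs'' \<noteq> []" if "bs'' \<in> listset (map Poly_Mapping.keys bs)" for bs''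
      using that by (auto simp: Cons set_Cons_def)
    then show ?thesis
      by (simp add: hip_lin_def cochain_hip_def Cons assms(2))
  qed
qed

text \<open>A finite basis has finitely many degrees, so every functional is a finite sum of
  homogeneous ones.\<close>

lemma additive_in_total_space_dual:
  fixes n :: "('b::finite \<Rightarrow>\<^sub>0 bit) \<Rightarrow> bit"
  assumes "part A = basis_part dg" "additive n"
  shows "n \<in> total_space (dual_bimod A)"
proof -
  \<comment> \<open>Dual degree \<open>k\<close> pairs with algebra degree
    \<open>- k\<close>.\<close>
  define c where "c k x = n (homog_comp dg (- k) x)" for k x
  let ?K = "uminus ` range dg"
  have supp: "homog_comp dg k x = 0" if "k \<notin> range dg" for k x
    using that homog_comp_support[of dg x] by auto
  have n0: "n 0 = 0"
    by (rule additive.zero[OF assms(2)])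
  have c0: "c k = 0" if "k \<notin> ?K" for k
  proof -
    have "- k \<notin> range dg"
      using that by (metis imageI minus_minus)
    then show ?thesis
      by (simp add: fun_eq_iff c_def supp n0)
  qed
  have fin: "finite {k. c k \<noteq> 0}"
    by (rule finite_subset[of _ ?K]) (use c0 in auto)
  have "homog_comp dg i (x + y) = homog_comp dg i x + homog_comp dg i y" for i x y
    by (simp add: homog_comp_def)
  moreover have "homog_comp dg j x = 0" if "x \<in> basis_part dg i" "i \<noteq> j" for i j x
    using that by (intro poly_mapping_eqI) (auto simp: lookup_homog_comp basis_part_iff)
  ultimately have part: "c k \<in> part (dual_bimod A) k" for k
    using assms(2) n0 by (auto simp: dual_bimod_def assms(1) c_def additive_def)
  have "n x = (\<Sum>k | c k \<noteq> 0. c k) x" for x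
  proof -
    have "(\<Sum>k | c k \<noteq> 0. c k) x = (\<Sum>k\<in>?K. c k x)"
      unfolding sum_fun_apply
    proof (rule sum.mono_neutral_left)
      show "{k. c k \<noteq> 0} \<subseteq> ?K" using c0 by blast
    qed auto
    also have "\<dots> = (\<Sum>k\<in>range dg. n (homog_comp dg k x))"
      by (subst sum.reindex) (auto simp: inj_on_def c_def)
    also have "\<dots> = n (\<Sum>k\<in>range dg. homog_comp dg k x)"
      by (simp add: additive.sum[OF assms(2)])
    also have "(\<Sum>k\<in>range dg. homog_comp dg k x) = (\<Sum>k | homog_comp dg k x \<noteq> 0. homog_comp dg k x)"
      by (rule sum.mono_neutral_right) (use supp in auto)
    finally show ?thesis
      by (simp only: sum_homog_comp)
  qed
  then show ?thesis
    unfolding total_space_def using part fin by (auto intro!: exI[of _ c])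
qed

lemma coeff_sum_letter_mult:
  fixes H :: "'b::finite \<Rightarrow> 'b ncseries"
  shows "coeff (\<Sum>b\<in>UNIV. letter b * H b) (a # w) = coeff (H a) w"
    "coeff (\<Sum>b\<in>UNIV. letter b * H b) [] = 0"
  by (simp_all add: sum.delta')

lemma mext_letter_mult:
  fixes H :: "'b::finite \<Rightarrow> 'b ncseries"
  shows "mext (coeff (\<Sum>b\<in>UNIV. letter b * H b)) (a # as) = lin (\<lambda>b. mext (coeff (H b)) as) a"
    "mext (coeff (\<Sum>b\<in>UNIV. letter b * H b)) [] = 0"
  by (simp_all add: coeff_sum_letter_mult del: coeff_sum)

lemma mext_mult_letter:
  fixes H :: "'b::finite \<Rightarrow> 'b ncseries"
  shows "mext (coeff (\<Sum>b\<in>UNIV. H b * letter b)) (as @ [a]) = lin (\<lambda>b. mext (coeff (H b)) as) a"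
    "mext (coeff (\<Sum>b\<in>UNIV. H b * letter b)) [] = 0"
  by (simp_all add: mext_snoc)

text \<open>Without right inputs, the Leibniz rule and associativity make all terms depend on
  \<open>x = m n\<close> only, which leaves the equation \<open>cocycle\<close> for basis elements
  \<open>x\<close>. With one right input \<open>b\<close>, the two terms are values at
  \<open>(m b) n\<close> and \<open>m (b n)\<close> and cancel; with more, every term
  vanishes.\<close>

lemma homotopy_inner_product_cochain_hip:
  fixes \<Gamma> :: "'b::finite \<Rightarrow> 'b ncseries"
  assumes A: "dg_algebra A" "part A = basis_part dg" "diff A = lin dl" "mul A = bilin ml"
    and unit: "\<And>x as. unit A \<in> set as \<Longrightarrow> mext (coeff (\<Gamma> x)) as = 0"
    and cocycle: "\<And>x. lin \<Gamma> (dl x) + bar_der dl ml (\<Gamma> x) + (\<Sum>b\<in>UNIV. letter b * lin \<Gamma> (ml x b)) +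
      (\<Sum>b\<in>UNIV. lin \<Gamma> (ml b x) * letter b) = 0"
  shows "homotopy_inner_product A (cochain_hip ml \<Gamma>)"
proof -
  define \<Phi> where "\<Phi> as x = lin (\<lambda>b. mext (coeff (\<Gamma> b)) as) x" for as x
  have F: "cochain_hip ml \<Gamma> as m [] n = \<Phi> as (mul A m n)" for as m n
    by (simp add: cochain_hip_def \<Phi>_def A)
  have F0: "cochain_hip ml \<Gamma> as m bs n = 0" if "bs \<noteq> []" for as m bs n
    using that by (simp add: cochain_hip_def)
  have \<Phi>_add: "\<Phi> as (x + y) = \<Phi> as x + \<Phi> as y" for as x y
    by (simp add: \<Phi>_def)
  have assoc: "mul A (mul A x y) z = mul A x (mul A y z)" for x y z
    using A(1) by (simp add: dg_algebra_def)
  have leibniz: "diff A (mul A x y) = mul A (diff A x) y + mul A x (diff A y)" for x y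
    using A(1) by (simp add: dg_algebra_def)
  have outer_left: "(if as = [] then 0 else \<Phi> (tl as) (mul A x (hd as))) =
      lin (\<lambda>y. mext (coeff (\<Sum>b\<in>UNIV. letter b * lin \<Gamma> (ml y b))) as) x" for as x
  proof (cases as)
    case Nil
    then show ?thesis by (simp only: mext_letter_mult(2)) simp
  next
    case (Cons a as')
    show ?thesis
      unfolding Cons mext_letter_mult(1) \<Phi>_def A
      by (simp add: mext_coeff_lin bilin_lin lin_lin)
  qed
  have outer_right: "(if as = [] then 0 else \<Phi> (butlast as) (mul A (last as) x)) =
      lin (\<lambda>y. mext (coeff (\<Sum>b\<in>UNIV. lin \<Gamma> (ml b y) * letter b)) as) x" for as x
  proof (cases as rule: rev_cases)
    case Nil
    then show ?thesis by (simp only: mext_mult_letter(2)) simp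
  next
    case (snoc as' a)
    show ?thesis
      unfolding snoc mext_mult_letter(1) \<Phi>_def A
      by (simp add: mext_coeff_lin bilin_lin lin_lin) (rule lin_swap)
  qed
  have inner: "(\<Sum>j<length as. \<Phi> (apply_diff A j as) x) + (\<Sum>j<length as - 1. \<Phi> (merge A j as) x) =
      lin (\<lambda>y. mext (coeff (bar_der dl ml (\<Gamma> y))) as) x" for as x
  proof -
    have "(\<Sum>j<n. \<Phi> (h j) x) = lin (\<lambda>y. \<Sum>j<n. mext (coeff (\<Gamma> y)) (h j)) x" for n h
      unfolding \<Phi>_def lin_def by (rule sum.swap)
    from this[of "\<lambda>j. apply_diff A j as" "length as"] this[of "\<lambda>j. merge A j as" "length as - 1"]
    show ?thesis
      by (simp only: bar_der.rep_eq mext_bar_coeff[OF A(3,4), symmetric] lin_add_fun)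
  qed
  have diff0: "hip_diff A (cochain_hip ml \<Gamma>) as m [] n = 0" for as m n
  proof -
    let ?x = "mul A m n"
    have "hip_diff A (cochain_hip ml \<Gamma>) as m [] n =
        \<Phi> as (diff A ?x) +
        ((\<Sum>j<length as. \<Phi> (apply_diff A j as) ?x) + (\<Sum>j<length as - 1. \<Phi> (merge A j as) ?x)) +
        (if as = [] then 0 else \<Phi> (tl as) (mul A ?x (hd as))) +
        (if as = [] then 0 else \<Phi> (butlast as) (mul A (last as) ?x))"
      by (simp add: hip_diff_def F leibniz \<Phi>_add assoc add_ac)
    also have "\<Phi> as (diff A ?x) = lin (\<lambda>y. mext (coeff (lin \<Gamma> (dl y))) as) ?x"
      by (simp add: \<Phi>_def A lin_lin mext_coeff_lin)
    finally have "hip_diff A (cochain_hip ml \<Gamma>) as m [] n =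
        lin (\<lambda>y. mext (coeff (lin \<Gamma> (dl y) + bar_der dl ml (\<Gamma> y) +
          (\<Sum>b\<in>UNIV. letter b * lin \<Gamma> (ml y b)) + (\<Sum>b\<in>UNIV. lin \<Gamma> (ml b y) * letter b))) as) ?x"
      unfolding inner outer_left outer_right by (simp only: mext_coeff_add lin_add_fun)
    then show ?thesis
      by (simp only: cocycle mext_coeff_0 lin_zero_fun)
  qed
  have diff1: "hip_diff A (cochain_hip ml \<Gamma>) as m (b # bs) n = 0" for as m b bs n
    by (cases bs) (simp_all add: hip_diff_def F F0 assoc del: sum.lessThan_Suc apply_diff_Cons)
  show ?thesis
    unfolding homotopy_inner_product_def
  proof (intro conjI allI impI)
    show "cochain_hip ml \<Gamma> as m bs \<in> total_space (dual_bimod A)" for as m bs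
      by (rule additive_in_total_space_dual[OF A(2)]) (simp add: additive_def cochain_hip_def)
    show "multilinear (\<lambda>as. cochain_hip ml \<Gamma> as m bs)" for m bs
      by (simp add: multilinear_def cochain_hip_def fun_eq_iff mext_append_add lin_add_fun)
    show "additive (\<lambda>m. cochain_hip ml \<Gamma> as m bs)" for as bs
      by (simp add: additive_def fun_eq_iff cochain_hip_def)
    show "multilinear (cochain_hip ml \<Gamma> as m)" for as m
      by (simp add: multilinear_def fun_eq_iff cochain_hip_def)
    show "cochain_hip ml \<Gamma> as m bs = 0" if "unit A \<in> set as \<union> set bs" for as m bs
      using that by (auto simp: fun_eq_iff cochain_hip_def unit)
    show "hip_diff A (cochain_hip ml \<Gamma>) as m bs n = 0" for as m bs n
      using diff0 diff1 by (cases bs) auto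
  qed
qed

lemma bar_coeff_zero [simp]: "bar_coeff dl ml (\<lambda>w. 0) w = 0"
  using bar_coeff_mult[of dl ml 0 "\<lambda>w. 0" w] by simp

lemma lin_of_bool_eq: "lin (\<lambda>c. of_bool (c = b)) x = Poly_Mapping.lookup x b"
proof -
  have "lin (\<lambda>c. of_bool (c = b)) x = lin (\<lambda>c. Poly_Mapping.lookup (bas c) b) x"
    by (intro lin_cong) (simp add: lookup_single when_def)
  then show ?thesis
    by (simp flip: lookup_lin)
qed

lemma coeff_sum_letters:
  fixes P :: "'b::finite \<Rightarrow> bool"
  shows "coeff (\<Sum>a\<in>UNIV. if P a then letter a else 0) w = (\<Sum>a\<in>UNIV. of_bool (w = [a] \<and> P a))"
  unfolding coeff_sum by (intro sum.cong) auto

lemma sum_of_bool_delta: "(\<Sum>c\<in>UNIV. of_bool (a = c \<and> x c = (1::bit))) = x a" for a :: "'b::finite"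
proof -
  have "(\<Sum>c\<in>UNIV. of_bool (a = c \<and> x c = (1::bit))) = (\<Sum>c\<in>UNIV. if a = c then x c else 0)"
    by (intro sum.cong) auto
  then show ?thesis by simp
qed

text \<open>Transposes of differential and product: \<open>b\<close> is hit by the letters whose
  differential contains it and by the two-letter words whose product contains it.\<close>

lemma bar_der_letter:
  fixes b :: "'b::finite"
  shows "bar_der dl ml (letter b) =
    (\<Sum>a\<in>UNIV. if Poly_Mapping.lookup (dl a) b = 1 then letter a else 0) +
    (\<Sum>a\<in>UNIV. letter a * (\<Sum>a'\<in>UNIV. if Poly_Mapping.lookup (ml a a') b = 1 then letter a' else 0))"
    (is "_ = ?r")
proof (rule coeff_eqI)
  fix w
  \<comment> \<open>Behind a first letter, the coefficient function of \<open>letter b\<close> is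
    supported on the empty word, which neither a differential nor a merge produces.\<close>
  have tail: "bar_coeff dl ml (\<lambda>v. of_bool (a = b \<and> v = [])) v = (0::bit)" for a v
    by (cases v; cases "tl v") auto
  show "coeff (bar_der dl ml (letter b)) w = coeff ?r w"
    unfolding bar_der.rep_eq
    by (cases w; cases "tl w"; cases "tl (tl w)")
      (auto simp: coeff_sum_letters coeff_sum_letter_mult lin_of_bool_eq sum_of_bool_delta tail simp del: coeff_sum)
qed

section \<open>The simplicial cochain algebra\<close>

lemma UNIV_smplx:
  "UNIV = {E0, E1, E2, E3, B01, B02, B03, B12, B13, B23, C012, C013, C023, C123}"
proof -
  have "x \<in> {E0, E1, E2, E3, B01, B02, B03, B12, B13, B23, C012, C013, C023, C123}" for x
    by (cases x) simp_all
  then show ?thesis by blast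
qed

instance smplx :: finite
  by standard (simp add: UNIV_smplx)

lemma sum_Collect_smplx:
  "(\<Sum>\<tau> | P \<tau>. f \<tau>) = (\<Sum>\<tau>\<in>(UNIV :: smplx set). if P \<tau> then f \<tau> else (0::'a::comm_monoid_add))"
  by (rule sum.mono_neutral_cong_left) auto

lemma tet_diff_simps [simp]:
  "tet_diff E0 = bas B01 + bas B02 + bas B03"
  "tet_diff E1 = bas B01 + bas B12 + bas B13"
  "tet_diff E2 = bas B02 + bas B12 + bas B23"
  "tet_diff E3 = bas B03 + bas B13 + bas B23"
  "tet_diff B01 = bas C012 + bas C013"
  "tet_diff B02 = bas C012 + bas C023"
  "tet_diff B03 = bas C013 + bas C023"
  "tet_diff B12 = bas C012 + bas C123"
  "tet_diff B13 = bas C013 + bas C123"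
  "tet_diff B23 = bas C023 + bas C123"
  "tet_diff C012 = 0" "tet_diff C013 = 0" "tet_diff C023 = 0" "tet_diff C123 = 0"
  by (simp_all add: tet_diff_def sum_Collect_smplx UNIV_smplx add_ac)

text \<open>A multiplication table that simp evaluates directly, in place of the sums over simplices
  in \<open>tet_mul\<close>.\<close>

primrec tet_prod :: "smplx \<Rightarrow> smplx \<Rightarrow> smplx \<Rightarrow>\<^sub>0 bit" where
  "tet_prod E0 = (\<lambda>\<tau>. case \<tau> of E0 \<Rightarrow> bas E0 | B01 \<Rightarrow> bas B01 | B02 \<Rightarrow> bas B02 | B03 \<Rightarrow> bas B03
       | C012 \<Rightarrow> bas C012 | C013 \<Rightarrow> bas C013 | C023 \<Rightarrow> bas C023 | _ \<Rightarrow> 0)"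
| "tet_prod E1 = (\<lambda>\<tau>. case \<tau> of E1 \<Rightarrow> bas E1 | B12 \<Rightarrow> bas B12
       | B13 \<Rightarrow> bas B13 | C123 \<Rightarrow> bas C123 | _ \<Rightarrow> 0)"
| "tet_prod E2 = (\<lambda>\<tau>. case \<tau> of E2 \<Rightarrow> bas E2 | B23 \<Rightarrow> bas B23 | _ \<Rightarrow> 0)"
| "tet_prod E3 = (\<lambda>\<tau>. case \<tau> of E3 \<Rightarrow> bas E3 | _ \<Rightarrow> 0)"
| "tet_prod B01 = (\<lambda>\<tau>. case \<tau> of E1 \<Rightarrow> bas B01 | B12 \<Rightarrow> bas C012 | B13 \<Rightarrow> bas C013 | _ \<Rightarrow> 0)"
| "tet_prod B02 = (\<lambda>\<tau>. case \<tau> of E2 \<Rightarrow> bas B02 | B23 \<Rightarrow> bas C023 | _ \<Rightarrow> 0)"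
| "tet_prod B03 = (\<lambda>\<tau>. case \<tau> of E3 \<Rightarrow> bas B03 | _ \<Rightarrow> 0)"
| "tet_prod B12 = (\<lambda>\<tau>. case \<tau> of E2 \<Rightarrow> bas B12 | B23 \<Rightarrow> bas C123 | _ \<Rightarrow> 0)"
| "tet_prod B13 = (\<lambda>\<tau>. case \<tau> of E3 \<Rightarrow> bas B13 | _ \<Rightarrow> 0)"
| "tet_prod B23 = (\<lambda>\<tau>. case \<tau> of E3 \<Rightarrow> bas B23 | _ \<Rightarrow> 0)"
| "tet_prod C012 = (\<lambda>\<tau>. case \<tau> of E2 \<Rightarrow> bas C012 | _ \<Rightarrow> 0)"
| "tet_prod C013 = (\<lambda>\<tau>. case \<tau> of E3 \<Rightarrow> bas C013 | _ \<Rightarrow> 0)"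
| "tet_prod C023 = (\<lambda>\<tau>. case \<tau> of E3 \<Rightarrow> bas C023 | _ \<Rightarrow> 0)"
| "tet_prod C123 = (\<lambda>\<tau>. case \<tau> of E3 \<Rightarrow> bas C123 | _ \<Rightarrow> 0)"

lemma tet_mul_eq: "tet_mul = tet_prod"
proof (intro ext)
  fix \<sigma> \<tau> show "tet_mul \<sigma> \<tau> = tet_prod \<sigma> \<tau>"
    by (cases \<sigma>; cases \<tau>) (simp_all add: tet_mul_def sum_Collect_smplx UNIV_smplx)
qed

lemma tet_prod_assoc: "lin (\<lambda>x. tet_prod x c) (tet_prod a b) = lin (tet_prod a) (tet_prod b c)"
  by (cases a; cases b; cases c) simp_all

lemma tet_leibniz:
  "lin tet_diff (tet_prod b c) = lin (\<lambda>x. tet_prod x c) (tet_diff b) + lin (tet_prod b) (tet_diff c)"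
  by (cases b; cases c) (simp_all add: add_ac)

lemma tetA_simps [simp]:
  "part tetA = basis_part tet_deg" "diff tetA = lin tet_diff" "mul tetA = bilin tet_prod"
  "unit tetA = bas E0 + bas E1 + bas E2 + bas E3"
  by (simp_all add: tetA_def tet_mul_eq)

lemma dg_algebra_tetA: "dg_algebra tetA"
proof (rule dg_algebra_basisI[OF tetA_simps(1-3)])
  fix a b c
  show "tet_diff b \<in> basis_part tet_deg (tet_deg b - 1)"
    by (cases b) (auto simp: tet_deg_def intro!: basis_part_add)
  show "lin tet_diff (tet_diff b) = 0"
    by (cases b) (simp_all add: add_ac)
  show "tet_prod b c \<in> basis_part tet_deg (tet_deg b + tet_deg c)"
    by (cases b; cases c) (simp_all add: tet_deg_def)
  show "lin (\<lambda>x. tet_prod x c) (tet_prod a b) = lin (tet_prod a) (tet_prod b c)"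
    by (rule tet_prod_assoc)
  show "unit tetA \<in> basis_part tet_deg 0"
    by (auto simp: tet_deg_def intro!: basis_part_add)
  show "lin (\<lambda>x. tet_prod x b) (unit tetA) = bas b" "lin (tet_prod b) (unit tetA) = bas b"
    by (cases b; simp)+
  show "lin tet_diff (tet_prod b c) = lin (\<lambda>x. tet_prod x c) (tet_diff b) + lin (tet_prod b) (tet_diff c)"
    by (rule tet_leibniz)
qed

section \<open>The local homotopy inner product\<close>

text \<open>The pairs \<open>(m, n)\<close> listed together in the local model are all the pairs
  with one product: \<open>c\<close>, \<open>ij\<close>, \<open>jl\<close> or \<open>j\<close>. Each
  of these gets one series; the long edge \<open>il\<close> and the other vertices get 0.\<close>

definition local_series :: "smplx \<Rightarrow> smplx \<Rightarrow> smplx \<Rightarrow> smplx \<Rightarrow> smplx \<Rightarrow> smplx \<Rightarrow> smplx ncseries" where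
  "local_series ij jl il c j x =
     (if x = c then star il
      else if x = ij then star ij * (letter c * star il)
      else if x = jl then star il * (letter c * star jl)
      else if x = j then star ij * (letter c * (star il * (letter c * star jl)))
      else 0)"

lemma inj_verts: "inj verts"
proof (rule injI)
  fix x y assume "verts x = verts y"
  then show "x = y" by (cases x; cases y) simp_all
qed

lemma local_support_verts:
  assumes v: "verts ei = [i]" "verts ej = [j]" "verts el = [l]" "verts ij = [i,j]" "verts jl = [j,l]"
    "verts il = [i,l]" "verts c = [i,j,l]"
  shows "local_support i j l (map verts as) (verts m) (verts n) \<longleftrightarrow>
    (\<exists>k. as = replicate k il) \<and> (m, n) \<in> {(c, el), (ei, c), (ij, jl)} \<or>
    (\<exists>u v. as = replicate u ij @ c # replicate v il) \<and> (m, n) \<in> {(ei, ij), (ij, ej)} \<or>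
    (\<exists>u v. as = replicate u il @ c # replicate v jl) \<and> (m, n) \<in> {(ej, jl), (jl, el)} \<or>
    (\<exists>u v w. as = replicate u ij @ c # replicate v il @ c # replicate w jl) \<and> (m, n) = (ej, ej)"
proof -
  have eq: "map verts as = map verts bs \<longleftrightarrow> as = bs" for as bs
    by (rule inj_map_eq_map[OF inj_verts])
  have eq1: "verts x = verts y \<longleftrightarrow> x = y" for x y
    using inj_verts by (simp add: inj_eq)
  note words =
    eq[of as "replicate k il" for k, simplified v map_replicate]
    eq[of as "replicate u ij @ c # replicate v il" for u v, simplified v map_replicate map_append list.map]
    eq[of as "replicate u il @ c # replicate v jl" for u v, simplified v map_replicate map_append list.map]
    eq[of as "replicate u ij @ c # replicate v il @ c # replicate w jl" for u v w,
      simplified v map_replicate map_append list.map]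
  note simplices = eq1[of _ ei, unfolded v] eq1[of _ ej, unfolded v] eq1[of _ el, unfolded v]
    eq1[of _ ij, unfolded v] eq1[of _ jl, unfolded v] eq1[of _ il, unfolded v] eq1[of _ c, unfolded v]
  show ?thesis
    unfolding local_support_def words prod.inject insert_iff empty_iff simplices by blast
qed

lemma replicate_letter_star:
  assumes "b \<noteq> c"
  shows "star b * (letter c * star d) = lang (\<lambda>w. \<exists>u v. w = replicate u b @ c # replicate v d)"
  unfolding star_letter_lang[OF assms] by (rule arg_cong[of _ _ lang]) (auto simp: fun_eq_iff)

lemma replicate_letter_star2:
  assumes "b \<noteq> c"
  shows "star b * (letter c * lang (\<lambda>w. \<exists>u v. w = replicate u d @ c # replicate v e)) =
    lang (\<lambda>w. \<exists>u v x. w = replicate u b @ c # replicate v d @ c # replicate x e)"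
  unfolding star_letter_lang[OF assms]
  by (rule arg_cong[of _ _ lang]) (auto simp: fun_eq_iff)

lemma localF_eq:
  "localF 0 1 2 = cochain_hip tet_prod (local_series B01 B12 B02 C012 E1)"
  "localF 0 1 3 = cochain_hip tet_prod (local_series B01 B13 B03 C013 E1)"
  "localF 0 2 3 = cochain_hip tet_prod (local_series B02 B23 B03 C023 E2)"
  "localF 1 2 3 = cochain_hip tet_prod (local_series B12 B23 B13 C123 E2)"
proof -
  note supp =
    local_support_verts[of E0 0 E1 1 E2 2 B01 B12 B02 C012, simplified]
    local_support_verts[of E0 0 E1 1 E3 3 B01 B13 B03 C013, simplified]
    local_support_verts[of E0 0 E2 2 E3 3 B02 B23 B03 C023, simplified]
    local_support_verts[of E1 1 E2 2 E3 3 B12 B23 B13 C123, simplified]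
  note series = local_series_def replicate_letter_star replicate_letter_star2
  show "localF 0 1 2 = cochain_hip tet_prod (local_series B01 B12 B02 C012 E1)"
    unfolding localF_def
  proof (rule hip_lin_eq_cochain_hip)
    fix as m n
    show "of_bool ([] = [] \<and> local_support 0 1 2 (map verts as) (verts m) (verts n)) =
        lin (\<lambda>x. coeff (local_series B01 B12 B02 C012 E1 x) as) (tet_prod m n)"
      \<comment> \<open>\<open>simplified\<close> has turned the vertex \<open>1\<close> into
        \<open>Suc 0\<close>; folding it back makes \<open>supp\<close> match the goal.\<close>
      unfolding supp[unfolded One_nat_def[symmetric]] by (cases m; cases n) (simp_all add: series)
  qed simp
  show "localF 0 1 3 = cochain_hip tet_prod (local_series B01 B13 B03 C013 E1)"
    unfolding localF_def
  proof (rule hip_lin_eq_cochain_hip)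
    fix as m n
    show "of_bool ([] = [] \<and> local_support 0 1 3 (map verts as) (verts m) (verts n)) =
        lin (\<lambda>x. coeff (local_series B01 B13 B03 C013 E1 x) as) (tet_prod m n)"
      unfolding supp[unfolded One_nat_def[symmetric]] by (cases m; cases n) (simp_all add: series)
  qed simp
  show "localF 0 2 3 = cochain_hip tet_prod (local_series B02 B23 B03 C023 E2)"
    unfolding localF_def
  proof (rule hip_lin_eq_cochain_hip)
    fix as m n
    show "of_bool ([] = [] \<and> local_support 0 2 3 (map verts as) (verts m) (verts n)) =
        lin (\<lambda>x. coeff (local_series B02 B23 B03 C023 E2 x) as) (tet_prod m n)"
      unfolding supp by (cases m; cases n) (simp_all add: series)
  qed simp
  show "localF 1 2 3 = cochain_hip tet_prod (local_series B12 B23 B13 C123 E2)"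
    unfolding localF_def
  proof (rule hip_lin_eq_cochain_hip)
    fix as m n
    show "of_bool ([] = [] \<and> local_support 1 2 3 (map verts as) (verts m) (verts n)) =
        lin (\<lambda>x. coeff (local_series B12 B23 B13 C123 E2 x) as) (tet_prod m n)"
      unfolding supp[unfolded One_nat_def[symmetric]] by (cases m; cases n) (simp_all add: series)
  qed simp
qed

section \<open>Closedness of the sum over the four triangles\<close>

definition tet_series :: "smplx \<Rightarrow> smplx ncseries" where
  "tet_series x = local_series B01 B12 B02 C012 E1 x + local_series B01 B13 B03 C013 E1 x +
     local_series B02 B23 B03 C023 E2 x + local_series B12 B23 B13 C123 E2 x"

lemma cochain_hip_add: "cochain_hip ml \<Gamma> + cochain_hip ml \<Gamma>' = cochain_hip ml (\<lambda>x. \<Gamma> x + \<Gamma>' x)"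
  by (simp add: fun_eq_iff cochain_hip_def lin_add_fun)

lemma tetF_eq: "tetF = cochain_hip tet_prod tet_series"
  by (simp add: tetF_def localF_eq[simplified] cochain_hip_add tet_series_def[abs_def] cong: if_cong)

abbreviation tet_der :: "smplx ncseries \<Rightarrow> smplx ncseries" where
  "tet_der \<equiv> bar_der tet_diff tet_prod"

lemma tet_der_edge:
  "tet_der (letter B01) = letter E0 + letter E1 + letter E0 * letter B01 + letter B01 * letter E1"
  "tet_der (letter B02) = letter E0 + letter E2 + letter E0 * letter B02 + letter B02 * letter E2"
  "tet_der (letter B03) = letter E0 + letter E3 + letter E0 * letter B03 + letter B03 * letter E3"
  "tet_der (letter B12) = letter E1 + letter E2 + letter E1 * letter B12 + letter B12 * letter E2"
  "tet_der (letter B13) = letter E1 + letter E3 + letter E1 * letter B13 + letter B13 * letter E3"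
  "tet_der (letter B23) = letter E2 + letter E3 + letter E2 * letter B23 + letter B23 * letter E3"
  by (simp_all add: bar_der_letter UNIV_smplx lookup_add lookup_single add_ac)

lemma tet_der_triangle:
  "tet_der (letter C012) = letter B01 + letter B02 + letter B12 + letter E0 * letter C012 +
     letter C012 * letter E2 + letter B01 * letter B12"
  "tet_der (letter C013) = letter B01 + letter B03 + letter B13 + letter E0 * letter C013 +
     letter C013 * letter E3 + letter B01 * letter B13"
  "tet_der (letter C023) = letter B02 + letter B03 + letter B23 + letter E0 * letter C023 +
     letter C023 * letter E3 + letter B02 * letter B23"
  "tet_der (letter C123) = letter B12 + letter B13 + letter B23 + letter E1 * letter C123 +
     letter C123 * letter E3 + letter B12 * letter B23"
  by (simp_all add: bar_der_letter UNIV_smplx lookup_add lookup_single add_ac)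

text \<open>Products are nested to the right during simplification, where
  \<open>letter_mult_star\<close> matches only at the very end of a product.\<close>

lemma letter_mult_star_assoc [simp]: "letter b * (star b * f) = f + star b * f"
  by (simp add: letter_mult_star distrib_right flip: mult.assoc)

lemma star_mult_letter_assoc [simp]: "star b * (letter b * f) = f + star b * f"
  by (simp add: star_mult_letter distrib_right flip: mult.assoc)

text \<open>In \<open>S (T b) S\<close> with \<open>T b\<close> factored, \<open>1 + b\<close>
  cancels one outer series in each summand: \<open>S e_i (1 + b) S = S e_i\<close> and
  \<open>S (1 + b) e_j S = e_j S\<close>.\<close>

lemma tet_der_star:
  "tet_der (star B01) = star B01 * letter E0 + letter E1 * star B01"
  "tet_der (star B02) = star B02 * letter E0 + letter E2 * star B02"
  "tet_der (star B03) = star B03 * letter E0 + letter E3 * star B03"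
  "tet_der (star B12) = star B12 * letter E1 + letter E2 * star B12"
  "tet_der (star B13) = star B13 * letter E1 + letter E3 * star B13"
  "tet_der (star B23) = star B23 * letter E2 + letter E3 * star B23"
  by (simp_all add: bar_der_star tet_der_edge distrib_left distrib_right mult.assoc letter_mult_star
      star_mult_letter add_ac)

text \<open>Vertex letters arising inside a product cancel between neighbouring factors, those at
  its ends against the outer terms. At a middle vertex \<open>j\<close>, each of the two factors
  \<open>c\<close> leaves a copy of \<open>S_ij c S_jl\<close>, and these cancel. Only the equations
  of the edges need the triangles together.\<close>

lemma tet_series_cocycle:
  "lin tet_series (tet_diff x) + tet_der (tet_series x) +
    (\<Sum>b\<in>UNIV. letter b * lin tet_series (tet_prod x b)) +
    (\<Sum>b\<in>UNIV. lin tet_series (tet_prod b x) * letter b) = 0"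
  by (cases x)
    (simp_all add: UNIV_smplx tet_series_def local_series_def bar_der_mult tet_der_edge tet_der_triangle
      tet_der_star distrib_left distrib_right mult.assoc letter_mult_star star_mult_letter add_ac)

text \<open>Serves the normalization: the unit of \<open>tetA\<close> is a sum of vertices, and no
  word in the supports contains a vertex.\<close>

lemma local_series_vertex:
  assumes "ij \<noteq> c" "il \<noteq> c" "v \<notin> {ij, jl, il, c}" "v \<in> set w"
  shows "coeff (local_series ij jl il c j x) w = 0"
  using assms by (auto simp: local_series_def replicate_letter_star replicate_letter_star2)

lemma homotopy_inner_product_tetF: "homotopy_inner_product tetA tetF"
  unfolding tetF_eq
proof (rule homotopy_inner_product_cochain_hip[OF dg_algebra_tetA tetA_simps(1-3) _ tet_series_cocycle])
  fix x as assume "unit tetA \<in> set as"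
  then obtain xs ys where as: "as = xs @ unit tetA # ys"
    by (meson split_list)
  have "mext (coeff (tet_series x)) (xs @ bas v # ys) = 0" if "v \<in> {E0, E1, E2, E3}" for v
    using that by (intro mext_append_bas) (auto simp: tet_series_def local_series_vertex[where v = E0] local_series_vertex[where v = E1]
          local_series_vertex[where v = E2] local_series_vertex[where v = E3])
  then show "mext (coeff (tet_series x)) as = 0"
    by (simp add: as mext_append_add)
qed

section \<open>Transfer to the cohomology of the sphere\<close>

lemma UNIV_sph: "UNIV = {Cls_e, Cls_s}"
  using sph.exhaust by blast

instance sph :: finite
  by standard (simp add: UNIV_sph)

lemma sphB_simps [simp]:
  "part sphB = basis_part sph_deg" "diff sphB = (\<lambda>x. 0)" "mul sphB = bilin sph_mul"
  "unit sphB = bas Cls_e"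
  by (simp_all add: sphB_def)

lemma sph_mul_e [simp]: "sph_mul x Cls_e = bas x"
  by (cases x) simp_all

lemma dg_algebra_sphB: "dg_algebra sphB"
proof (rule dg_algebra_basisI)
  show "diff sphB = lin (\<lambda>_. 0)"
    by (simp add: fun_eq_iff)
  show "mul sphB = bilin sph_mul" "part sphB = basis_part sph_deg"
    by simp_all
  fix a b c
  show "sph_mul b c \<in> basis_part sph_deg (sph_deg b + sph_deg c)"
    by (cases b; cases c) simp_all
  show "lin (\<lambda>x. sph_mul x c) (sph_mul a b) = lin (sph_mul a) (sph_mul b c)"
    by (cases a; cases b; cases c) simp_all
qed simp_all

lemma dg_algebra_map_sph_to_tet: "dg_algebra_map sphB tetA (lin sph_to_tet)"
  unfolding dg_algebra_map_def
proof (intro conjI allI)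
  show "additive (lin sph_to_tet)"
    by (rule additive_lin)
  show "lin sph_to_tet ` part sphB k \<subseteq> part tetA k" for k
  proof -
    have "sph_to_tet b \<in> basis_part tet_deg (sph_deg b)" for b
      by (cases b) (auto simp: tet_deg_def intro!: basis_part_add)
    then show ?thesis
      by (auto intro!: lin_in_basis_part)
  qed
  show "lin sph_to_tet (diff sphB x) = diff tetA (lin sph_to_tet x)" for x
  proof -
    have "lin tet_diff (sph_to_tet b) = 0" for b
      by (cases b) (simp_all add: add_ac)
    then show ?thesis by (simp add: lin_lin)
  qed
  show "lin sph_to_tet (mul sphB x y) = mul tetA (lin sph_to_tet x) (lin sph_to_tet y)" for x y
  proof -
    have "lin sph_to_tet (sph_mul b c) = bilin tet_prod (sph_to_tet b) (sph_to_tet c)" for b c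
      by (cases b; cases c) simp_all
    then show ?thesis
      using biadditive_eqI[of "\<lambda>x y. lin sph_to_tet (bilin sph_mul x y)"
          "\<lambda>x y. bilin tet_prod (lin sph_to_tet x) (lin sph_to_tet y)" x y]
      by (simp add: additive_def)
  qed
  show "lin sph_to_tet (unit sphB) = unit tetA"
    by simp
qed

definition sph_series :: "sph \<Rightarrow> sph ncseries" where
  "sph_series x = (case x of Cls_s \<Rightarrow> 1 | Cls_e \<Rightarrow> letter Cls_s * letter Cls_s)"

lemma coeff_letter_letter: "coeff (letter b * letter c) w = of_bool (w = [b, c])"
  by (cases w) auto

lemma sphF_eq: "sphF = cochain_hip sph_mul sph_series"
  unfolding sphF_def
proof (rule hip_lin_eq_cochain_hip)
  fix as m n
  show "of_bool ((as, m, [], n) \<in> {([], Cls_s, [], Cls_e), ([], Cls_e, [], Cls_s), ([Cls_s, Cls_s], Cls_e, [], Cls_e)}) =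
      lin (\<lambda>x. coeff (sph_series x) as) (sph_mul m n)"
    by (cases m; cases n) (simp_all add: sph_series_def coeff_letter_letter)
qed simp

lemma homotopy_inner_product_sphF: "homotopy_inner_product sphB sphF"
  unfolding sphF_eq
proof (rule homotopy_inner_product_cochain_hip[OF dg_algebra_sphB])
  show diff: "diff sphB = lin (\<lambda>_. 0)"
    by (simp add: fun_eq_iff)
  show "mul sphB = bilin sph_mul" "part sphB = basis_part sph_deg"
    by simp_all
  fix x
  \<comment> \<open>\<open>s\<close> arises only as \<open>e s\<close> and \<open>s e\<close>: the
    differential vanishes and \<open>s s = 0\<close>.\<close>
  have s: "bar_der (\<lambda>_. 0) sph_mul (letter Cls_s) = letter Cls_e * letter Cls_s + letter Cls_s * letter Cls_e"
    by (simp add: bar_der_letter UNIV_sph lookup_single)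
  show "lin sph_series 0 + bar_der (\<lambda>_. 0) sph_mul (sph_series x) +
      (\<Sum>b\<in>UNIV. letter b * lin sph_series (sph_mul x b)) +
      (\<Sum>b\<in>UNIV. lin sph_series (sph_mul b x) * letter b) = 0"
    by (cases x) (simp_all add: UNIV_sph sph_series_def bar_der_mult s distrib_left distrib_right mult.assoc add_ac)
  fix as assume "unit sphB \<in> set as"
  then obtain xs ys where as: "as = xs @ bas Cls_e # ys"
    by (metis split_list sphB_simps(4))
  show "mext (coeff (sph_series x)) as = 0"
    unfolding as
    by (intro mext_append_bas) (auto simp: sph_series_def coeff_letter_letter split: sph.split)
qed

section \<open>Substitution of letters and the transferred family\<close>

lift_definition pull :: "('c \<Rightarrow> 'b \<Rightarrow>\<^sub>0 bit) \<Rightarrow> 'b ncseries \<Rightarrow> 'c ncseries" is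
  "\<lambda>\<phi> f w. mext f (map \<phi> w)" .

lemma pull_add [simp]: "pull \<phi> (f + g) = pull \<phi> f + pull \<phi> g"
  by transfer (simp add: fun_eq_iff mext_add_fun)

lemma pull_0 [simp]: "pull \<phi> 0 = 0"
  by transfer simp

text \<open>Substitution acts on the two parts of a cut word separately. As a ring homomorphism,
  \<open>pull\<close> is then computed from its values on letters and stars.\<close>

lemma pull_mult [simp]: "pull \<phi> (f * g) = pull \<phi> f * pull \<phi> g"
proof (transfer, rule ext)
  fix \<phi> :: "'c \<Rightarrow> 'b \<Rightarrow>\<^sub>0 bit" and f g :: "'b list \<Rightarrow> bit" and w
  show "mext (conv f g) (map \<phi> w) = conv (\<lambda>w. mext f (map \<phi> w)) (\<lambda>w. mext g (map \<phi> w)) w"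
    by (induction w arbitrary: f)
      (simp_all add: mext_add_fun lin_add_fun conv_lin_left lin_mult_left mext_mult_left)
qed

lemma pull_1 [simp]: "pull \<phi> 1 = 1"
proof (transfer, rule ext)
  show "mext (\<lambda>w. of_bool (w = [])) (map \<phi> w) = (of_bool (w = []) :: bit)" for \<phi> :: "'c \<Rightarrow> 'b \<Rightarrow>\<^sub>0 bit" and w
    by (cases w) simp_all
qed

lemma pull_letter:
  fixes \<phi> :: "'c::finite \<Rightarrow> 'b \<Rightarrow>\<^sub>0 bit"
  shows "pull \<phi> (letter b) = (\<Sum>a\<in>UNIV. if Poly_Mapping.lookup (\<phi> a) b = 1 then letter a else 0)"
proof (rule coeff_eqI)
  fix w
  show "coeff (pull \<phi> (letter b)) w = coeff (\<Sum>a\<in>UNIV. if Poly_Mapping.lookup (\<phi> a) b = 1 then letter a else 0) w"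
    unfolding coeff_sum_letters pull.rep_eq
    by (cases w; cases "tl w") (auto simp: lin_of_bool_eq sum_of_bool_delta)
qed

text \<open>Applying \<open>pull \<phi>\<close> to \<open>letter_mult_star\<close> leaves
  \<open>0 = 1 + pull \<phi> (star b)\<close>.\<close>

lemma pull_star:
  assumes "pull \<phi> (letter b) = 0"
  shows "pull \<phi> (star b) = 1"
  using arg_cong[OF letter_mult_star[of b], of "pull \<phi>"] assms by (simp add: add_eq_0_iff_eq)

lemma transfer_cochain_hip:
  assumes "\<And>x y. lin \<phi> (bilin ml' x y) = bilin ml (lin \<phi> x) (lin \<phi> y)"
    and "\<And>z. \<Gamma>' z = lin (\<lambda>x. pull \<phi> (\<Gamma> x)) (\<phi> z)"
  shows "transfer_hip (lin \<phi>) (cochain_hip ml \<Gamma>) = cochain_hip ml' \<Gamma>'"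
proof (intro ext)
  fix as m bs n
  show "transfer_hip (lin \<phi>) (cochain_hip ml \<Gamma>) as m bs n = cochain_hip ml' \<Gamma>' as m bs n"
    by (simp add: transfer_hip_def cochain_hip_def assms(2) mext_coeff_lin mext_map_lin
        pull.rep_eq lin_lin flip: assms(1))
qed

text \<open>The image of \<open>f\<close> involves no edge and only the triangle
  \<open>C012\<close>, so stars become 1 and the other triangles 0. Of the four vertices only
  \<open>E1\<close>, the middle vertex of \<open>C012\<close>, keeps a non-zero series, namely
  \<open>s s\<close>: this is the origin of the value of \<open>sphF\<close> at two inputs
  \<open>s\<close>. For the class \<open>s\<close>, \<open>star B02\<close> becomes 1.\<close>

lemma transfer_tetF: "transfer_hip (lin sph_to_tet) tetF = sphF"
  unfolding tetF_eq sphF_eq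
proof (rule transfer_cochain_hip)
  show "lin sph_to_tet (bilin sph_mul x y) = bilin tet_prod (lin sph_to_tet x) (lin sph_to_tet y)" for x y
    using dg_algebra_map_sph_to_tet by (simp add: dg_algebra_map_def)
  have edges: "pull sph_to_tet (letter b) = 0" if "b \<in> {B01, B02, B03, B12, B13, B23, C013, C023, C123}" for b
    using that by (auto simp: pull_letter UNIV_sph lookup_add lookup_single)
  have face: "pull sph_to_tet (letter C012) = letter Cls_s"
    by (simp add: pull_letter UNIV_sph lookup_add lookup_single)
  show "sph_series z = lin (\<lambda>x. pull sph_to_tet (tet_series x)) (sph_to_tet z)" for z
    by (cases z) (simp_all add: sph_series_def tet_series_def local_series_def pull_star edges face)
qed

section \<open>Hochschild cochains of the cohomology of the sphere\<close>

text \<open>Scalar multiplication by a bit, for spaces that are given only as additive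
  groups.\<close>

definition sc :: "bit \<Rightarrow> 'v::char_two \<Rightarrow> 'v" where
  "sc x m = (if x = 1 then m else 0)"

lemma sc_simps [simp]: "sc 0 m = 0" "sc 1 m = m" "sc x 0 = 0"
  by (simp_all add: sc_def)

lemma sc_add_left: "sc (x + y) m = sc x m + sc y m"
  by (cases x; cases y) simp_all

lemma sc_add_right: "sc x (m + n) = sc x m + sc x n"
  by (cases x) simp_all

lemma sc_mult: "sc (x * y) m = sc x (sc y m)"
  by (cases x; cases y) simp_all

lemma sc_sum_left: "sc (sum f I) m = (\<Sum>i\<in>I. sc (f i) m)"
  by (induction I rule: infinite_finite_induct) (simp_all add: sc_add_left)

lemma additive_sc: "additive f \<Longrightarrow> f (sc x m) = sc x (f m)"
  by (cases x) (simp_all add: additive.zero)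

lemma sc_bit [simp]: "sc x y = x * (y :: bit)"
  by (cases x) simp_all

lemma sc_apply: "sc x f a = sc x (f a)"
  by (cases x) simp_all

lemma lookup_sc: "Poly_Mapping.lookup (sc x p) b = x * Poly_Mapping.lookup p b"
  by (cases x) simp_all

section \<open>Coordinates of the inputs and telescoping of the merges\<close>

abbreviation s_coeff :: "(sph \<Rightarrow>\<^sub>0 bit) \<Rightarrow> bit" where
  "s_coeff a \<equiv> Poly_Mapping.lookup a Cls_s"

abbreviation e_coeff :: "(sph \<Rightarrow>\<^sub>0 bit) \<Rightarrow> bit" where
  "e_coeff a \<equiv> Poly_Mapping.lookup a Cls_e"

lemma sph_decomp: "a = sc (e_coeff a) (bas Cls_e) + sc (s_coeff a) (bas Cls_s)"
proof (rule poly_mapping_eqI)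
  fix b show "Poly_Mapping.lookup a b =
      Poly_Mapping.lookup (sc (e_coeff a) (bas Cls_e) + sc (s_coeff a) (bas Cls_s)) b"
    by (cases b) (simp_all add: lookup_add lookup_sc lookup_single)
qed

lemma lin_sph: "lin g x = sc (e_coeff x) (g Cls_e) + sc (s_coeff x) (g Cls_s)"
  by (simp add: lin_UNIV UNIV_sph sc_def)

lemma lookup_sph_mul [simp]:
  "e_coeff (bilin sph_mul x y) = e_coeff x * e_coeff y"
  "s_coeff (bilin sph_mul x y) = e_coeff x * s_coeff y + s_coeff x * e_coeff y"
  by (simp_all add: bilin_lin lin_sph lookup_add lookup_sc lookup_single algebra_simps)

definition s_prod :: "(sph \<Rightarrow>\<^sub>0 bit) list \<Rightarrow> bit" where
  "s_prod as = (\<Prod>a\<leftarrow>as. s_coeff a)"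

lemma s_prod_simps [simp]:
  "s_prod [] = 1" "s_prod (a # as) = s_coeff a * s_prod as" "s_prod (as @ bs) = s_prod as * s_prod bs"
  by (simp_all add: s_prod_def)

lemma s_prod_replicate [simp]: "s_prod (replicate n (bas Cls_s)) = 1"
  by (induction n) (simp_all add: lookup_single)

lemma s_prod_rotate [simp]: "s_prod (rotate j as) = s_prod as"
proof -
  have "s_prod (rotate1 as) = s_prod as" for as
    by (cases as) (simp_all add: mult.commute)
  then show ?thesis
    by (induction j) (simp_all add: rotate_Suc)
qed

lemma s_prod_unit: "bas Cls_e \<in> set as \<Longrightarrow> s_prod as = 0"
  by (induction as) (auto simp: lookup_single)

text \<open>Let \<open>P i\<close> be the product with \<open>e_coeff\<close> at position
  \<open>i\<close> and \<open>s_coeff\<close> elsewhere. The merge at \<open>j\<close> gives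
  \<open>P j + P (j + 1)\<close>, so the sum telescopes modulo 2 to its two ends; the outer terms of
  the Hochschild differential cancel these.\<close>

lemma s_prod_merge:
  "as \<noteq> [] \<Longrightarrow> (\<Sum>j<length as - 1. s_prod (merge sphB j as)) =
     e_coeff (hd as) * s_prod (tl as) + s_prod (butlast as) * e_coeff (last as)"
proof (induction as rule: induct_list012)
  case (3 a b as)
  have "(\<Sum>j<length (a # b # as) - 1. s_prod (merge sphB j (a # b # as))) =
      s_prod (bilin sph_mul a b # as) + s_coeff a * (\<Sum>j<length (b # as) - 1. s_prod (merge sphB j (b # as)))"
    by (simp add: sum.lessThan_Suc_shift sum_distrib_left del: sum.lessThan_Suc)
  also have "\<dots> = e_coeff a * s_prod (b # as) + s_prod (butlast (a # b # as)) * e_coeff (last (b # as))"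
    using 3(2) by (simp add: algebra_simps)
  finally show ?case by simp
qed (simp_all add: mult.commute)

lemma multilinear_slot:
  assumes "multilinear \<phi>" "normalized sphB \<phi>"
  shows "\<phi> (xs @ a # ys) = sc (s_coeff a) (\<phi> (xs @ bas Cls_s # ys) :: 'm::char_two)"
proof -
  have add: "additive (\<lambda>y. \<phi> (xs @ y # ys))"
    using assms(1) by (simp add: additive_def multilinear_def)
  have "\<phi> (xs @ bas Cls_e # ys) = 0"
    using assms(2) by (simp add: normalized_def)
  then have "\<phi> (xs @ (sc (e_coeff a) (bas Cls_e) + sc (s_coeff a) (bas Cls_s)) # ys) =
      sc (s_coeff a) (\<phi> (xs @ bas Cls_s # ys))"
    using additive_add[OF add] additive_sc[OF add] by simp
  then show ?thesis
    using sph_decomp[of a] by metis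
qed

lemma cochain_determined:
  assumes "multilinear \<phi>" "normalized sphB \<phi>"
  shows "\<phi> as = sc (s_prod as) (\<phi> (replicate (length as) (bas Cls_s)) :: 'm::char_two)"
proof -
  \<comment> \<open>The prefix \<open>xs\<close> absorbs the slots already replaced by
    \<open>s\<close>.\<close>
  have "\<phi> (xs @ as) = sc (s_prod as) (\<phi> (xs @ replicate (length as) (bas Cls_s)))" for xs
  proof (induction as arbitrary: xs)
    case (Cons a as)
    have "\<phi> (xs @ a # as) = sc (s_coeff a) (\<phi> ((xs @ [bas Cls_s]) @ as))"
      by (simp add: multilinear_slot[OF assms, of xs a])
    then show ?case
      unfolding Cons.IH by (simp add: sc_mult)
  qed simp
  from this[of "[]"] show ?thesis by simp
qed

text \<open>Coordinates on the cochains with values in a bimodule with basis \<open>u\<close>, \<open>v\<close>: the coefficients of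
  \<open>Alpha r\<close> and \<open>Beta r\<close> belong to the cochains sending \<open>(s, \<dots>, s)\<close> with \<open>r\<close> entries to \<open>u\<close> and
  to \<open>v\<close>.\<close>

definition coch :: "'m \<Rightarrow> 'm \<Rightarrow> (st_gen \<Rightarrow>\<^sub>0 bit) \<Rightarrow> (sph \<Rightarrow>\<^sub>0 bit) list \<Rightarrow> 'm::char_two" where
  "coch u v x as = sc (s_prod as)
     (sc (Poly_Mapping.lookup x (Alpha (length as))) u + sc (Poly_Mapping.lookup x (Beta (length as))) v)"

lemma coch_add: "coch u v (x + y) = coch u v x + coch u v y"
  by (simp add: fun_eq_iff coch_def lookup_add sc_add_left sc_add_right add_ac)

lemma additive_coch: "additive (coch u v)"
  by (simp add: additive_def coch_add)

lemma coch_0 [simp]: "coch u v 0 = 0"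
  by (simp add: fun_eq_iff coch_def)

fun st_index :: "st_gen \<Rightarrow> nat" where
  "st_index (Alpha k) = k"
| "st_index (Beta k) = k"

fun st_val :: "'m \<Rightarrow> 'm \<Rightarrow> st_gen \<Rightarrow> 'm" where
  "st_val u v (Alpha k) = u"
| "st_val u v (Beta k) = v"

lemma coch_bas: "coch u v (bas g) as = sc (s_prod as) (if length as = st_index g then st_val u v g else 0)"
  by (cases g) (auto simp: coch_def lookup_single when_def)

lemma total_space_image:
  assumes part: "part X = (\<lambda>k. \<Phi> ` basis_part dg k)" and add: "additive \<Phi>"
  shows "total_space X = range \<Phi>"
proof
  have \<Phi>0: "\<Phi> 0 = 0"
    by (rule additive.zero[OF add])
  show "total_space X \<subseteq> range \<Phi>"
  proof
    fix y assume "y \<in> total_space X"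
    then obtain c where c: "\<And>k. c k \<in> \<Phi> ` basis_part dg k" "y = (\<Sum>k | c k \<noteq> 0. c k)"
      unfolding total_space_def part by auto
    have "\<forall>k. \<exists>x. c k = \<Phi> x"
      using c(1) by blast
    then obtain x where "\<And>k. c k = \<Phi> (x k)"
      by metis
    then have "y = \<Phi> (\<Sum>k | c k \<noteq> 0. x k)"
      unfolding c(2) additive.sum[OF add] by simp
    then show "y \<in> range \<Phi>"
      by blast
  qed
  show "range \<Phi> \<subseteq> total_space X"
  proof
    fix y assume "y \<in> range \<Phi>"
    then obtain x where y: "y = \<Phi> x" by blast
    let ?c = "\<lambda>k. \<Phi> (homog_comp dg k x)"
    \<comment> \<open>\<open>\<Phi>\<close> may send a non-zero component to 0, so the two supports
      are compared by inclusion.\<close>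
    have sub: "{k. ?c k \<noteq> 0} \<subseteq> {k. homog_comp dg k x \<noteq> 0}"
      by (auto simp: \<Phi>0)
    have "(\<Sum>k | ?c k \<noteq> 0. ?c k) = (\<Sum>k | homog_comp dg k x \<noteq> 0. ?c k)"
      using sub homog_comp_finite by (intro sum.mono_neutral_left) auto
    also have "\<dots> = y"
      by (simp add: y sum_homog_comp flip: additive.sum[OF add])
    finally have "(\<forall>k. ?c k \<in> part X k) \<and> finite {k. ?c k \<noteq> 0} \<and> y = (\<Sum>k | ?c k \<noteq> 0. ?c k)"
      using sub homog_comp_finite[of dg x] by (auto simp: part intro: finite_subset)
    then show "y \<in> total_space X"
      unfolding total_space_def by (intro CollectI exI[of _ ?c])
  qed
qed

text \<open>\<open>B\<close> and its dual have the same shape: two basis vectors, zero differential,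
  \<open>e\<close> acting as the identity and \<open>s\<close> by one map \<open>N\<close> on both
  sides. Their cohomology is computed once for both.\<close>

locale sph_bimod =
  fixes M :: "(sph \<Rightarrow>\<^sub>0 bit, 'm::char_two) dg_bimod" and u v :: 'm and du dv :: int and N :: "'m \<Rightarrow> 'm"
  assumes part_M: "part M k = {sc x u + sc y v | x y. (x = 1 \<longrightarrow> k = du) \<and> (y = 1 \<longrightarrow> k = dv)}"
    and indep: "sc x u + sc y v = 0 \<Longrightarrow> x = 0 \<and> y = 0"
    and diff_M: "diff M (sc x u + sc y v) = 0"
    and lact_M: "lact M a (sc x u + sc y v) = sc (e_coeff a) (sc x u + sc y v) + sc (s_coeff a) (N (sc x u + sc y v))"
    and ract_M: "ract M (sc x u + sc y v) a = sc (e_coeff a) (sc x u + sc y v) + sc (s_coeff a) (N (sc x u + sc y v))"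
    and N_0: "N 0 = 0"
begin

fun dg :: "st_gen \<Rightarrow> int" where
  "dg (Alpha k) = int k + du"
| "dg (Beta k) = int k + dv"

text \<open>A non-zero \<open>s_prod as\<close> forces an \<open>s\<close> component, hence degree
  -2, on every entry; after the shift each entry counts -1.\<close>

lemma degree_sum:
  assumes "list_all2 (\<lambda>a i. a \<in> basis_part sph_deg i) as ds" "s_prod as = 1"
  shows "(\<Sum>i\<leftarrow>ds. i + 1) = - int (length as)"
  using assms
proof (induction rule: list_all2_induct)
  case (Cons a as d ds)
  then have "s_coeff a = 1" "s_prod as = 1"
    by (cases "s_coeff a"; cases "s_prod as"; simp)+
  moreover from this have "d = -2"
    using Cons(1) by (auto simp: basis_part_iff dest: spec[of _ Cls_s])
  ultimately show ?case
    using Cons by simp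
qed simp

lemma coch_in_CH_part:
  assumes "x \<in> basis_part dg k"
  shows "coch u v x \<in> CH_part sphB M k"
  unfolding CH_part_def
proof (intro CollectI conjI allI impI)
  show "multilinear (coch u v x)"
    by (simp add: multilinear_def coch_def lookup_add algebra_simps sc_add_left)
  show "normalized sphB (coch u v x)"
    by (simp add: normalized_def coch_def s_prod_unit)
  fix as ds assume ds: "list_all2 (\<lambda>a i. a \<in> part sphB i) as ds"
  let ?n = "length as"
  show "coch u v x as \<in> part M (k + (\<Sum>i\<leftarrow>ds. i + 1))"
  proof (cases "s_prod as = 1")
    case True
    then have "(\<Sum>i\<leftarrow>ds. i + 1) = - int ?n"
      using degree_sum ds by simp
    moreover have "Poly_Mapping.lookup x (Alpha ?n) = 1 \<longrightarrow> k - int ?n = du"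
      "Poly_Mapping.lookup x (Beta ?n) = 1 \<longrightarrow> k - int ?n = dv"
      using assms by (auto simp: basis_part_iff)
    ultimately show ?thesis
      using True unfolding part_M coch_def by auto
  next
    case False
    then have "coch u v x as = sc 0 u + sc 0 v"
      by (simp add: coch_def)
    then show ?thesis
      unfolding part_M by fastforce
  qed
qed

text \<open>A degree \<open>k\<close> leaves one possible arity for each of the values
  \<open>u\<close> and \<open>v\<close>. So homogeneous cochains correspond to finitely supported
  vectors, although cochains form a product over all arities.\<close>

lemma CH_part_subset:
  assumes "\<phi> \<in> CH_part sphB M k"
  shows "\<phi> \<in> coch u v ` basis_part dg k"
proof -
  have \<phi>: "multilinear \<phi>" "normalized sphB \<phi>"
    using assms by (simp_all add: CH_part_def)
  have "\<phi> (replicate n (bas Cls_s)) \<in> part M (k - int n)" for n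
  proof -
    have "list_all2 (\<lambda>a i. a \<in> part sphB i) (replicate n (bas Cls_s)) (replicate n (- 2))"
      by (simp add: list_all2_conv_all_nth)
    moreover have "(\<Sum>i\<leftarrow>replicate n (- 2 :: int). i + 1) = - int n"
      by (induction n) simp_all
    ultimately show ?thesis
      using assms unfolding CH_part_def by fastforce
  qed
  then have "\<exists>x y. \<phi> (replicate n (bas Cls_s)) = sc x u + sc y v \<and>
      (x = 1 \<longrightarrow> k - int n = du) \<and> (y = 1 \<longrightarrow> k - int n = dv)" for n
    unfolding part_M by blast
  then obtain x y where xy: "\<And>n. \<phi> (replicate n (bas Cls_s)) = sc (x n) u + sc (y n) v"
    "\<And>n. x n = 1 \<Longrightarrow> k - int n = du" "\<And>n. y n = 1 \<Longrightarrow> k - int n = dv"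
    by metis
  \<comment> \<open>The only arities at which \<open>u\<close> and \<open>v\<close> can occur. If
    \<open>k < du\<close>, the truncation to 0 is harmless, since then every \<open>x n\<close> is
    0; likewise for \<open>dv\<close> and \<open>y\<close>.\<close>
  define p q where "p = nat (k - du)" and "q = nat (k - dv)"
  have pq: "x n = 0" if "n \<noteq> p" for n
    using xy(2)[of n] that by (cases "x n") (auto simp: p_def)
  have qp: "y n = 0" if "n \<noteq> q" for n
    using xy(3)[of n] that by (cases "y n") (auto simp: q_def)
  define z where "z = sc (x p) (bas (Alpha p)) + sc (y q) (bas (Beta q))"
  have "Poly_Mapping.lookup z (Alpha n) = x n" "Poly_Mapping.lookup z (Beta n) = y n" for n
    using pq[of n] qp[of n] by (auto simp: z_def lookup_add lookup_sc lookup_single when_def)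
  then have "\<phi> as = coch u v z as" for as
    unfolding cochain_determined[OF \<phi>, of as] coch_def xy(1) by simp
  moreover have "z \<in> basis_part dg k"
    using xy(2)[of p] xy(3)[of q] unfolding z_def
    by (intro basis_part_add) (auto simp: sc_def)
  ultimately show ?thesis by blast
qed

lemma part_CH: "part (CH sphB M) = (\<lambda>k. coch u v ` basis_part dg k)"
  using coch_in_CH_part CH_part_subset by (auto simp: CH_def fun_eq_iff)

lemma total_space_CH: "total_space (CH sphB M) = range (coch u v)"
  by (rule total_space_image[OF part_CH additive_coch])

lemma inj_coch: "inj (coch u v)"
proof (rule injI)
  fix x y assume "coch u v x = coch u v y"
  then have "coch u v (x + y) = 0"
    by (simp add: coch_add)
  then have "coch u v (x + y) (replicate n (bas Cls_s)) = 0" for n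
    by simp
  then have "Poly_Mapping.lookup (x + y) (Alpha n) = 0 \<and> Poly_Mapping.lookup (x + y) (Beta n) = 0" for n
    by (intro indep) (simp add: coch_def)
  then have "Poly_Mapping.lookup (x + y) g = 0" for g
    by (cases g) auto
  then have "x + y = 0"
    by (intro poly_mapping_eqI) simp
  then show "x = y"
    by (simp add: add_eq_0_iff_eq)
qed

lemma diff_M_coch: "diff M (coch u v x as) = 0"
proof -
  have "coch u v x as = sc (s_prod as * Poly_Mapping.lookup x (Alpha (length as))) u +
      sc (s_prod as * Poly_Mapping.lookup x (Beta (length as))) v"
    by (simp add: coch_def sc_add_right sc_mult)
  then show ?thesis
    by (simp only: diff_M)
qed

text \<open>The merges telescope to the \<open>e\<close> parts of the two outer terms, and the
  \<open>s\<close> parts of these both equal \<open>s_prod as\<close> times \<open>N c\<close>;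
  everything cancels in pairs.\<close>

lemma diff_coch: "diff (CH sphB M) (coch u v x) = 0"
proof
  fix as
  show "diff (CH sphB M) (coch u v x) as = 0 as"
  proof (cases "as = []")
    case False
    define n where "n = length as - 1"
    define c where "c = sc (Poly_Mapping.lookup x (Alpha n)) u + sc (Poly_Mapping.lookup x (Beta n)) v"
    have len: "length (tl as) = n" "length (butlast as) = n" "\<And>j. j < n \<Longrightarrow> length (merge sphB j as) = n"
      using False by (auto simp: n_def merge_def min_def)
    have N: "N (sc y c) = sc y (N c)" for y
      by (cases y) (simp_all add: N_0)
    have act: "lact M a (sc y c) = sc (e_coeff a) (sc y c) + sc (s_coeff a) (sc y (N c))"
      "ract M (sc y c) a = sc (e_coeff a) (sc y c) + sc (s_coeff a) (sc y (N c))" for a y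
    proof -
      have "sc y c = sc (y * Poly_Mapping.lookup x (Alpha n)) u + sc (y * Poly_Mapping.lookup x (Beta n)) v"
        by (simp add: c_def sc_mult sc_add_right)
      then show "lact M a (sc y c) = sc (e_coeff a) (sc y c) + sc (s_coeff a) (sc y (N c))"
        "ract M (sc y c) a = sc (e_coeff a) (sc y c) + sc (s_coeff a) (sc y (N c))"
        using lact_M[of a] ract_M[of _ _ a] by (metis N)+
    qed
    have "(\<Sum>j<n. coch u v x (merge sphB j as)) = sc (\<Sum>j<n. s_prod (merge sphB j as)) c"
      unfolding sc_sum_left by (intro sum.cong) (auto simp: coch_def len c_def)
    also have "\<dots> = sc (e_coeff (hd as)) (sc (s_prod (tl as)) c) + sc (e_coeff (last as)) (sc (s_prod (butlast as)) c)"
      using s_prod_merge[OF False] by (simp add: n_def sc_add_left sc_mult mult.commute[of "s_prod (butlast as)"])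
    finally have merge: "(\<Sum>j<length as - 1. coch u v x (merge sphB j as)) = \<dots>"
      by (simp add: n_def)
    have zero: "s_prod (apply_diff sphB j as) = 0" if "j < length as" for j
      using that by (induction as arbitrary: j) (auto simp: apply_diff_def less_Suc_eq_0_disj)
    have "coch u v x (tl as) = sc (s_prod (tl as)) c" "coch u v x (butlast as) = sc (s_prod (butlast as)) c"
      by (simp_all only: coch_def len c_def)
    moreover have "s_prod as = s_coeff (hd as) * s_prod (tl as)"
      using False by (cases as) simp_all
    moreover have "s_prod as = s_coeff (last as) * s_prod (butlast as)"
      using False by (cases as rule: rev_cases) simp_all
    moreover have "(\<Sum>j<length as. coch u v x (apply_diff sphB j as)) = 0"
      by (intro sum.neutral) (simp add: coch_def zero)
    ultimately show ?thesis
      using False by (simp add: CH_def CH_diff_def diff_M_coch merge[unfolded One_nat_def] act add_ac flip: sc_mult)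
  qed (simp add: CH_def CH_diff_def diff_M_coch)
qed

text \<open>All coboundaries vanish, so classes are singletons and induced maps are read off from
  cochains.\<close>

lemma coh_class_CH: "coh_class (CH sphB M) \<phi> = {\<phi>}"
proof -
  have "{\<phi> + diff (CH sphB M) y | y. y \<in> range (coch u v)} = {\<phi>}"
    by (auto simp: diff_coch intro!: exI[of _ "coch u v 0"] simp del: coch_0)
  then show ?thesis
    by (simp add: coh_class_def total_space_CH)
qed

lemma carrier_cohomology: "carrier (cohomology (CH sphB M)) = range (\<lambda>x. {coch u v x})"
  by (auto simp: cohomology_def total_space_CH coh_class_CH diff_coch)

lemma coh_part_CH: "coh_part (CH sphB M) k = (\<lambda>x. {coch u v x}) ` basis_part dg k"
  by (auto simp: coh_part_def part_CH coh_class_CH diff_coch)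

end

section \<open>Transport of BV algebras\<close>

lemma (in ring) hom_finsum_iso:
  assumes "abelian_monoid R'" "h \<in> ring_hom R R'" "h \<zero> = \<zero>\<^bsub>R'\<^esub>" "f \<in> A \<rightarrow> carrier R"
  shows "h (\<Oplus>x\<in>A. f x) = (\<Oplus>\<^bsub>R'\<^esub>x\<in>A. h (f x))"
proof -
  interpret R': abelian_monoid R' by fact
  show ?thesis
    using assms(4)
  proof (induction A rule: infinite_finite_induct)
    case (insert a A)
    then have "(\<lambda>x. h (f x)) \<in> insert a A \<rightarrow> carrier R'"
      using ring_hom_closed[OF assms(2)] by blast
    then show ?case
      using insert ring_hom_add[OF assms(2)] by (simp add: Pi_def finsum_closed)
  qed (simp_all add: assms(3))
qed

text \<open>The axioms are checked in \<open>string_bv\<close>, where they concern basis vectors,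
  and carried to Hochschild cohomology. The zero is a separate premise because
  \<open>ring_iso\<close> speaks only of sums, products and one.\<close>

lemma bv_algebra_transport:
  assumes S: "bv_algebra S" and h: "h \<in> ring_iso S R" and zero: "h \<zero>\<^bsub>S\<^esub> = \<zero>\<^bsub>R\<^esub>"
    and part: "\<And>k. h ` bv_part S k = bv_part R k"
    and op: "\<And>x. x \<in> carrier S \<Longrightarrow> bv_op R (h x) = h (bv_op S x)"
  shows "bv_algebra R"
proof -
  interpret S: cring S
    using S by (simp add: bv_algebra_def)
  note closed = ring_iso_memE(1)[OF h] and mult = ring_iso_memE(2)[OF h]
    and add = ring_iso_memE(3)[OF h] and one = ring_iso_memE(4)[OF h] and bij = ring_iso_memE(5)[OF h]
  have hom: "h \<in> ring_hom S R"
    using h by (simp add: ring_iso_def)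
  have carrier: "carrier R = h ` carrier S"
    using bij by (simp add: bij_betw_def)
  have inj: "inj_on h (carrier S)"
    using bij by (simp add: bij_betw_def)
  have "cring (R \<lparr> zero := h \<zero>\<^bsub>S\<^esub> \<rparr>)"
    by (rule S.ring_iso_imp_img_cring[OF h])
  then interpret R: cring R
    by (simp add: zero)
  have part_S: "x \<in> carrier S" if "x \<in> bv_part S k" for x k
  proof -
    have "subgroup (bv_part S k) (add_monoid S)"
      using S by (simp add: bv_algebra_def)
    from subgroup.subset[OF this] show ?thesis
      using that by auto
  qed
  have op_closed: "bv_op S x \<in> carrier S" if "x \<in> carrier S" for x
    using S that by (auto simp: bv_algebra_def hom_def)
  have op_add: "bv_op S (x \<oplus>\<^bsub>S\<^esub> y) = bv_op S x \<oplus>\<^bsub>S\<^esub> bv_op S y" if "x \<in> carrier S" "y \<in> carrier S" for x y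
    using S that by (auto simp: bv_algebra_def hom_def)
  have zero_iff: "h x = \<zero>\<^bsub>R\<^esub> \<longleftrightarrow> x = \<zero>\<^bsub>S\<^esub>" if "x \<in> carrier S" for x
    using that inj_onD[OF inj, of x "\<zero>\<^bsub>S\<^esub>"] zero S.zero_closed by auto
  have finsum: "h (\<Oplus>\<^bsub>S\<^esub>k\<in>K. c k) = (\<Oplus>\<^bsub>R\<^esub>k\<in>K. h (c k))" if "\<And>k. c k \<in> carrier S" for c and K :: "int set"
    using that by (intro S.hom_finsum_iso[OF R.abelian_monoid_axioms hom zero]) auto
  show ?thesis
    unfolding bv_algebra_def
  proof (intro conjI allI ballI)
    show "cring R" by (rule R.cring_axioms)
    show "x \<oplus>\<^bsub>R\<^esub> x = \<zero>\<^bsub>R\<^esub>" if x: "x \<in> carrier R" for x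
    proof -
      obtain a where a: "a \<in> carrier S" "x = h a"
        using x carrier by blast
      then have "a \<oplus>\<^bsub>S\<^esub> a = \<zero>\<^bsub>S\<^esub>"
        using S by (simp add: bv_algebra_def)
      then show ?thesis
        using a by (metis add zero)
    qed
    show "subgroup (bv_part R k) (add_monoid R)" for k
    proof -
      interpret group_hom "add_monoid S" "add_monoid R" h
        using closed add
        by (auto simp: group_hom_def group_hom_axioms_def hom_def intro: S.a_group R.a_group)
      show ?thesis
        using S subgroup_img_is_subgroup[of "bv_part S k"] by (simp add: bv_algebra_def part)
    qed
    show "\<exists>!c. (\<forall>k. c k \<in> bv_part R k) \<and> finite {k. c k \<noteq> \<zero>\<^bsub>R\<^esub>} \<and>
        x = (\<Oplus>\<^bsub>R\<^esub>k\<in>{k. c k \<noteq> \<zero>\<^bsub>R\<^esub>}. c k)" if x: "x \<in> carrier R" for x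
    proof -
      obtain a where a: "a \<in> carrier S" "x = h a"
        using x carrier by blast
      let ?P = "\<lambda>c. (\<forall>k. c k \<in> bv_part S k) \<and> finite {k. c k \<noteq> \<zero>\<^bsub>S\<^esub>} \<and>
        a = (\<Oplus>\<^bsub>S\<^esub>k\<in>{k. c k \<noteq> \<zero>\<^bsub>S\<^esub>}. c k)"
      have ex1: "\<exists>!c. ?P c"
        using S a by (simp add: bv_algebra_def)
      then obtain c where c: "?P c" by blast
      have hc: "x = (\<Oplus>\<^bsub>R\<^esub>k\<in>{k. c k \<noteq> \<zero>\<^bsub>S\<^esub>}. h (c k))"
      proof -
        have "h a = h (\<Oplus>\<^bsub>S\<^esub>k\<in>{k. c k \<noteq> \<zero>\<^bsub>S\<^esub>}. c k)"
          using c by simp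
        also have "\<dots> = (\<Oplus>\<^bsub>R\<^esub>k\<in>{k. c k \<noteq> \<zero>\<^bsub>S\<^esub>}. h (c k))"
          using c part_S by (intro finsum) blast
        finally show ?thesis by (simp add: a)
      qed
      have supp: "{k. h (c k) \<noteq> \<zero>\<^bsub>R\<^esub>} = {k. c k \<noteq> \<zero>\<^bsub>S\<^esub>}" if "\<And>k. c k \<in> carrier S" for c :: "int \<Rightarrow> _"
        using that by (simp add: zero_iff)
      show ?thesis
      proof (rule ex1I[of _ "\<lambda>k. h (c k)"])
        have "h (c k) \<in> bv_part R k" for k
          using c part by blast
        then show "(\<forall>k. h (c k) \<in> bv_part R k) \<and> finite {k. h (c k) \<noteq> \<zero>\<^bsub>R\<^esub>} \<and>
            x = (\<Oplus>\<^bsub>R\<^esub>k\<in>{k. h (c k) \<noteq> \<zero>\<^bsub>R\<^esub>}. h (c k))"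
          using c hc supp[of c] part_S[OF c[THEN conjunct1, rule_format]] by auto
      next
        fix d
        assume d: "(\<forall>k. d k \<in> bv_part R k) \<and> finite {k. d k \<noteq> \<zero>\<^bsub>R\<^esub>} \<and>
            x = (\<Oplus>\<^bsub>R\<^esub>k\<in>{k. d k \<noteq> \<zero>\<^bsub>R\<^esub>}. d k)"
        \<comment> \<open>A second decomposition in \<open>R\<close> is pulled back along
          \<open>h\<close>, where uniqueness in \<open>S\<close> applies.\<close>
        have "\<forall>k. \<exists>y. y \<in> bv_part S k \<and> d k = h y"
          using d part by blast
        then obtain c' where c': "\<And>k. c' k \<in> bv_part S k" "\<And>k. d k = h (c' k)"
          by metis
        then have c'S: "\<And>k. c' k \<in> carrier S"
          using part_S by blast
        have "h a = h (\<Oplus>\<^bsub>S\<^esub>k\<in>{k. c' k \<noteq> \<zero>\<^bsub>S\<^esub>}. c' k)"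
          using d finsum[OF c'S] a by (simp add: c'(2) supp[OF c'S])
        then have "a = (\<Oplus>\<^bsub>S\<^esub>k\<in>{k. c' k \<noteq> \<zero>\<^bsub>S\<^esub>}. c' k)"
          using inj a c'S by (auto dest!: inj_onD intro!: S.finsum_closed)
        then have "?P c'"
          using c' d supp[OF c'S] by simp
        then have "c' = c"
          using ex1 c by blast
        then show "d = (\<lambda>k. h (c k))"
          using c'(2) by auto
      qed
    qed
    show "\<one>\<^bsub>R\<^esub> \<in> bv_part R 0"
      using S by (simp add: bv_algebra_def flip: one part)
    show "x \<otimes>\<^bsub>R\<^esub> y \<in> bv_part R (i + j)" if xy: "x \<in> bv_part R i" "y \<in> bv_part R j" for i j x y
    proof -
      obtain a b where ab: "a \<in> bv_part S i" "b \<in> bv_part S j" "x = h a" "y = h b"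
        using xy part by blast
      then have "a \<otimes>\<^bsub>S\<^esub> b \<in> bv_part S (i + j)"
        using S by (simp add: bv_algebra_def)
      then show ?thesis
        using ab part_S part by (metis image_eqI mult)
    qed
    show "bv_op R \<in> hom (add_monoid R) (add_monoid R)"
    proof -
      have "bv_op R (h a \<oplus>\<^bsub>R\<^esub> h b) = bv_op R (h a) \<oplus>\<^bsub>R\<^esub> bv_op R (h b)"
        if "a \<in> carrier S" "b \<in> carrier S" for a b
        using that by (simp add: op op_closed op_add flip: add)
      then show ?thesis
        by (auto simp: hom_def carrier op op_closed)
    qed
    show "bv_op R ` bv_part R k \<subseteq> bv_part R (k + 1)" for k
    proof -
      have "bv_op S ` bv_part S k \<subseteq> bv_part S (k + 1)"
        using S by (simp add: bv_algebra_def)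
      then show ?thesis
        using op[OF part_S] by (auto simp flip: part)
    qed
    show "bv_op R (bv_op R x) = \<zero>\<^bsub>R\<^esub>" if "x \<in> carrier R" for x
    proof -
      have "bv_op S (bv_op S a) = \<zero>\<^bsub>S\<^esub>" if "a \<in> carrier S" for a
        using S that by (simp add: bv_algebra_def)
      then show ?thesis
        using that by (auto simp: carrier op op_closed zero)
    qed
    show "bv_op R (x \<otimes>\<^bsub>R\<^esub> y \<otimes>\<^bsub>R\<^esub> z) =
        bv_op R (x \<otimes>\<^bsub>R\<^esub> y) \<otimes>\<^bsub>R\<^esub> z \<oplus>\<^bsub>R\<^esub> x \<otimes>\<^bsub>R\<^esub> bv_op R (y \<otimes>\<^bsub>R\<^esub> z)
        \<oplus>\<^bsub>R\<^esub> y \<otimes>\<^bsub>R\<^esub> bv_op R (x \<otimes>\<^bsub>R\<^esub> z)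
        \<oplus>\<^bsub>R\<^esub> bv_op R x \<otimes>\<^bsub>R\<^esub> y \<otimes>\<^bsub>R\<^esub> z \<oplus>\<^bsub>R\<^esub> x \<otimes>\<^bsub>R\<^esub> bv_op R y \<otimes>\<^bsub>R\<^esub> z
        \<oplus>\<^bsub>R\<^esub> x \<otimes>\<^bsub>R\<^esub> y \<otimes>\<^bsub>R\<^esub> bv_op R z" if xyz: "x \<in> carrier R" "y \<in> carrier R" "z \<in> carrier R" for x y z
    proof -
      obtain a b c where abc: "a \<in> carrier S" "b \<in> carrier S" "c \<in> carrier S" "x = h a" "y = h b" "z = h c"
        using xyz unfolding carrier by blast
      have "bv_op S (a \<otimes>\<^bsub>S\<^esub> b \<otimes>\<^bsub>S\<^esub> c) =
        bv_op S (a \<otimes>\<^bsub>S\<^esub> b) \<otimes>\<^bsub>S\<^esub> c \<oplus>\<^bsub>S\<^esub> a \<otimes>\<^bsub>S\<^esub> bv_op S (b \<otimes>\<^bsub>S\<^esub> c)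
        \<oplus>\<^bsub>S\<^esub> b \<otimes>\<^bsub>S\<^esub> bv_op S (a \<otimes>\<^bsub>S\<^esub> c)
        \<oplus>\<^bsub>S\<^esub> bv_op S a \<otimes>\<^bsub>S\<^esub> b \<otimes>\<^bsub>S\<^esub> c \<oplus>\<^bsub>S\<^esub> a \<otimes>\<^bsub>S\<^esub> bv_op S b \<otimes>\<^bsub>S\<^esub> c
        \<oplus>\<^bsub>S\<^esub> a \<otimes>\<^bsub>S\<^esub> b \<otimes>\<^bsub>S\<^esub> bv_op S c" (is "_ = ?r")
        using S abc unfolding bv_algebra_def by blast
      then have "h (bv_op S (a \<otimes>\<^bsub>S\<^esub> b \<otimes>\<^bsub>S\<^esub> c)) = h ?r"
        by simp
      then show ?thesis
        using abc by (simp add: add mult op_closed flip: op)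
    qed
  qed
qed

text \<open>The map with an explicit formula starts at the string topology algebra, opposite to the
  direction claimed.\<close>

lemma bv_isomorphic_sym:
  assumes "ring S" "h \<in> ring_iso S R"
    and part: "\<And>k. bv_part S k \<subseteq> carrier S" "\<And>k. h ` bv_part S k = bv_part R k"
    and op: "\<And>x. x \<in> carrier S \<Longrightarrow> bv_op S x \<in> carrier S \<and> bv_op R (h x) = h (bv_op S x)"
  shows "bv_isomorphic R S"
proof -
  let ?g = "inv_into (carrier S) h"
  have bij: "bij_betw h (carrier S) (carrier R)"
    using assms(2) by (rule ring_iso_memE(5))
  then have inj: "inj_on h (carrier S)" and surj: "carrier R = h ` carrier S"
    by (simp_all add: bij_betw_def)
  have "?g \<in> ring_iso R S"
    by (rule ring_iso_set_sym[OF assms(1,2)])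
  moreover have "?g ` bv_part R k = bv_part S k" for k
    unfolding part(2)[symmetric] by (rule inv_into_image_cancel[OF inj part(1)])
  moreover have "?g (bv_op R x) = bv_op S (?g x)" if x: "x \<in> carrier R" for x
  proof -
    obtain a where "x = h a" "a \<in> carrier S"
      using x surj by blast
    then have "?g (bv_op R x) = bv_op S a" "?g x = a"
      using op[of a] inv_into_f_f[OF inj] by simp_all
    then show ?thesis
      by simp
  qed
  ultimately show ?thesis
    unfolding bv_isomorphic_def by blast
qed

section \<open>The string topology BV algebra\<close>

lemma string_bv_simps [simp]:
  "carrier string_bv = UNIV" "monoid.mult string_bv = bilin st_mul" "one string_bv = bas (Alpha 0)"
  "zero string_bv = 0" "add string_bv = (+)" "bv_part string_bv = basis_part st_deg"
  "bv_op string_bv = lin st_delta"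
  by (simp_all add: string_bv_def)

lemma st_mul_assoc: "bilin st_mul (bilin st_mul x y) z = bilin st_mul x (bilin st_mul y z)"
proof (rule triadditive_eqI[of "\<lambda>x y z. bilin st_mul (bilin st_mul x y) z"
      "\<lambda>x y z. bilin st_mul x (bilin st_mul y z)"])
  show "bilin st_mul (bilin st_mul (bas a) (bas b)) (bas c) =
      bilin st_mul (bas a) (bilin st_mul (bas b) (bas c))" for a b c
    by (cases a; cases b; cases c) (simp_all add: add.assoc)
qed (simp_all add: additive_def)

lemma st_mul_commute: "bilin st_mul x y = bilin st_mul y x"
proof (rule biadditive_eqI[of "bilin st_mul" "\<lambda>x y. bilin st_mul y x"])
  show "bilin st_mul (bas a) (bas b) = bilin st_mul (bas b) (bas a)" for a b
    by (cases a; cases b) (simp_all add: add.commute)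
qed (simp_all add: additive_def)

lemma st_mul_one: "bilin st_mul (bas (Alpha 0)) x = x"
proof (rule additive_eqI[of "bilin st_mul (bas (Alpha 0))" "\<lambda>x. x"])
  show "bilin st_mul (bas (Alpha 0)) (bas a) = bas a" for a
    by (cases a) simp_all
qed (simp_all add: additive_def)

lemma abelian_group_string_bv: "abelian_group string_bv"
  by (rule abelian_groupI) (auto simp: add.assoc add.commute intro: exI[of _ "- x" for x] add_self)

lemma cring_string_bv: "cring string_bv"
proof (rule cringI[OF abelian_group_string_bv])
  show "Group.comm_monoid string_bv"
  proof (rule comm_monoidI)
    show "x \<otimes>\<^bsub>string_bv\<^esub> y = y \<otimes>\<^bsub>string_bv\<^esub> x" for x y
      by (simp only: string_bv_simps) (rule st_mul_commute)
  qed (simp_all add: st_mul_assoc st_mul_one)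
qed simp_all

lemma finsum_string_bv: "finite A \<Longrightarrow> finsum string_bv f A = sum f A"
proof (induction A rule: finite_induct)
  case (insert a A)
  interpret cring string_bv by (rule cring_string_bv)
  show ?case
    using insert by (simp add: finsum_insert)
next
  case empty
  interpret cring string_bv by (rule cring_string_bv)
  show ?case by simp
qed

lemma sc_idem [simp]: "sc x (sc x m) = sc x m"
  by (cases x) simp_all

lemma single_of_nat_eq: "Poly_Mapping.single b (of_nat k) = sc (of_nat k) (bas b)"
  by (cases "of_nat k :: bit") simp_all

text \<open>\<open>st_delta (Beta n)\<close> without its coefficient \<open>n\<close>:
  multiplication by \<open>Alpha a\<close> shifts the index of this vector but leaves the
  coefficient alone.\<close>

definition st_gamma :: "nat \<Rightarrow> st_gen \<Rightarrow>\<^sub>0 bit" where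
  "st_gamma n = bas (Alpha (n - 1)) + bas (Beta (n + 1))"

lemma st_delta_Beta: "st_delta (Beta k) = sc (of_nat k) (st_gamma k)"
  by (simp add: single_of_nat_eq sc_add_right st_gamma_def)

text \<open>The truncated subtraction in \<open>st_gamma 0\<close> is masked by the coefficient \<open>k\<close>.\<close>

lemma st_mul_gamma:
  "bilin st_mul (bas (Alpha a)) (sc (of_nat k) (st_gamma (b + k))) = sc (of_nat k) (st_gamma (a + (b + k)))"
  "bilin st_mul (bas (Beta a)) (sc (of_nat k) (st_gamma (b + k))) = sc (of_nat k) (bas (Beta (a + (b + k) - 1)))"
  "bilin st_mul (bas (Alpha a)) (sc (of_nat k) (bas (Beta (b + k - 1)))) =
     sc (of_nat k) (bas (Beta (a + (b + k) - 1)))"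
  "bilin st_mul (bas (Beta a)) (sc (of_nat k) (bas (Beta (b + k - 1)))) = 0"
  by (cases k; simp add: additive_sc[OF additive_bilin(1)] st_gamma_def)+

lemma st_mul_delta_Beta:
  "bilin st_mul (bas (Alpha a)) (st_delta (Beta k)) = sc (of_nat k) (st_gamma (a + k))"
  "bilin st_mul (bas (Beta a)) (st_delta (Beta k)) = sc (of_nat k) (bas (Beta (a + k - 1)))"
  using st_mul_gamma(1,2)[of a k 0] by (simp_all add: st_delta_Beta del: st_delta.simps)

text \<open>All non-zero terms are multiples of one vector, so only coefficients matter.
  \<open>Alpha a\<close>, \<open>Alpha b\<close>, \<open>Beta k\<close> give
  \<open>a + b + k = (b + k) + (a + k) + k\<close>, and \<open>Alpha a\<close>,
  \<open>Beta k\<close>, \<open>Beta l\<close> give \<open>0 = (a + k) + (a + l) + k + l\<close>,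
  both modulo 2.\<close>

lemma st_seven_term:
  fixes a b c
  defines "m \<equiv> bilin st_mul" and "d \<equiv> lin st_delta" and "x \<equiv> bas a" and "y \<equiv> bas b" and "z \<equiv> bas c"
  shows "d (m (m x y) z) = m (d (m x y)) z + m x (d (m y z)) + m y (d (m x z)) +
    m (m (d x) y) z + m (m x (d y)) z + m (m x y) (d z)"
proof -
  \<comment> \<open>Values of the operator are moved to the right factor, where the rules
    \<open>st_mul_delta_Beta\<close> and \<open>st_mul_gamma\<close> expect them.\<close>
  have "d (m (m x y) z) = m z (d (m x y)) + m x (d (m y z)) + m y (d (m x z)) +
      m z (m y (d x)) + m z (m x (d y)) + m (m x y) (d z)"
    unfolding assms
    \<comment> \<open>\<open>of_nat (a + k)\<close> must stay whole while coefficient and index are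
      matched; the second pass splits it and cancels.\<close>
    by (cases a; cases b; cases c;
        simp add: st_mul_delta_Beta st_mul_gamma[unfolded One_nat_def]
          del: st_delta.simps(2) of_nat_add;
        simp add: st_delta_Beta sc_add_left add_ac del: st_delta.simps(2))
  then show ?thesis
    by (simp add: m_def st_mul_commute[of _ z] st_mul_commute[of "d x"])
qed

lemma bv_algebra_string_bv: "bv_algebra string_bv"
proof -
  interpret cring string_bv by (rule cring_string_bv)
  show ?thesis
    unfolding bv_algebra_def
  proof (intro conjI allI ballI)
    show "cring string_bv" by (rule cring_string_bv)
    show "x \<oplus>\<^bsub>string_bv\<^esub> x = \<zero>\<^bsub>string_bv\<^esub>" for x
      by simp
    show "subgroup (bv_part string_bv k) (add_monoid string_bv)" for k
    proof -
      have "inv\<^bsub>add_monoid string_bv\<^esub> x = x" for x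
        by (rule group.inv_equality[OF a_group]) simp_all
      then show ?thesis
        by unfold_locales (simp_all add: basis_part_add)
    qed
    show "\<exists>!c. (\<forall>k. c k \<in> bv_part string_bv k) \<and> finite {k. c k \<noteq> \<zero>\<^bsub>string_bv\<^esub>} \<and>
        x = (\<Oplus>\<^bsub>string_bv\<^esub>k\<in>{k. c k \<noteq> \<zero>\<^bsub>string_bv\<^esub>}. c k)" for x
    proof (rule ex1I[of _ "\<lambda>k. homog_comp st_deg k x"])
      show "(\<forall>k. homog_comp st_deg k x \<in> bv_part string_bv k) \<and>
          finite {k. homog_comp st_deg k x \<noteq> \<zero>\<^bsub>string_bv\<^esub>} \<and>
          x = (\<Oplus>\<^bsub>string_bv\<^esub>k\<in>{k. homog_comp st_deg k x \<noteq> \<zero>\<^bsub>string_bv\<^esub>}. homog_comp st_deg k x)"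
        by (simp add: finsum_string_bv homog_comp_finite sum_homog_comp)
    next
      fix c assume "(\<forall>k. c k \<in> bv_part string_bv k) \<and> finite {k. c k \<noteq> \<zero>\<^bsub>string_bv\<^esub>} \<and>
          x = (\<Oplus>\<^bsub>string_bv\<^esub>k\<in>{k. c k \<noteq> \<zero>\<^bsub>string_bv\<^esub>}. c k)"
      then show "c = (\<lambda>k. homog_comp st_deg k x)"
        by (intro homog_comp_unique) (auto simp: finsum_string_bv)
    qed
    show "\<one>\<^bsub>string_bv\<^esub> \<in> bv_part string_bv 0"
      by simp
    show "x \<otimes>\<^bsub>string_bv\<^esub> y \<in> bv_part string_bv (i + j)"
      if "x \<in> bv_part string_bv i" "y \<in> bv_part string_bv j" for i j x y
    proof -
      have "st_mul a b \<in> basis_part st_deg (st_deg a + st_deg b)" for a b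
        by (cases a; cases b) simp_all
      then show ?thesis
        using that by (auto intro!: bilin_in_basis_part)
    qed
    show "bv_op string_bv \<in> hom (add_monoid string_bv) (add_monoid string_bv)"
      by (simp add: hom_def)
    show "bv_op string_bv ` bv_part string_bv k \<subseteq> bv_part string_bv (k + 1)" for k
    proof -
      have "st_delta a \<in> basis_part st_deg (st_deg a + 1)" for a
      proof (cases a)
        case (Beta n)
        then show ?thesis
          unfolding Beta st_delta_Beta sc_def st_gamma_def by (cases n) (auto intro!: basis_part_add)
      qed simp
      then show ?thesis
        by (auto intro!: lin_in_basis_part)
    qed
    show "bv_op string_bv (bv_op string_bv x) = \<zero>\<^bsub>string_bv\<^esub>" for x
    proof -
      \<comment> \<open>The coefficients multiply to \<open>k (k + 1)\<close>, which is
        even.\<close>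
      have "lin st_delta (st_delta a) = 0" for a
        by (cases a) (simp_all add: st_delta_Beta st_gamma_def additive_sc[OF additive_lin] sc_add_right sc_add_left del: st_delta.simps(2))
      then show ?thesis
        by (simp add: lin_lin)
    qed
    show "bv_op string_bv (x \<otimes>\<^bsub>string_bv\<^esub> y \<otimes>\<^bsub>string_bv\<^esub> z) =
        bv_op string_bv (x \<otimes>\<^bsub>string_bv\<^esub> y) \<otimes>\<^bsub>string_bv\<^esub> z
        \<oplus>\<^bsub>string_bv\<^esub> x \<otimes>\<^bsub>string_bv\<^esub> bv_op string_bv (y \<otimes>\<^bsub>string_bv\<^esub> z)
        \<oplus>\<^bsub>string_bv\<^esub> y \<otimes>\<^bsub>string_bv\<^esub> bv_op string_bv (x \<otimes>\<^bsub>string_bv\<^esub> z)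
        \<oplus>\<^bsub>string_bv\<^esub> bv_op string_bv x \<otimes>\<^bsub>string_bv\<^esub> y \<otimes>\<^bsub>string_bv\<^esub> z
        \<oplus>\<^bsub>string_bv\<^esub> x \<otimes>\<^bsub>string_bv\<^esub> bv_op string_bv y \<otimes>\<^bsub>string_bv\<^esub> z
        \<oplus>\<^bsub>string_bv\<^esub> x \<otimes>\<^bsub>string_bv\<^esub> y \<otimes>\<^bsub>string_bv\<^esub> bv_op string_bv z" for x y z
    proof -
      let ?m = "bilin st_mul" and ?d = "lin st_delta"
      let ?r = "\<lambda>x y z. ?m (?d (?m x y)) z + ?m x (?d (?m y z)) + ?m y (?d (?m x z)) +
        ?m (?m (?d x) y) z + ?m (?m x (?d y)) z + ?m (?m x y) (?d z)"
      have "?d (?m (?m (bas a) (bas b)) (bas c)) = ?r (bas a) (bas b) (bas c)" for a b c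
        by (rule st_seven_term)
      then show ?thesis
        using triadditive_eqI[of "\<lambda>x y z. ?d (?m (?m x y) z)" ?r x y z]
        by (simp add: additive_def add_ac)
    qed
  qed
qed

section \<open>The BV algebra of the sphere\<close>

abbreviation self_coch :: "(st_gen \<Rightarrow>\<^sub>0 bit) \<Rightarrow> (sph \<Rightarrow>\<^sub>0 bit) list \<Rightarrow> (sph \<Rightarrow>\<^sub>0 bit)" where
  "self_coch \<equiv> coch (bas Cls_e) (bas Cls_s)"

text \<open>\<open>F_{0,0}\<close> sends \<open>e\<close> to \<open>s_coeff\<close> and
  \<open>s\<close> to \<open>e_coeff\<close>; with the dual basis in this order it is the identity
  on coordinates.\<close>

abbreviation dual_coch :: "(st_gen \<Rightarrow>\<^sub>0 bit) \<Rightarrow> (sph \<Rightarrow>\<^sub>0 bit) list \<Rightarrow> (sph \<Rightarrow>\<^sub>0 bit) \<Rightarrow> bit" where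
  "dual_coch \<equiv> coch s_coeff e_coeff"

lemma basis_part_sph:
  "basis_part sph_deg k =
    {sc x (bas Cls_e) + sc y (bas Cls_s) | x y. (x = 1 \<longrightarrow> k = 0) \<and> (y = 1 \<longrightarrow> k = - 2)}"
proof (intro equalityI subsetI)
  fix a assume "a \<in> basis_part sph_deg k"
  then have "(e_coeff a = 1 \<longrightarrow> k = 0) \<and> (s_coeff a = 1 \<longrightarrow> k = - 2)"
    by (auto simp: basis_part_iff)
  then show "a \<in> {sc x (bas Cls_e) + sc y (bas Cls_s) | x y. (x = 1 \<longrightarrow> k = 0) \<and> (y = 1 \<longrightarrow> k = - 2)}"
    using sph_decomp[of a] by blast
next
  fix a assume "a \<in> {sc x (bas Cls_e) + sc y (bas Cls_s) | x y. (x = 1 \<longrightarrow> k = 0) \<and> (y = 1 \<longrightarrow> k = - 2)}"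
  then show "a \<in> basis_part sph_deg k"
    by (auto simp: sc_def intro!: basis_part_add)
qed

section \<open>The two coefficient bimodules as instances of the common shape\<close>

lemma self_bimod_simps [simp]:
  "part (self_bimod A) = part A" "diff (self_bimod A) = diff A"
  "lact (self_bimod A) = mul A" "ract (self_bimod A) = mul A"
  by (simp_all add: self_bimod_def)

lemma dual_bimod_simps [simp]:
  "diff (dual_bimod A) n m = n (diff A m)"
  "lact (dual_bimod A) a n m = n (mul A m a)" "ract (dual_bimod A) n a m = n (mul A a m)"
  by (simp_all add: dual_bimod_def)

lemma bilin_sph_mul_decomp:
  "bilin sph_mul a b = sc (e_coeff a) b + sc (s_coeff a) (bilin sph_mul (bas Cls_s) b)"
  "bilin sph_mul b a = sc (e_coeff a) b + sc (s_coeff a) (bilin sph_mul (bas Cls_s) b)"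
proof -
  show "bilin sph_mul a b = sc (e_coeff a) b + sc (s_coeff a) (bilin sph_mul (bas Cls_s) b)"
    by (rule poly_mapping_eqI, case_tac k) (simp_all add: lookup_add lookup_sc lookup_single)
  show "bilin sph_mul b a = sc (e_coeff a) b + sc (s_coeff a) (bilin sph_mul (bas Cls_s) b)"
    by (rule poly_mapping_eqI, case_tac k) (simp_all add: lookup_add lookup_sc lookup_single algebra_simps)
qed

interpretation self: sph_bimod "self_bimod sphB" "bas Cls_e" "bas Cls_s" 0 "- 2" "bilin sph_mul (bas Cls_s)"
proof
  show "x = 0 \<and> y = 0" if "sc x (bas Cls_e) + sc y (bas Cls_s) = 0" for x y
    using arg_cong[OF that, of e_coeff] arg_cong[OF that, of s_coeff]
    by (simp add: lookup_add lookup_sc lookup_single)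
  let ?w = "\<lambda>x y. sc x (bas Cls_e) + sc y (bas Cls_s)"
  show "lact (self_bimod sphB) a (?w x y) =
      sc (e_coeff a) (?w x y) + sc (s_coeff a) (bilin sph_mul (bas Cls_s) (?w x y))" for a x y
    unfolding self_bimod_simps sphB_simps by (rule bilin_sph_mul_decomp(1))
  show "ract (self_bimod sphB) (?w x y) a =
      sc (e_coeff a) (?w x y) + sc (s_coeff a) (bilin sph_mul (bas Cls_s) (?w x y))" for a x y
    unfolding self_bimod_simps sphB_simps by (rule bilin_sph_mul_decomp(2))
qed (simp_all add: basis_part_sph)

text \<open>\<open>s_coeff\<close> sits in dual degree 2 because \<open>s\<close> has degree -2;
  thus the inner product raises degrees by 2.\<close>

interpretation dual: sph_bimod "dual_bimod sphB" s_coeff e_coeff 2 0 "\<lambda>n m. n (bilin sph_mul (bas Cls_s) m)"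
proof
  let ?w = "\<lambda>x y. sc x s_coeff + sc y e_coeff :: (sph \<Rightarrow>\<^sub>0 bit) \<Rightarrow> bit"
  have add: "additive (?w x y)" for x y
    by (simp add: additive_def sc_apply lookup_add algebra_simps)
  show "part (dual_bimod sphB) k = {?w x y | x y. (x = 1 \<longrightarrow> k = 2) \<and> (y = 1 \<longrightarrow> k = 0)}" for k
  proof (intro equalityI subsetI)
    fix n assume "n \<in> part (dual_bimod sphB) k"
    then have n: "additive n" "\<And>i m. i \<noteq> - k \<Longrightarrow> m \<in> basis_part sph_deg i \<Longrightarrow> n m = 0"
      by (auto simp: dual_bimod_def)
    have "n a = ?w (n (bas Cls_s)) (n (bas Cls_e)) a" for a
      using additive_eq_lin[OF n(1), of a] by (simp add: lin_sph sc_apply mult.commute add.commute)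
    moreover have "n (bas Cls_s) = 1 \<longrightarrow> k = 2"
      using n(2)[of "- 2" "bas Cls_s"] by (cases "k = 2") auto
    moreover have "n (bas Cls_e) = 1 \<longrightarrow> k = 0"
      using n(2)[of 0 "bas Cls_e"] by (cases "k = 0") auto
    ultimately show "n \<in> {?w x y | x y. (x = 1 \<longrightarrow> k = 2) \<and> (y = 1 \<longrightarrow> k = 0)}"
      by blast
  next
    fix n assume "n \<in> {?w x y | x y. (x = 1 \<longrightarrow> k = 2) \<and> (y = 1 \<longrightarrow> k = 0)}"
    then obtain x y where n: "n = ?w x y" "x = 1 \<longrightarrow> k = 2" "y = 1 \<longrightarrow> k = 0"
      by blast
    have "?w x y m = 0" if "i \<noteq> - k" "m \<in> basis_part sph_deg i" for i m
    proof -
      have "s_coeff m = 1 \<longrightarrow> i = - 2" "e_coeff m = 1 \<longrightarrow> i = 0"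
        using that(2) by (auto simp: basis_part_iff)
      then have "x * s_coeff m = 0" "y * e_coeff m = 0"
        using n(2,3) that(1) by (cases x; cases y; cases "s_coeff m"; cases "e_coeff m"; auto)+
      then show ?thesis by (auto simp: sc_apply)
    qed
    then show "n \<in> part (dual_bimod sphB) k"
      using add n(1) by (auto simp: dual_bimod_def)
  qed
  show "x = 0 \<and> y = 0" if "?w x y = 0" for x y
    using fun_cong[OF that, of "bas Cls_s"] fun_cong[OF that, of "bas Cls_e"]
    by (simp add: sc_apply lookup_single)
  show "diff (dual_bimod sphB) (?w x y) = 0" for x y
    by (rule ext) (simp add: sc_apply)
  show "lact (dual_bimod sphB) a (?w x y) =
      sc (e_coeff a) (?w x y) + sc (s_coeff a) (\<lambda>m. ?w x y (bilin sph_mul (bas Cls_s) m))" for a x y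
    by (rule ext) (simp only: dual_bimod_simps sphB_simps bilin_sph_mul_decomp(2)[of _ a],
        simp add: sc_apply lookup_add lookup_sc algebra_simps)
  show "ract (dual_bimod sphB) (?w x y) a =
      sc (e_coeff a) (?w x y) + sc (s_coeff a) (\<lambda>m. ?w x y (bilin sph_mul (bas Cls_s) m))" for a x y
    by (rule ext) (simp only: dual_bimod_simps sphB_simps bilin_sph_mul_decomp(1)[of a],
        simp add: sc_apply lookup_add lookup_sc algebra_simps)
qed (simp add: fun_eq_iff)

lemma self_dg: "self.dg = st_deg"
proof
  show "self.dg g = st_deg g" for g by (cases g) simp_all
qed

text \<open>The matrix of the inner product. \<open>Beta (k + 2)\<close> comes from
  \<open>F_{2,0}\<close>: a cochain with value \<open>e\<close> on \<open>k\<close> inputs gains two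
  inputs \<open>s\<close> in front and the value \<open>e_coeff\<close>.\<close>

definition hip_coord :: "st_gen \<Rightarrow> st_gen \<Rightarrow>\<^sub>0 bit" where
  "hip_coord g = (case g of Alpha k \<Rightarrow> bas (Alpha k) + bas (Beta (k + 2)) | Beta k \<Rightarrow> bas (Beta k))"

text \<open>All \<open>k\<close> rotations of \<open>(s, ..., s)\<close> give the same value, whence
  the factor \<open>k\<close>. One input becomes the argument of the functional, so
  \<open>e_coeff\<close> on \<open>k\<close> inputs turns into \<open>s_coeff\<close> on
  \<open>k - 1\<close>; \<open>s_coeff\<close> itself vanishes at the unit.\<close>

definition connes_coord :: "st_gen \<Rightarrow> st_gen \<Rightarrow>\<^sub>0 bit" where
  "connes_coord g = (case g of Alpha k \<Rightarrow> 0 | Beta k \<Rightarrow> sc (of_nat k) (bas (Alpha (k - 1))))"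

lemma sphF_Nil:
  "sphF as m [] n = of_bool (as = []) * s_coeff (bilin sph_mul m n) +
     of_bool (length as = 2) * s_prod as * e_coeff (bilin sph_mul m n)"
proof -
  have "mext (coeff (1 :: sph ncseries)) as = of_bool (as = [])"
    by (cases as) simp_all
  moreover have "mext (coeff (letter Cls_s * letter Cls_s)) as = of_bool (length as = 2) * s_prod as"
    by (cases as; cases "tl as"; cases "tl (tl as)") (auto simp: coeff_letter_letter lin_sph)
  ultimately show ?thesis
    unfolding sphF_eq cochain_hip_def lin_sph sph_series_def
    by (simp add: mult_ac add_ac del: lookup_sph_mul)
qed

lemma sphF_Cons: "sphF as m (b # bs) n = 0"
  by (simp add: sphF_eq cochain_hip_def)

lemma sphF_nonempty: "bs \<noteq> [] \<Longrightarrow> sphF as m bs n = 0"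
  by (cases bs) (simp_all add: sphF_Cons)

text \<open>\<open>sphF\<close> takes no right inputs and either 0 or 2 left inputs, so only
  \<open>q = 0\<close> with \<open>p = 0\<close> or \<open>p = 2\<close> survives.\<close>

lemma hip_map_sphF:
  "hip_map sphF \<phi> as n = s_coeff (bilin sph_mul (\<phi> as) n) +
     of_bool (length as \<ge> 2) * s_prod (take 2 as) * e_coeff (bilin sph_mul (\<phi> (drop 2 as)) n)"
proof -
  have "hip_map sphF \<phi> as n = (\<Sum>p\<le>length as. sphF (take p as) (\<phi> (drop p as)) [] n)"
    unfolding hip_map_def sum_fun_apply
  proof (rule sum.cong[OF refl])
    fix p assume p: "p \<in> {..length as}"
    have "(\<Sum>q\<le>N. sphF (take p as) (\<phi> (take (length as - p - q) (drop p as))) (drop (length as - q) as) n) =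
        sphF (take p as) (\<phi> (drop p as)) [] n" if "N \<le> length as" for N
    proof -
      have "sphF (take p as) (\<phi> (take (length as - p - Suc q) (drop p as))) (drop (length as - Suc q) as) n = 0"
        if "q < N" for q
        using that \<open>N \<le> length as\<close> by (intro sphF_nonempty) simp
      then show ?thesis
        by (simp add: sum.atMost_shift)
    qed
    from this[of "length as - p"] show "(\<Sum>q\<le>length as - p. sphF (take p as)
        (\<phi> (take (length as - p - q) (drop p as))) (drop (length as - q) as) n) =
        sphF (take p as) (\<phi> (drop p as)) [] n" by simp
  qed
  also have "\<dots> = (\<Sum>p\<le>length as.
      (if p = 0 then s_coeff (bilin sph_mul (\<phi> as) n) else 0) +
      (if p = 2 then s_prod (take 2 as) * e_coeff (bilin sph_mul (\<phi> (drop 2 as)) n) else 0))"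
    by (intro sum.cong) (auto simp: sphF_Nil simp del: lookup_sph_mul)
  finally show ?thesis
    by (simp add: sum.distrib del: lookup_sph_mul)
qed

lemma additive_hip_map_coch: "additive (\<lambda>x. hip_map sphF (self_coch x))"
  by (simp add: additive_def fun_eq_iff hip_map_sphF coch_add lookup_add algebra_simps)

lemma hip_map_coch: "hip_map sphF (self_coch x) = dual_coch (lin hip_coord x)"
proof (rule additive_eqI[OF additive_hip_map_coch])
  show "additive (\<lambda>x. dual_coch (lin hip_coord x))"
    by (simp add: additive_def coch_add)
  fix g
  show "hip_map sphF (self_coch (bas g)) = dual_coch (lin hip_coord (bas g))"
  proof (intro ext)
    fix as n
    show "hip_map sphF (self_coch (bas g)) as n = dual_coch (lin hip_coord (bas g)) as n"
    proof (cases "length as \<ge> 2")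
      case True
      then obtain a b cs where "as = a # b # cs"
        by (cases as; cases "tl as") auto
      then show ?thesis
        by (cases g) (auto simp: hip_map_sphF hip_coord_def coch_add coch_bas sc_apply lookup_sc lookup_single numeral_2_eq_2)
    next
      case False
      then show ?thesis
        by (cases g) (auto simp: hip_map_sphF hip_coord_def coch_add coch_bas sc_apply lookup_sc lookup_single)
    qed
  qed
qed

lemma Connes_coch: "Connes sphB (dual_coch x) = dual_coch (lin connes_coord x)"
proof (rule additive_eqI[of "\<lambda>x. Connes sphB (dual_coch x)" "\<lambda>x. dual_coch (lin connes_coord x)"])
  show "additive (\<lambda>x. Connes sphB (dual_coch x))"
    by (simp add: additive_def fun_eq_iff Connes_def coch_add sum.distrib)
  show "additive (\<lambda>x. dual_coch (lin connes_coord x))"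
    by (simp add: additive_def coch_add)
  fix g
  show "Connes sphB (dual_coch (bas g)) = dual_coch (lin connes_coord (bas g))"
  proof (intro ext)
    fix as a
    show "Connes sphB (dual_coch (bas g)) as a = dual_coch (lin connes_coord (bas g)) as a"
      \<comment> \<open>Index 0 is split off: the rotated list is never empty, so arity 0 is not
        read, in accordance with the coefficient \<open>of_nat 0\<close>.\<close>
      by (cases g; cases "st_index g") (auto simp: Connes_def connes_coord_def coch_bas sc_apply lookup_single
          additive_sc[OF additive_coch] simp del: sum.lessThan_Suc)
  qed
qed

text \<open>Only the cut after \<open>st_index g\<close> entries contributes, and the values
  \<open>e\<close>, \<open>s\<close> multiply like \<open>Alpha\<close>,
  \<open>Beta\<close>.\<close>

lemma cup_coch: "cup sphB (self_coch x) (self_coch y) = self_coch (bilin st_mul x y)"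
proof (rule biadditive_eqI[of "\<lambda>x y. cup sphB (self_coch x) (self_coch y)" "\<lambda>x y. self_coch (bilin st_mul x y)"])
  fix g h
  show "cup sphB (self_coch (bas g)) (self_coch (bas h)) = self_coch (bilin st_mul (bas g) (bas h))"
  proof
    fix as
    let ?v = "st_val (bas Cls_e) (bas Cls_s)"
    have "cup sphB (self_coch (bas g)) (self_coch (bas h)) as =
        (\<Sum>r\<le>length as. if r = st_index g then
          (if length as = st_index g + st_index h then sc (s_prod as) (bilin sph_mul (?v g) (?v h)) else 0) else 0)"
      unfolding cup_def
    proof (intro sum.cong refl)
      fix r assume r: "r \<in> {..length as}"
      have "s_prod (take r as) * s_prod (drop r as) = s_prod as"
        by (metis append_take_drop_id s_prod_simps(3))
      then show "mul sphB (self_coch (bas g) (take r as)) (self_coch (bas h) (drop r as)) =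
          (if r = st_index g then
            (if length as = st_index g + st_index h then sc (s_prod as) (bilin sph_mul (?v g) (?v h)) else 0) else 0)"
        using r by (auto simp: coch_bas additive_sc[OF additive_bilin(1)] additive_sc[OF additive_bilin(2)]
            mult.commute simp flip: sc_mult)
    qed
    then show "cup sphB (self_coch (bas g)) (self_coch (bas h)) as = self_coch (bilin st_mul (bas g) (bas h)) as"
      by (cases g; cases h) (auto simp: coch_bas)
  qed
qed (simp_all add: additive_def fun_eq_iff cup_def coch_add sum.distrib)

lemma cup_unit_coch: "cup_unit sphB = self_coch (bas (Alpha 0))"
  by (auto simp: fun_eq_iff cup_unit_def coch_bas)

text \<open>\<open>Beta (k + 2)\<close> is added twice and cancels. This makes the inverse of the
  inner product on cohomology explicit.\<close>

lemma hip_coord_invol: "lin hip_coord (lin hip_coord x) = x"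
proof -
  have "lin hip_coord (hip_coord g) = bas g" for g
    by (cases g) (simp_all add: hip_coord_def)
  then show ?thesis by (simp add: lin_lin)
qed

section \<open>The induced isomorphism of cohomologies\<close>

lemma cochain_map_sphF:
  "cochain_map (CH sphB (self_bimod sphB)) (CH sphB (dual_bimod sphB)) (hip_map sphF)"
proof -
  have "hip_map sphF (0 :: (sph \<Rightarrow>\<^sub>0 bit) list \<Rightarrow> (sph \<Rightarrow>\<^sub>0 bit)) = 0"
    using hip_map_coch[of 0] by simp
  moreover have "hip_map sphF (self_coch x + self_coch y) = hip_map sphF (self_coch x) + hip_map sphF (self_coch y)" for x y
    using additive_add[OF additive_hip_map_coch, of x y] by (simp add: coch_add)
  ultimately show ?thesis
    unfolding cochain_map_def self.total_space_CH dual.total_space_CH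
    by (auto simp: hip_map_coch self.diff_coch dual.diff_coch)
qed

lemma HH_hip_map_coch: "HH_hip_map sphB sphF {self_coch x} = {dual_coch (lin hip_coord x)}"
  by (simp add: HH_hip_map_def induced_def dual.coh_class_CH hip_map_coch)

lemma HH_Connes_coch: "HH_Connes sphB {dual_coch x} = {dual_coch (lin connes_coord x)}"
  by (simp add: HH_Connes_def induced_def dual.coh_class_CH Connes_coch)

lemma class_add_singleton: "class_add {a} {b} = {a + b}"
  by (simp add: class_add_def)

lemma HH_hip_map_iso: "HH_hip_map sphB sphF \<in> iso (HH_self sphB) (HH_dual sphB)"
proof (rule isoI)
  show "HH_hip_map sphB sphF \<in> hom (HH_self sphB) (HH_dual sphB)"
  proof (rule homI)
    fix a assume "a \<in> carrier (HH_self sphB)"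
    then show "HH_hip_map sphB sphF a \<in> carrier (HH_dual sphB)"
      by (auto simp: self.carrier_cohomology dual.carrier_cohomology HH_hip_map_coch)
  next
    fix a b assume "a \<in> carrier (HH_self sphB)" "b \<in> carrier (HH_self sphB)"
    then obtain x y where "a = {self_coch x}" "b = {self_coch y}"
      by (auto simp: self.carrier_cohomology)
    moreover from this have "a \<otimes>\<^bsub>HH_self sphB\<^esub> b = {self_coch (x + y)}"
      by (simp add: cohomology_def class_add_singleton coch_add)
    ultimately show "HH_hip_map sphB sphF (a \<otimes>\<^bsub>HH_self sphB\<^esub> b) =
        HH_hip_map sphB sphF a \<otimes>\<^bsub>HH_dual sphB\<^esub> HH_hip_map sphB sphF b"
      by (simp add: HH_hip_map_coch) (simp add: cohomology_def class_add_singleton coch_add)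
  qed
  show "bij_betw (HH_hip_map sphB sphF) (carrier (HH_self sphB)) (carrier (HH_dual sphB))"
    unfolding bij_betw_def
  proof
    show "inj_on (HH_hip_map sphB sphF) (carrier (HH_self sphB))"
    proof (rule inj_onI)
      fix a b assume "a \<in> carrier (HH_self sphB)" "b \<in> carrier (HH_self sphB)"
      then obtain x y where ab: "a = {self_coch x}" "b = {self_coch y}"
        by (auto simp: self.carrier_cohomology)
      assume "HH_hip_map sphB sphF a = HH_hip_map sphB sphF b"
      then have "lin hip_coord x = lin hip_coord y"
        using inj_eq[OF dual.inj_coch] by (simp add: ab HH_hip_map_coch)
      then have "x = y"
        by (metis hip_coord_invol)
      then show "a = b" by (simp add: ab)
    qed
    have "{dual_coch y} \<in> HH_hip_map sphB sphF ` carrier (HH_self sphB)" for y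
      using imageI[of "{self_coch (lin hip_coord y)}" "carrier (HH_self sphB)" "HH_hip_map sphB sphF"]
      by (simp add: HH_hip_map_coch hip_coord_invol self.carrier_cohomology)
    then show "HH_hip_map sphB sphF ` carrier (HH_self sphB) = carrier (HH_dual sphB)"
      by (auto simp: self.carrier_cohomology dual.carrier_cohomology HH_hip_map_coch)
  qed
qed

text \<open>The evident bases do not match: \<open>\<Delta>\<close> sends the cochain of \<open>Alpha k\<close> to \<open>k\<close> times those of
  \<open>Alpha (k + 1) + Beta (k + 3)\<close>.  The generator \<open>\<alpha>\<^sub>1\<close> corresponds to \<open>Alpha 1 + Beta 3\<close> instead,
  whose \<open>k\<close>-th power is the following vector.\<close>

definition bv_coord :: "st_gen \<Rightarrow> st_gen \<Rightarrow>\<^sub>0 bit" where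
  "bv_coord g = (case g of Alpha k \<Rightarrow> bas (Alpha k) + sc (of_nat k) (bas (Beta (k + 2))) | Beta k \<Rightarrow> bas (Beta k))"

lemma bv_coord_invol: "lin bv_coord (lin bv_coord x) = x"
proof -
  have "lin bv_coord (bv_coord g) = bas g" for g
    by (cases g) (simp_all add: bv_coord_def additive_sc[OF additive_lin])
  then show ?thesis by (simp add: lin_lin)
qed

text \<open>The coefficient \<open>k\<close> is additive in the index and products of two
  \<open>Beta\<close> vanish, as for powers of one element.\<close>

lemma bv_coord_mult: "lin bv_coord (bilin st_mul x y) = bilin st_mul (lin bv_coord x) (lin bv_coord y)"
proof (rule biadditive_eqI[of "\<lambda>x y. lin bv_coord (bilin st_mul x y)" "\<lambda>x y. bilin st_mul (lin bv_coord x) (lin bv_coord y)"])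
  fix g h
  show "lin bv_coord (bilin st_mul (bas g) (bas h)) = bilin st_mul (lin bv_coord (bas g)) (lin bv_coord (bas h))"
    by (cases g; cases h) (simp_all add: bv_coord_def additive_sc[OF additive_bilin(1)]
        additive_sc[OF additive_bilin(2)] sc_add_left add_ac)
qed (simp_all add: additive_def)

text \<open>At \<open>Alpha k\<close> the coefficient \<open>(k + 1) (k + 2)\<close> appears, at
  \<open>Beta k\<close> the correction in \<open>bv_coord\<close> carries \<open>k (k - 1)\<close>;
  both are even.\<close>

lemma bv_coord_delta:
  "lin hip_coord (lin connes_coord (lin hip_coord (lin bv_coord x))) = lin bv_coord (lin st_delta x)"
proof -
  have "lin hip_coord (lin connes_coord (lin hip_coord (bv_coord g))) = lin bv_coord (st_delta g)" for g
  proof (cases g)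
    case (Alpha k)
    then show ?thesis
      by (simp add: bv_coord_def hip_coord_def connes_coord_def additive_sc[OF additive_lin] sc_add_left sc_add_right)
  next
    case (Beta k)
    then show ?thesis
      by (cases k) (simp_all add: bv_coord_def hip_coord_def connes_coord_def additive_sc[OF additive_lin]
          st_delta_Beta st_gamma_def sc_add_left sc_add_right add_ac del: st_delta.simps(2))
  qed
  then show ?thesis by (simp add: lin_lin)
qed

lemma bv_coord_deg: "lin bv_coord ` basis_part st_deg k = basis_part st_deg k"
proof -
  have "bv_coord g \<in> basis_part st_deg (st_deg g)" for g
    by (cases g) (auto simp: bv_coord_def sc_def intro!: basis_part_add)
  then have "lin bv_coord x \<in> basis_part st_deg k" if "x \<in> basis_part st_deg k" for x
    using that by (auto intro!: lin_in_basis_part)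
  then show ?thesis
    using bv_coord_invol by (metis (no_types, lifting) image_iff subsetI subset_antisym)
qed

section \<open>Assembly of the BV isomorphism\<close>

definition bv_iso :: "(st_gen \<Rightarrow>\<^sub>0 bit) \<Rightarrow> ((sph \<Rightarrow>\<^sub>0 bit) list \<Rightarrow> (sph \<Rightarrow>\<^sub>0 bit)) set" where
  "bv_iso x = {self_coch (lin bv_coord x)}"

lemma HH_bv_simps:
  "carrier (HH_bv sphB sphF) = range (\<lambda>x. {self_coch x})"
  "{self_coch x} \<otimes>\<^bsub>HH_bv sphB sphF\<^esub> {self_coch y} = {self_coch (bilin st_mul x y)}"
  "\<one>\<^bsub>HH_bv sphB sphF\<^esub> = {self_coch (bas (Alpha 0))}"
  "\<zero>\<^bsub>HH_bv sphB sphF\<^esub> = {self_coch 0}"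
  "{self_coch x} \<oplus>\<^bsub>HH_bv sphB sphF\<^esub> {self_coch y} = {self_coch (x + y)}"
  "bv_part (HH_bv sphB sphF) k = (\<lambda>x. {self_coch x}) ` basis_part st_deg k"
  by (simp_all add: HH_bv_def self.carrier_cohomology induced2_def self.coh_class_CH cup_coch
      cup_unit_coch class_add_singleton coch_add self.coh_part_CH self_dg)

lemma HH_bv_op: "bv_op (HH_bv sphB sphF) {self_coch x} =
    {self_coch (lin hip_coord (lin connes_coord (lin hip_coord x)))}"
proof -
  let ?y = "lin hip_coord (lin connes_coord (lin hip_coord x))"
  \<comment> \<open>By \<open>hip_coord_invol\<close> the value of Connes' operator is an explicit
    image under the inner product, so injectivity evaluates \<open>inv_into\<close>.\<close>
  have "bv_op (HH_bv sphB sphF) {self_coch x} =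
      inv_into (carrier (HH_self sphB)) (HH_hip_map sphB sphF) (HH_hip_map sphB sphF {self_coch ?y})"
    by (simp add: HH_bv_def HH_hip_map_coch HH_Connes_coch hip_coord_invol)
  also have "\<dots> = {self_coch ?y}"
    using HH_hip_map_iso
    by (intro inv_into_f_f) (auto simp: iso_def bij_betw_def self.carrier_cohomology)
  finally show ?thesis .
qed

lemma bv_iso_ring_iso: "bv_iso \<in> ring_iso string_bv (HH_bv sphB sphF)"
proof (rule ring_iso_memI)
  have "inj bv_iso"
    unfolding bv_iso_def by (rule injI) (metis bv_coord_invol injD self.inj_coch singleton_inject)
  moreover have "range bv_iso = range (\<lambda>x. {self_coch x})"
  proof -
    have "{self_coch x} = bv_iso (lin bv_coord x)" for x
      by (simp add: bv_iso_def bv_coord_invol)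
    then show ?thesis
      by (auto simp: bv_iso_def)
  qed
  ultimately show "bij_betw bv_iso (carrier string_bv) (carrier (HH_bv sphB sphF))"
    by (simp add: bij_betw_def HH_bv_simps)
qed (simp_all add: bv_iso_def HH_bv_simps bv_coord_mult, simp add: bv_coord_def)

lemma bv_iso_part: "bv_iso ` bv_part string_bv k = bv_part (HH_bv sphB sphF) k"
proof -
  have "bv_iso ` basis_part st_deg k = (\<lambda>x. {self_coch x}) ` (lin bv_coord ` basis_part st_deg k)"
    unfolding image_image bv_iso_def ..
  then show ?thesis
    by (simp add: bv_coord_deg HH_bv_simps)
qed

lemma bv_iso_op: "bv_op (HH_bv sphB sphF) (bv_iso x) = bv_iso (bv_op string_bv x)"
  by (simp add: bv_iso_def HH_bv_op bv_coord_delta)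

lemma bv_algebra_HH: "bv_algebra (HH_bv sphB sphF)"
proof (rule bv_algebra_transport[OF bv_algebra_string_bv bv_iso_ring_iso _ bv_iso_part bv_iso_op])
  show "bv_iso \<zero>\<^bsub>string_bv\<^esub> = \<zero>\<^bsub>HH_bv sphB sphF\<^esub>"
    by (simp add: bv_iso_def HH_bv_simps)
qed

lemma bv_isomorphic_HH: "bv_isomorphic (HH_bv sphB sphF) string_bv"
  using bv_isomorphic_sym[OF cring.axioms(1)[OF cring_string_bv] bv_iso_ring_iso _ bv_iso_part]
  by (simp add: bv_iso_op)

theorem theorem1p6:
  shows
    "dg_algebra tetA \<and> homotopy_inner_product tetA tetF \<and>
     dg_algebra sphB \<and> homotopy_inner_product sphB sphF \<and>
     dg_algebra_map sphB tetA (lin sph_to_tet) \<and>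
     transfer_hip (lin sph_to_tet) tetF = sphF \<and>
     cochain_map (CH sphB (self_bimod sphB)) (CH sphB (dual_bimod sphB)) (hip_map sphF) \<and>
     HH_hip_map sphB sphF \<in> iso (HH_self sphB) (HH_dual sphB) \<and>
     bv_algebra (HH_bv sphB sphF) \<and>
     bv_algebra string_bv \<and>
     bv_isomorphic (HH_bv sphB sphF) string_bv"
  using dg_algebra_tetA homotopy_inner_product_tetF dg_algebra_sphB homotopy_inner_product_sphF
    dg_algebra_map_sph_to_tet transfer_tetF cochain_map_sphF HH_hip_map_iso bv_algebra_HH
    bv_algebra_string_bv bv_isomorphic_HH
  by blast

end
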